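(* Let $(\mathcal{Q},\sigma)$ be a symmetric quiver of type $A_n$ ($n\geq2$) and $\varepsilon\in\{+1,-1\}$ such that $(\mathcal{Q},\varepsilon)$ is of non-split type. Let $M$ be an $\varepsilon$-representation of $\mathcal{Q}$ with respect to an $\varepsilon$-quadratic space $(V,\Psi)$, and let $L$ be an indecomposable subrepresentation of $M$. Let $\iota:L\hookrightarrow M$ be a generic embedding with (generic) quotient $Q$. Assume that: (1) there is a surjective homomorphism $Q\twoheadrightarrow\nabla L$; (2) $\mathrm{Ext}^1(L,K)=0$, where $K$ is the generic kernel of $Q\twoheadrightarrow\nabla L$. Then there exists an automorphism $g$ of the $\mathcal{Q}$-representation $M$ such that $j=g\circ\iota$ is an isotropic embedding of $L$ into $M$. In particular, $j$ is an isotropic and generic embedding.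
   Context: The ground field is $\mathbb{C}$; representations are finite-dimensional. Symmetric quiver of type $A_n$: $\mathcal{Q}$ is an orientation of the graph $1-2-\cdots-n$ with edges $e_i$ joining $i,i+1$; $\sigma(i)=n+1-i$, $\sigma(e_i)=e_{n-i}$, and $\sigma$ reverses the arrows of $\mathcal{Q}$: if $\alpha:i\to j$ is an arrow then $\sigma(\alpha):\sigma(j)\to\sigma(i)$. The pair $(\mathcal{Q},\varepsilon)$ is of split type if ($n$ odd and $\varepsilon=-1$) or ($n$ even and $\varepsilon=+1$); it is of non-split type if ($n$ odd and $\varepsilon=+1$) or ($n$ even and $\varepsilon=-1$). An $\varepsilon$-quadratic space is a finite-dimensional $\mathcal{Q}_0$-graded space $V$ with a non-degenerate bilinear form with $\langle V_i,V_j\rangle=0$ if $j\neq\sigma(i)$ and $\langle v,w\rangle=\varepsilon\langle w,v\rangle$; $\Psi(v)=\langle v,-\rangle$ denotes the induced isomorphism from $V$ to its twisted dual. An $\varepsilon$-representation with respect to it is a representation $M$ on $V$ with $\langle M_\alpha v,w\rangle+\langle v,M_{\sigma(\alpha)}w\rangle=0$ for all $\alpha:i\to j$, $v\in V_i$, $w\in V_{\sigma(j)}$. For a representation $L$ with underlying space $W$, $\nabla L$ has underlying space $(\nabla W)_i=W_{\sigma(i)}^*$ and maps $(\nabla L)_\alpha=-L_{\sigma(\alpha)}^*$. An embedding $j:L\hookrightarrow M$ is isotropic if $\langle j(l),j(l')\rangle=0$ for all $l,l'\in L$. Generic quotients and kernels: for representations $L,M$ such that $L$ embeds into $M$, let $\mathrm{Quot}(L,M)$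 be the set of points of the representation variety of dimension vector $\mathbf{dim}\,M-\mathbf{dim}\,L$ that are isomorphic to $M/\iota(L)$ for some monomorphism $\iota:L\to M$; it is an irreducible constructible set stable under base change. A generic quotient of $M$ by $L$ is a representation in $\mathrm{Quot}(L,M)$ whose orbit is dense in it (it exists and is unique up to isomorphism for Dynkin quivers); a monomorphism $\iota:L\to M$ with $M/\iota(L)$ isomorphic to the generic quotient is a generic embedding. Dually, for representations $Q,Z$ such that $Q$ surjects onto $Z$, the generic kernel of $Q\twoheadrightarrow Z$ is the representation whose orbit is dense in the set of all kernels of epimorphisms $Q\to Z$. *)

theory Defs
  imports Complex_Main "HOL-Library.Function_Algebras"
begin

section \<open>Complex vector spaces\<close>

class complex_vector = ab_group_add +
  fixes scaleC :: "complex \<Rightarrow> 'a \<Rightarrow> 'a"  (infixr \<open>*\<^sub>C\<close> 75)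
  assumes scaleC_add_right: "a *\<^sub>C (x + y) = a *\<^sub>C x + a *\<^sub>C y"
    and scaleC_add_left: "(a + b) *\<^sub>C x = a *\<^sub>C x + b *\<^sub>C x"
    and scaleC_scaleC: "a *\<^sub>C b *\<^sub>C x = (a * b) *\<^sub>C x"
    and scaleC_one: "1 *\<^sub>C x = x"

global_interpretation cvec: vector_space "scaleC :: complex \<Rightarrow> 'a \<Rightarrow> 'a::complex_vector"
  by standard (simp_all add: scaleC_add_right scaleC_add_left scaleC_scaleC scaleC_one)

instantiation complex :: complex_vector
begin
definition scaleC_complex_def: "a *\<^sub>C (x::complex) = a * x"
instance by standard (simp_all add: scaleC_complex_def algebra_simps)
end

instantiation "fun" :: (type, complex_vector) complex_vector
begin
definition scaleC_fun_def: "a *\<^sub>C f = (\<lambda>x. a *\<^sub>C f x)"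
instance
  by standard (simp_all add: scaleC_fun_def fun_eq_iff plus_fun_def
      scaleC_add_right scaleC_add_left scaleC_scaleC scaleC_one)
end

definition fin_dim_subspace :: "'v::complex_vector set \<Rightarrow> bool" where
  "fin_dim_subspace S \<longleftrightarrow> (\<exists>B. finite B \<and> S = cvec.span B)"

definition linear_between ::
  "'v::complex_vector set \<Rightarrow> 'w::complex_vector set \<Rightarrow> ('v \<Rightarrow> 'w) \<Rightarrow> bool" where
  "linear_between S T f \<longleftrightarrow>
     f ` S \<subseteq> T \<and>
     (\<forall>x\<in>S. \<forall>y\<in>S. f (x + y) = f x + f y) \<and>
     (\<forall>a. \<forall>x\<in>S. f (a *\<^sub>C x) = a *\<^sub>C f x)"

section \<open>Symmetric quivers of type \<open>A\<^sub>n\<close>\<close>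

text \<open>Vertices are \<open>1, \<dots>, n\<close>, and the number \<open>e \<in> {1..<n}\<close> names the edge
  \<open>e\<^sub>e\<close> between \<open>e\<close> and \<open>e + 1\<close>, which \<open>rightward\<close> orients as \<open>e \<rightarrow> e + 1\<close>
  (when true) or \<open>e + 1 \<rightarrow> e\<close>.\<close>

record quiver =
  num_verts :: nat
  rightward :: "nat \<Rightarrow> bool"

definition q_verts :: "quiver \<Rightarrow> nat set" where
  "q_verts \<Gamma> = {1..num_verts \<Gamma>}"

definition q_arrows :: "quiver \<Rightarrow> nat set" where
  "q_arrows \<Gamma> = {1..<num_verts \<Gamma>}"

definition arrow_tail :: "quiver \<Rightarrow> nat \<Rightarrow> nat" where
  "arrow_tail \<Gamma> e = (if rightward \<Gamma> e then e else e + 1)"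

definition arrow_head :: "quiver \<Rightarrow> nat \<Rightarrow> nat" where
  "arrow_head \<Gamma> e = (if rightward \<Gamma> e then e + 1 else e)"

definition vert_inv :: "quiver \<Rightarrow> nat \<Rightarrow> nat" where
  "vert_inv \<Gamma> i = num_verts \<Gamma> + 1 - i"

definition arrow_inv :: "quiver \<Rightarrow> nat \<Rightarrow> nat" where
  "arrow_inv \<Gamma> e = num_verts \<Gamma> - e"

definition symmetric_quiver :: "quiver \<Rightarrow> bool" where
  "symmetric_quiver \<Gamma> \<longleftrightarrow>
     (\<forall>e\<in>q_arrows \<Gamma>. arrow_tail \<Gamma> (arrow_inv \<Gamma> e) = vert_inv \<Gamma> (arrow_head \<Gamma> e) \<and>
                  arrow_head \<Gamma> (arrow_inv \<Gamma> e) = vert_inv \<Gamma> (arrow_tail \<Gamma> e))"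

definition non_split_type :: "quiver \<Rightarrow> complex \<Rightarrow> bool" where
  "non_split_type \<Gamma> \<epsilon> \<longleftrightarrow>
     (odd (num_verts \<Gamma>) \<and> \<epsilon> = 1) \<or> (even (num_verts \<Gamma>) \<and> \<epsilon> = - 1)"

section \<open>Representations\<close>

text \<open>The space at each vertex is a finite-dimensional subspace of an ambient vector space
  \<open>'v\<close>; no independence between different vertices is required, so that the underlying
  graded space is the external direct sum.  Values of \<open>rep_space\<close> and \<open>rep_map\<close> outside the
  quiver, and of \<open>rep_map M e\<close> outside \<open>rep_space M (arrow_tail \<Gamma> e)\<close>, are irrelevant.  The same
  applies to the components of homomorphisms.\<close>

record 'v rep =
  rep_space :: "nat \<Rightarrow> 'v set"
  rep_map :: "nat \<Rightarrow> 'v \<Rightarrow> 'v"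

definition is_rep :: "quiver \<Rightarrow> 'v::complex_vector rep \<Rightarrow> bool" where
  "is_rep \<Gamma> M \<longleftrightarrow>
     (\<forall>i\<in>q_verts \<Gamma>. fin_dim_subspace (rep_space M i)) \<and>
     (\<forall>e\<in>q_arrows \<Gamma>.
        linear_between (rep_space M (arrow_tail \<Gamma> e)) (rep_space M (arrow_head \<Gamma> e)) (rep_map M e))"

definition dim_vec :: "'v::complex_vector rep \<Rightarrow> nat \<Rightarrow> nat" where
  "dim_vec M i = cvec.dim (rep_space M i)"

definition is_hom :: "quiver \<Rightarrow> 'v::complex_vector rep \<Rightarrow> 'w::complex_vector rep
    \<Rightarrow> (nat \<Rightarrow> 'v \<Rightarrow> 'w) \<Rightarrow> bool" where
  "is_hom \<Gamma> M N f \<longleftrightarrow>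
     (\<forall>i\<in>q_verts \<Gamma>. linear_between (rep_space M i) (rep_space N i) (f i)) \<and>
     (\<forall>e\<in>q_arrows \<Gamma>. \<forall>x\<in>rep_space M (arrow_tail \<Gamma> e).
        f (arrow_head \<Gamma> e) (rep_map M e x) = rep_map N e (f (arrow_tail \<Gamma> e) x))"

definition is_mono :: "quiver \<Rightarrow> 'v::complex_vector rep \<Rightarrow> 'w::complex_vector rep
    \<Rightarrow> (nat \<Rightarrow> 'v \<Rightarrow> 'w) \<Rightarrow> bool" where
  "is_mono \<Gamma> M N f \<longleftrightarrow> is_hom \<Gamma> M N f \<and> (\<forall>i\<in>q_verts \<Gamma>. inj_on (f i) (rep_space M i))"

definition is_epi :: "quiver \<Rightarrow> 'v::complex_vector rep \<Rightarrow> 'w::complex_vector rep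
    \<Rightarrow> (nat \<Rightarrow> 'v \<Rightarrow> 'w) \<Rightarrow> bool" where
  "is_epi \<Gamma> M N f \<longleftrightarrow> is_hom \<Gamma> M N f \<and> (\<forall>i\<in>q_verts \<Gamma>. f i ` rep_space M i = rep_space N i)"

definition is_iso :: "quiver \<Rightarrow> 'v::complex_vector rep \<Rightarrow> 'w::complex_vector rep
    \<Rightarrow> (nat \<Rightarrow> 'v \<Rightarrow> 'w) \<Rightarrow> bool" where
  "is_iso \<Gamma> M N f \<longleftrightarrow> is_hom \<Gamma> M N f \<and> (\<forall>i\<in>q_verts \<Gamma>. bij_betw (f i) (rep_space M i) (rep_space N i))"

abbreviation is_automorphism :: "quiver \<Rightarrow> 'v::complex_vector rep
    \<Rightarrow> (nat \<Rightarrow> 'v \<Rightarrow> 'v) \<Rightarrow> bool" where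
  "is_automorphism \<Gamma> M g \<equiv> is_iso \<Gamma> M M g"

definition short_exact :: "quiver \<Rightarrow> 'u::complex_vector rep \<Rightarrow> (nat \<Rightarrow> 'u \<Rightarrow> 'v)
    \<Rightarrow> 'v::complex_vector rep \<Rightarrow> (nat \<Rightarrow> 'v \<Rightarrow> 'w) \<Rightarrow> 'w::complex_vector rep \<Rightarrow> bool" where
  "short_exact \<Gamma> A f B g C \<longleftrightarrow>
     is_rep \<Gamma> A \<and> is_rep \<Gamma> B \<and> is_rep \<Gamma> C \<and> is_mono \<Gamma> A B f \<and> is_epi \<Gamma> B C g \<and>
     (\<forall>i\<in>q_verts \<Gamma>. f i ` rep_space A i = {x \<in> rep_space B i. g i x = 0})"

definition is_subrep :: "quiver \<Rightarrow> 'v::complex_vector rep \<Rightarrow> 'v rep \<Rightarrow> bool" where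
  "is_subrep \<Gamma> L M \<longleftrightarrow>
     is_rep \<Gamma> L \<and> (\<forall>i\<in>q_verts \<Gamma>. rep_space L i \<subseteq> rep_space M i) \<and>
     (\<forall>e\<in>q_arrows \<Gamma>. \<forall>x\<in>rep_space L (arrow_tail \<Gamma> e). rep_map L e x = rep_map M e x)"

definition is_zero_rep :: "quiver \<Rightarrow> 'v::complex_vector rep \<Rightarrow> bool" where
  "is_zero_rep \<Gamma> M \<longleftrightarrow> (\<forall>i\<in>q_verts \<Gamma>. rep_space M i = {0})"

definition indecomposable :: "quiver \<Rightarrow> 'v::complex_vector rep \<Rightarrow> bool" where
  "indecomposable \<Gamma> L \<longleftrightarrow>
     is_rep \<Gamma> L \<and> \<not> is_zero_rep \<Gamma> L \<and>
     (\<forall>X Y. is_subrep \<Gamma> X L \<and> is_subrep \<Gamma> Y L \<and>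
        (\<forall>i\<in>q_verts \<Gamma>. rep_space X i \<inter> rep_space Y i = {0} \<and> rep_space L i = {x + y |x y. x \<in> rep_space X i \<and> y \<in> rep_space Y i})
        \<longrightarrow> is_zero_rep \<Gamma> X \<or> is_zero_rep \<Gamma> Y)"

text \<open>\<open>Ext\<^sup>1(L, K) = 0\<close> in the sense of Yoneda: every extension of \<open>L\<close> by \<open>K\<close> splits.
  Up to isomorphism every representation lives in the ambient space \<open>nat \<Rightarrow> complex\<close>,
  so it suffices that the middle term ranges over those.\<close>

definition ext1_vanishes :: "quiver \<Rightarrow> 'v::complex_vector rep \<Rightarrow> 'w::complex_vector rep \<Rightarrow> bool" where
  "ext1_vanishes \<Gamma> L K \<longleftrightarrow>
     (\<forall>(E :: (nat \<Rightarrow> complex) rep) f g. short_exact \<Gamma> K f E g L \<longrightarrow>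
        (\<exists>s. is_hom \<Gamma> L E s \<and> (\<forall>i\<in>q_verts \<Gamma>. \<forall>x\<in>rep_space L i. g i (s i x) = x)))"

text \<open>Functionals on \<open>S\<close> are normalised to be \<open>0\<close> outside \<open>S\<close>, so that they form a
  subspace of \<open>'v \<Rightarrow> complex\<close> isomorphic to \<open>S\<^sup>*\<close>.\<close>

definition dual_space :: "'v::complex_vector set \<Rightarrow> ('v \<Rightarrow> complex) set" where
  "dual_space S = {\<phi>. linear_between S UNIV \<phi> \<and> (\<forall>x. x \<notin> S \<longrightarrow> \<phi> x = 0)}"

definition nabla :: "quiver \<Rightarrow> 'v::complex_vector rep \<Rightarrow> ('v \<Rightarrow> complex) rep" where
  "nabla \<Gamma> L =
     \<lparr>rep_space = (\<lambda>i. dual_space (rep_space L (vert_inv \<Gamma> i))),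
      rep_map = (\<lambda>e \<phi> x. if x \<in> rep_space L (arrow_tail \<Gamma> (arrow_inv \<Gamma> e))
                     then - \<phi> (rep_map L (arrow_inv \<Gamma> e) x) else 0)\<rparr>"

section \<open>Quadratic spaces and \<open>\<epsilon>\<close>-representations\<close>

text \<open>A bilinear form on \<open>\<Oplus>\<^sub>i V\<^sub>i\<close> is given by its components \<open>B i j\<close> on
  \<open>V\<^sub>i \<times> V\<^sub>j\<close>.  Because of the orthogonality condition, nondegeneracy may be tested
  on homogeneous vectors.\<close>

definition quadratic_space :: "quiver \<Rightarrow> complex \<Rightarrow> (nat \<Rightarrow> 'v::complex_vector set)
    \<Rightarrow> (nat \<Rightarrow> nat \<Rightarrow> 'v \<Rightarrow> 'v \<Rightarrow> complex) \<Rightarrow> bool" where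
  "quadratic_space \<Gamma> \<epsilon> V B \<longleftrightarrow>
     (\<forall>i\<in>q_verts \<Gamma>. fin_dim_subspace (V i)) \<and>
     (\<forall>i\<in>q_verts \<Gamma>. \<forall>j\<in>q_verts \<Gamma>.
        (\<forall>v\<in>V i. linear_between (V j) UNIV (\<lambda>w. B i j v w)) \<and>
        (\<forall>w\<in>V j. linear_between (V i) UNIV (\<lambda>v. B i j v w)) \<and>
        (j \<noteq> vert_inv \<Gamma> i \<longrightarrow> (\<forall>v\<in>V i. \<forall>w\<in>V j. B i j v w = 0)) \<and>
        (\<forall>v\<in>V i. \<forall>w\<in>V j. B i j v w = \<epsilon> * B j i w v)) \<and>
     (\<forall>i\<in>q_verts \<Gamma>. \<forall>v\<in>V i. (\<forall>j\<in>q_verts \<Gamma>. \<forall>w\<in>V j. B i j v w = 0) \<longrightarrow> v = 0)"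

definition eps_representation :: "quiver \<Rightarrow> complex \<Rightarrow> (nat \<Rightarrow> 'v::complex_vector set)
    \<Rightarrow> (nat \<Rightarrow> nat \<Rightarrow> 'v \<Rightarrow> 'v \<Rightarrow> complex) \<Rightarrow> 'v rep \<Rightarrow> bool" where
  "eps_representation \<Gamma> \<epsilon> V B M \<longleftrightarrow>
     quadratic_space \<Gamma> \<epsilon> V B \<and> is_rep \<Gamma> M \<and> (\<forall>i\<in>q_verts \<Gamma>. rep_space M i = V i) \<and>
     (\<forall>e\<in>q_arrows \<Gamma>. \<forall>v\<in>V (arrow_tail \<Gamma> e). \<forall>w\<in>V (vert_inv \<Gamma> (arrow_head \<Gamma> e)).
        B (arrow_head \<Gamma> e) (vert_inv \<Gamma> (arrow_head \<Gamma> e)) (rep_map M e v) w +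
        B (arrow_tail \<Gamma> e) (vert_inv \<Gamma> (arrow_tail \<Gamma> e)) v (rep_map M (arrow_inv \<Gamma> e) w) = 0)"

definition isotropic_embedding :: "quiver \<Rightarrow> (nat \<Rightarrow> nat \<Rightarrow> 'v \<Rightarrow> 'v \<Rightarrow> complex)
    \<Rightarrow> 'u::complex_vector rep \<Rightarrow> 'v::complex_vector rep \<Rightarrow> (nat \<Rightarrow> 'u \<Rightarrow> 'v) \<Rightarrow> bool" where
  "isotropic_embedding \<Gamma> B L M f \<longleftrightarrow>
     is_mono \<Gamma> L M f \<and>
     (\<forall>i\<in>q_verts \<Gamma>. \<forall>j\<in>q_verts \<Gamma>. \<forall>x\<in>rep_space L i. \<forall>y\<in>rep_space L j. B i j (f i x) (f j y) = 0)"

section \<open>Representation varieties, generic quotients and generic kernels\<close>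

text \<open>A point of the representation variety consists of the entries \<open>A (e, r, c)\<close>
  (row \<open>r\<close>, column \<open>c\<close>, both counted from \<open>0\<close>) of one matrix for each arrow \<open>e\<close>.\<close>

type_synonym rep_point = "nat \<times> nat \<times> nat \<Rightarrow> complex"

definition rep_variety :: "quiver \<Rightarrow> (nat \<Rightarrow> nat) \<Rightarrow> rep_point set" where
  "rep_variety \<Gamma> d =
     {A. \<forall>e r c. \<not> (e \<in> q_arrows \<Gamma> \<and> r < d (arrow_head \<Gamma> e) \<and> c < d (arrow_tail \<Gamma> e)) \<longrightarrow> A (e, r, c) = 0}"

text \<open>The representation defined by a point, on the spaces \<open>\<complex>\<^bsup>d i\<^esup>\<close> realised as sequences
  vanishing from \<open>d i\<close> on.\<close>

definition rep_of :: "quiver \<Rightarrow> (nat \<Rightarrow> nat) \<Rightarrow> rep_point \<Rightarrow> (nat \<Rightarrow> complex) rep" where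
  "rep_of \<Gamma> d A =
     \<lparr>rep_space = (\<lambda>i. {x. \<forall>k\<ge>d i. x k = 0}),
      rep_map = (\<lambda>e x r. \<Sum>c<d (arrow_tail \<Gamma> e). A (e, r, c) * x c)\<rparr>"

text \<open>Two points lie in the same orbit under base change exactly when some family of
  invertible linear maps intertwines them.\<close>

definition base_change_orbit :: "quiver \<Rightarrow> (nat \<Rightarrow> nat) \<Rightarrow> rep_point \<Rightarrow> rep_point set" where
  "base_change_orbit \<Gamma> d A = {A' \<in> rep_variety \<Gamma> d. \<exists>f. is_iso \<Gamma> (rep_of \<Gamma> d A) (rep_of \<Gamma> d A') f}"

inductive regular_function :: "(('i \<Rightarrow> complex) \<Rightarrow> complex) \<Rightarrow> bool" where
  const: "regular_function (\<lambda>_. a)"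
| coord: "regular_function (\<lambda>A. A i)"
| add: "regular_function p \<Longrightarrow> regular_function q \<Longrightarrow> regular_function (\<lambda>A. p A + q A)"
| mult: "regular_function p \<Longrightarrow> regular_function q \<Longrightarrow> regular_function (\<lambda>A. p A * q A)"

definition zariski_closure :: "('i \<Rightarrow> complex) set \<Rightarrow> ('i \<Rightarrow> complex) set" where
  "zariski_closure S = {x. \<forall>p. regular_function p \<and> (\<forall>y\<in>S. p y = 0) \<longrightarrow> p x = 0}"

definition zariski_dense_in :: "('i \<Rightarrow> complex) set \<Rightarrow> ('i \<Rightarrow> complex) set \<Rightarrow> bool" where
  "zariski_dense_in S T \<longleftrightarrow> S \<subseteq> T \<and> T \<subseteq> zariski_closure S"

abbreviation dim_diff :: "'v::complex_vector rep \<Rightarrow> 'w::complex_vector rep \<Rightarrow> nat \<Rightarrow> nat" where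
  "dim_diff M L \<equiv> (\<lambda>i. dim_vec M i - dim_vec L i)"

text \<open>A representation is isomorphic to \<open>M/\<iota>(L)\<close>, respectively to the kernel of \<open>p\<close>, exactly
  when it completes \<open>\<iota>\<close>, respectively \<open>p\<close>, to a short exact sequence.\<close>

definition quot_set :: "quiver \<Rightarrow> 'u::complex_vector rep \<Rightarrow> 'v::complex_vector rep \<Rightarrow> rep_point set" where
  "quot_set \<Gamma> L M =
     {A \<in> rep_variety \<Gamma> (dim_diff M L). \<exists>\<iota> \<pi>. short_exact \<Gamma> L \<iota> M \<pi> (rep_of \<Gamma> (dim_diff M L) A)}"

definition generic_quotient :: "quiver \<Rightarrow> 'u::complex_vector rep \<Rightarrow> 'v::complex_vector rep
    \<Rightarrow> rep_point \<Rightarrow> bool" where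
  "generic_quotient \<Gamma> L M A \<longleftrightarrow>
     A \<in> quot_set \<Gamma> L M \<and> zariski_dense_in (base_change_orbit \<Gamma> (dim_diff M L) A) (quot_set \<Gamma> L M)"

definition generic_embedding :: "quiver \<Rightarrow> 'u::complex_vector rep \<Rightarrow> 'v::complex_vector rep
    \<Rightarrow> (nat \<Rightarrow> 'u \<Rightarrow> 'v) \<Rightarrow> bool" where
  "generic_embedding \<Gamma> L M \<iota> \<longleftrightarrow>
     is_mono \<Gamma> L M \<iota> \<and>
     (\<exists>A \<pi>. generic_quotient \<Gamma> L M A \<and> short_exact \<Gamma> L \<iota> M \<pi> (rep_of \<Gamma> (dim_diff M L) A))"

definition kernel_set :: "quiver \<Rightarrow> 'u::complex_vector rep \<Rightarrow> 'v::complex_vector rep \<Rightarrow> rep_point set" where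
  "kernel_set \<Gamma> Q Z =
     {A \<in> rep_variety \<Gamma> (dim_diff Q Z). \<exists>\<kappa> p. short_exact \<Gamma> (rep_of \<Gamma> (dim_diff Q Z) A) \<kappa> Q p Z}"

definition generic_kernel :: "quiver \<Rightarrow> 'u::complex_vector rep \<Rightarrow> 'v::complex_vector rep
    \<Rightarrow> rep_point \<Rightarrow> bool" where
  "generic_kernel \<Gamma> Q Z A \<longleftrightarrow>
     A \<in> kernel_set \<Gamma> Q Z \<and> zariski_dense_in (base_change_orbit \<Gamma> (dim_diff Q Z) A) (kernel_set \<Gamma> Q Z)"

end

theory Submission
  imports "Jordan_Normal_Form.Determinant" "HOL-Library.Product_Plus" Defs
begin

text \<open>
  Composing an embedding \<open>u : L \<rightarrow> M\<close> with \<open>M \<cong> \<nabla>M\<close> and with the dual \<open>\<nabla>M \<rightarrow> \<nabla>L\<close> of \<open>u\<close> gives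
  a homomorphism \<open>L \<rightarrow> \<nabla>L\<close>, and \<open>u\<close> is isotropic exactly when this homomorphism is zero. An
  indecomposable \<open>L\<close> is an interval, so \<open>Hom(L, \<nabla>L)\<close> is at most one-dimensional and the
  construction amounts to a scalar bilinear form on \<open>Hom(L, M)\<close>. In the non-split case this form is
  symmetric, and the theorem asks for an isotropic vector of it in the orbit of \<open>\<iota>\<close> under \<open>Aut(M)\<close>.

  Decompose \<open>M\<close> into intervals, called strings below (\<open>string_basis_exists\<close>). The form only depends
  on the value of a homomorphism at a middle vertex, hence on the coordinates of that value with
  respect to the strings through the middle. Automorphisms of \<open>M\<close> rescale these coordinates
  independently, and they add multiples of coordinate \<open>k\<close> to coordinate \<open>l\<close> whenever an endomorphism
  of \<open>M\<close> leads from string \<open>k\<close> to string \<open>l\<close>. The lemma \<open>isotropic_vector_in_orbit\<close> is elementary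
  algebra about such an orbit: a complex polynomial in one variable without a zero is constant, and
  one without a nonzero zero is a monomial. If the orbit had no isotropic vector, these two facts
  would leave a single nonzero coefficient of the form, and it would have rank one. Three properties
  of the situation enter.

  \<^item> Comparison (\<open>gram_compare\<close>): if the strings \<open>k\<close> and \<open>l\<close> are not orthogonal, then endomorphisms
    lead from \<open>k\<close> to a string that is not orthogonal to \<open>k\<close>, or from \<open>l\<close> to a string that is not
    orthogonal to \<open>l\<close>. The reason is that the possible left ends of strings through the middle are
    totally ordered by the existence of maps. If \<open>k\<close> maps to the dual of \<open>l\<close>, comparing ends shows
    that \<open>k\<close> or \<open>l\<close> maps to its own dual.

  \<^item> Genericity (\<open>generic_reaches\<close>): a string on which some homomorphism \<open>L \<rightarrow> M\<close> has a nonzero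
    middle coordinate can be reached from a string on which \<open>\<iota>\<close> has one. Otherwise every homomorphism
    from \<open>M\<close> to that string vanishes on \<open>\<iota>\<close>, whereas some do not vanish on a perturbation of \<open>\<iota>\<close>,
    so that the quotient by the perturbed embedding has fewer homomorphisms to the string than the
    generic quotient. This contradicts the semicontinuity of \<open>dim Hom\<close>, which is proved as
    \<open>kernel_dim_semicontinuous\<close>.

  \<^item> Rank at least two (\<open>form_has_rank_two\<close>): suppose that \<open>\<iota>\<close> is not isotropic and let
    \<open>\<theta> : L \<rightarrow> \<nabla>L\<close> be the nonzero homomorphism that it induces. As \<open>Ext\<^sup>1(L, K) = 0\<close>, the map \<open>\<theta>\<close>
    lifts along \<open>Q \<rightarrow> \<nabla>L\<close>, and then along \<open>M \<rightarrow> Q\<close> to some \<open>h : L \<rightarrow> M\<close>. The composite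
    \<open>M \<rightarrow> Q \<rightarrow> \<nabla>L\<close> is dual to some \<open>w : L \<rightarrow> M\<close>. It kills \<open>\<iota>\<close> and sends \<open>h\<close> to \<open>\<theta>\<close>, so \<open>w\<close> is
    orthogonal to \<open>\<iota>\<close> but not to \<open>h\<close>. For a form of rank one that does not vanish on \<open>\<iota>\<close> this is
    impossible.
\<close>

section \<open>Isotropic vectors in an orbit\<close>

lemma complex_quadratic_roots:
  fixes A :: complex
  assumes "A \<noteq> 0"
  obtains r s where "\<And>z. A * z\<^sup>2 + 2 * B * z + C = A * (z - r) * (z - s)"
proof -
  define d where "d = csqrt (B\<^sup>2 - A * C)"
  have d: "d * d = B * B - A * C"
    unfolding d_def by (metis power2_csqrt power2_eq_square)
  show ?thesis
  proof (rule that[of "(- B + d) / A" "(- B - d) / A"])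
    fix z
    have "A * (z - (- B + d) / A) * (z - (- B - d) / A)
        = ((A * z + B) * (A * z + B) - d * d) / A"
      using assms by (simp add: field_simps)
    also have "\<dots> = A * z\<^sup>2 + 2 * B * z + C"
      unfolding d using assms by (simp add: field_simps power2_eq_square)
    finally show "A * z\<^sup>2 + 2 * B * z + C = A * (z - (- B + d) / A) * (z - (- B - d) / A)"
      by simp
  qed
qed

lemma quadratic_without_root:
  fixes a b d :: complex
  assumes "\<And>s. a + 2 * s * b + s\<^sup>2 * d \<noteq> 0"
  shows "b = 0" "d = 0"
proof -
  show d: "d = 0"
  proof (rule ccontr)
    assume "d \<noteq> 0"
    then obtain r s where "\<And>z. d * z\<^sup>2 + 2 * b * z + a = d * (z - r) * (z - s)"
      using complex_quadratic_roots[of d b a] by blast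
    from this[of r] assms[of r] show False by (simp add: algebra_simps)
  qed
  show "b = 0"
  proof (rule ccontr)
    assume "b \<noteq> 0"
    then show False using assms[of "- a / (2 * b)"] d by (simp add: field_simps)
  qed
qed

lemma quadratic_without_nonzero_root:
  fixes A B C :: complex
  assumes "A \<noteq> 0" and nz: "\<And>s. s \<noteq> 0 \<Longrightarrow> C + 2 * s * B + s\<^sup>2 * A \<noteq> 0"
  shows "B = 0" "C = 0"
proof -
  obtain r s where rs: "\<And>z. A * z\<^sup>2 + 2 * B * z + C = A * (z - r) * (z - s)"
    using complex_quadratic_roots[OF assms(1)] by blast
  have "r = 0" using rs[of r] nz[of r] by (auto simp: algebra_simps)
  moreover have "s = 0" using rs[of s] nz[of s] by (auto simp: algebra_simps)
  ultimately have eq: "A * z\<^sup>2 + 2 * B * z + C = A * z\<^sup>2" for z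
    using rs[of z] by (simp add: power2_eq_square)
  from eq[of 0] show "C = 0" by simp
  with eq[of 1] show "B = 0" by simp
qed

definition bilin :: "'k set \<Rightarrow> ('k \<Rightarrow> 'k \<Rightarrow> complex) \<Rightarrow> ('k \<Rightarrow> complex) \<Rightarrow> ('k \<Rightarrow> complex) \<Rightarrow> complex"
  where "bilin K \<beta> x y = (\<Sum>k\<in>K. \<Sum>l\<in>K. \<beta> k l * x k * y l)"

lemma bilin_update:
  assumes fin: "finite K" and l: "l \<in> K"
    and sym: "\<And>k l. k \<in> K \<Longrightarrow> l \<in> K \<Longrightarrow> \<beta> k l = \<beta> l k"
  shows "bilin K \<beta> (x(l := x l + s)) (x(l := x l + s))
       = bilin K \<beta> x x + 2 * s * (\<Sum>j\<in>K. \<beta> j l * x j) + s\<^sup>2 * \<beta> l l"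
proof -
  define e where "e k = (if k = l then s else 0)" for k
  have upd: "x(l := x l + s) = (\<lambda>k. x k + e k)" by (auto simp: e_def)
  have s1: "(\<Sum>k\<in>K. f k * e k) = f l * s" for f :: "'a \<Rightarrow> complex"
  proof -
    have "(\<Sum>k\<in>K. f k * e k) = (\<Sum>k\<in>K. if k = l then f k * s else 0)"
      by (rule sum.cong) (auto simp: e_def)
    then show ?thesis using fin l by simp
  qed
  have xe: "(\<Sum>k\<in>K. \<Sum>j\<in>K. \<beta> k j * x k * e j) = s * (\<Sum>j\<in>K. \<beta> j l * x j)"
    unfolding s1 by (simp add: sum_distrib_left algebra_simps)
  have "(\<Sum>k\<in>K. \<Sum>j\<in>K. \<beta> k j * e k * x j) = (\<Sum>k\<in>K. (\<Sum>j\<in>K. \<beta> k j * x j) * e k)"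
    by (simp add: sum_distrib_left sum_distrib_right algebra_simps)
  also have "\<dots> = (\<Sum>j\<in>K. \<beta> l j * x j) * s" by (rule s1)
  also have "\<dots> = s * (\<Sum>j\<in>K. \<beta> j l * x j)"
    using sym l by (simp add: mult.commute)
  finally have ex: "(\<Sum>k\<in>K. \<Sum>j\<in>K. \<beta> k j * e k * x j) = s * (\<Sum>j\<in>K. \<beta> j l * x j)" .
  have "(\<Sum>k\<in>K. \<Sum>j\<in>K. \<beta> k j * e k * e j) = (\<Sum>k\<in>K. \<beta> k l * e k * s)"
    by (simp add: s1)
  also have "\<dots> = (\<Sum>k\<in>K. (\<beta> k l * s) * e k)" by (simp add: algebra_simps)
  also have "\<dots> = s\<^sup>2 * \<beta> l l" by (simp add: s1 power2_eq_square)
  finally have ee: "(\<Sum>k\<in>K. \<Sum>j\<in>K. \<beta> k j * e k * e j) = s\<^sup>2 * \<beta> l l" .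
  have "bilin K \<beta> (\<lambda>k. x k + e k) (\<lambda>k. x k + e k)
      = bilin K \<beta> x x + (\<Sum>k\<in>K. \<Sum>j\<in>K. \<beta> k j * x k * e j)
      + (\<Sum>k\<in>K. \<Sum>j\<in>K. \<beta> k j * e k * x j) + (\<Sum>k\<in>K. \<Sum>j\<in>K. \<beta> k j * e k * e j)"
    unfolding bilin_def by (simp add: algebra_simps sum.distrib)
  then show ?thesis unfolding upd xe ex ee by simp
qed

text \<open>
  If the form has no zero on the orbit, a shear yields a quadratic polynomial without zeros, so its
  linear and quadratic coefficients vanish. Combined with rescaling, this says that a coordinate
  reached by a shear from the support of a vector of the orbit is orthogonal to that support. Hence
  \<open>compare\<close> provides a nonzero diagonal coefficient as soon as some coefficient on the support of \<open>v\<close>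
  is nonzero. Rescaling the corresponding coordinate gives a quadratic polynomial whose only zero
  can be \<open>0\<close>, and this leaves no other nonzero coefficient on the support. The assumption \<open>gen\<close>
  carries this over to all coordinates in \<open>T\<close>. A form with a single nonzero coefficient, which is
  nonzero on \<open>v\<close>, cannot make \<open>w\<close> orthogonal to \<open>v\<close> but not to \<open>h\<close>.
\<close>

lemma isotropic_vector_in_orbit:
  fixes K :: "'k set" and \<beta> :: "'k \<Rightarrow> 'k \<Rightarrow> complex" and le :: "'k \<Rightarrow> 'k \<Rightarrow> bool"
    and Orb :: "('k \<Rightarrow> complex) set"
  assumes fin: "finite K"
    and sym: "\<And>k l. k \<in> K \<Longrightarrow> l \<in> K \<Longrightarrow> \<beta> k l = \<beta> l k"
    and v: "v \<in> Orb"
    and shear: "\<And>x k l t. x \<in> Orb \<Longrightarrow> k \<in> K \<Longrightarrow> l \<in> K \<Longrightarrow> k \<noteq> l \<Longrightarrow> le k l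
                  \<Longrightarrow> x(l := x l + t * x k) \<in> Orb"
    and torus: "\<And>x c. x \<in> Orb \<Longrightarrow> \<forall>k\<in>K. c k \<noteq> 0 \<Longrightarrow> (\<lambda>k. c k * x k) \<in> Orb"
    and compare: "\<And>k l. k \<in> K \<Longrightarrow> l \<in> K \<Longrightarrow> \<beta> k l \<noteq> 0 \<Longrightarrow>
        (\<exists>j\<in>K. le k j \<and> \<beta> j k \<noteq> 0) \<or> (\<exists>j\<in>K. le l j \<and> \<beta> j l \<noteq> 0)"
    and gen: "\<And>l. l \<in> T \<Longrightarrow> \<exists>k\<in>K. v k \<noteq> 0 \<and> le k l"
    and hT: "\<And>k. k \<in> K \<Longrightarrow> h k \<noteq> 0 \<Longrightarrow> k \<in> T"
    and wT: "\<And>k. k \<in> K \<Longrightarrow> w k \<noteq> 0 \<Longrightarrow> k \<in> T"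
    and vw: "bilin K \<beta> v w = 0" and hw: "bilin K \<beta> h w \<noteq> 0"
  shows "\<exists>x\<in>Orb. bilin K \<beta> x x = 0"
proof (rule ccontr)
  assume "\<not> ?thesis"
  then have aniso: "bilin K \<beta> x x \<noteq> 0" if "x \<in> Orb" for x using that by blast
  have upd: "bilin K \<beta> (x(l := x l + s)) (x(l := x l + s))
       = bilin K \<beta> x x + 2 * s * (\<Sum>j\<in>K. \<beta> j l * x j) + s\<^sup>2 * \<beta> l l" if "l \<in> K" for l x s
    by (rule bilin_update[OF fin that sym])
  \<comment> \<open>Along a shear that reaches coordinate \<open>l\<close> the form is a quadratic polynomial in the parameter.\<close>
  have C1: "(\<Sum>i\<in>K. \<beta> i l * x i) = 0"
    if x: "x \<in> Orb" and kl: "k \<in> K" "l \<in> K" "k \<noteq> l" "le k l" "x k \<noteq> 0" for x k l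
  proof (rule quadratic_without_root(1))
    fix s
    have "x(l := x l + (s / x k) * x k) \<in> Orb" using shear[OF x kl(1-4)] .
    then have "x(l := x l + s) \<in> Orb" using kl(5) by simp
    from aniso[OF this]
    show "bilin K \<beta> x x + 2 * s * (\<Sum>i\<in>K. \<beta> i l * x i) + s\<^sup>2 * \<beta> l l \<noteq> 0"
      using upd[of l x s] kl(2) by simp
  qed
  have sumupd: "(\<Sum>i\<in>K. \<beta> i l * (x(j := a)) i) = (\<Sum>i\<in>K. \<beta> i l * x i) + \<beta> j l * (a - x j)"
    if "j \<in> K" for x j l a
    using fin that by (simp add: sum.remove[of K j] algebra_simps)
  \<comment> \<open>Doubling coordinate \<open>j\<close> separates its contribution to the sum in \<open>C1\<close>.\<close>
  have C2: "\<beta> j l = 0"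
    if x: "x \<in> Orb" and kl: "k \<in> K" "l \<in> K" "k \<noteq> l" "le k l" "x k \<noteq> 0"
      and j: "j \<in> K" "x j \<noteq> 0" for x k l j
  proof -
    have "(\<lambda>i. (if i = j then 2 else 1) * x i) \<in> Orb" by (rule torus[OF x]) simp
    moreover have "(\<lambda>i. (if i = j then 2 else 1) * x i) = x(j := 2 * x j)" by auto
    ultimately have x': "x(j := 2 * x j) \<in> Orb" by simp
    have "(\<Sum>i\<in>K. \<beta> i l * (x(j := 2 * x j)) i) = 0"
      by (rule C1[OF x' kl(1-4)]) (use kl(5) j(2) in auto)
    then show ?thesis using sumupd[OF j(1)] C1[OF x kl] j(2) by simp
  qed
  have diag: "\<beta> p p \<noteq> 0 \<or> \<beta> l l \<noteq> 0"
    if "\<beta> p l \<noteq> 0" "p \<in> K" "l \<in> K" "v p \<noteq> 0" "v l \<noteq> 0" for p l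
  proof -
    have *: "\<beta> p p \<noteq> 0" if "\<exists>j\<in>K. le p j \<and> \<beta> j p \<noteq> 0" "p \<in> K" "v p \<noteq> 0" for p
      using that C2[OF v, of p _ p] sym by metis
    show ?thesis using compare[of p l] that * by blast
  qed
  \<comment> \<open>As a function of coordinate \<open>k\<close> the form is a quadratic polynomial whose only zero can be \<open>0\<close>,
    so it reduces to its leading term. Varying coordinate \<open>j\<close> isolates the coefficients at \<open>j\<close>.\<close>
  have only: "\<beta> j k = 0 \<and> \<beta> j j = 0"
    if k: "k \<in> K" "v k \<noteq> 0" "\<beta> k k \<noteq> 0" and j: "j \<in> K" "v j \<noteq> 0" "j \<noteq> k" for j k
  proof -
    define y where "y a = v(k := 0, j := a * v j)" for a :: complex
    have y: "(\<Sum>i\<in>K. \<beta> i k * y a i) = 0 \<and> bilin K \<beta> (y a) (y a) = 0" if a: "a \<noteq> 0" for a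
    proof -
      have nz: "bilin K \<beta> (y a) (y a) + 2 * s * (\<Sum>i\<in>K. \<beta> i k * y a i) + s\<^sup>2 * \<beta> k k \<noteq> 0"
        if "s \<noteq> 0" for s
      proof -
        have "(\<lambda>i. (if i = k then s / v k else if i = j then a else 1) * v i) \<in> Orb"
          by (rule torus[OF v]) (use that a k in auto)
        moreover have "(\<lambda>i. (if i = k then s / v k else if i = j then a else 1) * v i)
            = (y a)(k := y a k + s)"
          using k j by (auto simp: y_def)
        ultimately have "(y a)(k := y a k + s) \<in> Orb" by simp
        from aniso[OF this] show ?thesis using upd[of k "y a" s] k by simp
      qed
      show ?thesis using quadratic_without_nonzero_root[OF k(3) nz] by blast
    qed
    have step: "y a = (y 1)(j := y 1 j + (a - 1) * v j)" for a
      by (auto simp: y_def algebra_simps)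
    have "\<beta> j k * v j = 0"
      using y[of 1] y[of 2] sumupd[OF j(1), of k "y 1" "y 1 j + (2 - 1) * v j"]
      unfolding step[of 2] by simp
    then have 1: "\<beta> j k = 0" using j by simp
    define B where "B = (\<Sum>i\<in>K. \<beta> i j * y 1 i)"
    have q: "2 * ((a - 1) * v j) * B + ((a - 1) * v j)\<^sup>2 * \<beta> j j = 0" if "a \<noteq> 0" for a
      using y[OF that] y[of 1] upd[of j "y 1" "(a - 1) * v j"] j(1)
      unfolding step[of a] B_def by simp
    have "v j * (2 * B + v j * \<beta> j j) = 0" "v j * (4 * (B + v j * \<beta> j j)) = 0"
      using q[of 2] q[of 3] by (simp_all add: power2_eq_square algebra_simps)
    then have "2 * B + v j * \<beta> j j = 0" "B + v j * \<beta> j j = 0"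
      using j(2) by (metis mult_eq_0_iff zero_neq_numeral)+
    moreover have "v j * \<beta> j j = 2 * (B + v j * \<beta> j j) - (2 * B + v j * \<beta> j j)"
      by (simp add: algebra_simps)
    ultimately have "v j * \<beta> j j = 0" by simp
    then show ?thesis using 1 j by simp
  qed
  define S where "S = {k \<in> K. v k \<noteq> 0}"
  have SS: "p = l \<and> \<beta> p p \<noteq> 0" if "\<beta> p l \<noteq> 0" "p \<in> S" "l \<in> S" for p l
  proof -
    have K: "p \<in> K" "v p \<noteq> 0" "l \<in> K" "v l \<noteq> 0" using that(2,3) by (simp_all add: S_def)
    have "p = l"
    proof (rule ccontr)
      assume "p \<noteq> l"
      then show False
        using diag[OF that(1) K(1,3,2,4)] only[OF K(1,2) _ K(3,4)] only[OF K(3,4) _ K(1,2)]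
          that(1) sym[OF K(1,3)] by metis
    qed
    then show ?thesis using that(1) by simp
  qed
  \<comment> \<open>Outside the support \<open>p\<close> is reached by a shear from the support. If necessary, another shear first
    makes coordinate \<open>l\<close> nonzero, so that \<open>C2\<close> applies.\<close>
  have half: "p \<in> S" if bpl: "\<beta> p l \<noteq> 0" and p: "p \<in> K" "p \<in> T" and l: "l \<in> K" "l \<in> S \<or> l \<in> T" for p l
  proof (rule ccontr)
    assume pS: "p \<notin> S"
    obtain k1 where k1: "k1 \<in> K" "v k1 \<noteq> 0" "le k1 p" using gen p by blast
    have k1p: "k1 \<noteq> p" using pS k1 p by (auto simp: S_def)
    show False
    proof (cases "l \<in> S")
      case True
      then show False using C2[OF v k1(1) p(1) k1p k1(3) k1(2), of l] bpl sym[of p l] l p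
        by (auto simp: S_def)
    next
      case False
      then obtain k2 where k2: "k2 \<in> K" "v k2 \<noteq> 0" "le k2 l" using gen l by blast
      have ne: "k2 \<noteq> l" "k1 \<noteq> l" "v l = 0" using False k1 k2 l by (auto simp: S_def)
      have u: "v(l := v l + 1 * v k2) \<in> Orb"
        by (rule shear[OF v k2(1) l(1) ne(1) k2(3)])
      show False using C2[OF u k1(1) p(1) k1p k1(3), of l] bpl sym[of p l] l p k1 k2 ne by auto
    qed
  qed
  have key: "p \<in> S \<and> p = l \<and> \<beta> p p \<noteq> 0"
    if bpl: "\<beta> p l \<noteq> 0" and p: "p \<in> K" "p \<in> S \<or> p \<in> T" and l: "l \<in> K" "l \<in> S \<or> l \<in> T" for p l
  proof -
    have "p \<in> S" using half[OF bpl p(1) _ l] p(2) by blast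
    moreover have "l \<in> S"
    proof (cases "l \<in> S")
      case False
      moreover have "\<beta> l p \<noteq> 0" using bpl sym[OF p(1) l(1)] by simp
      ultimately show ?thesis using half[of l p] p l by blast
    qed
    ultimately show ?thesis using SS[OF bpl] by blast
  qed
  obtain k l where kl: "k \<in> K" "l \<in> K" "\<beta> k l * h k * w l \<noteq> 0"
    using hw unfolding bilin_def by (meson sum.not_neutral_contains_not_neutral)
  then have k: "k \<in> S" "k = l" "\<beta> k k \<noteq> 0"
    using key[of k l] hT[of k] wT[of l] by auto
  have "bilin K \<beta> v w = (\<Sum>p\<in>K. \<Sum>l\<in>K. if p = k then if l = k then \<beta> k k * v k * w k else 0 else 0)"
    unfolding bilin_def
  proof (intro sum.cong refl)
    fix p l assume pl: "p \<in> K" "l \<in> K"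
    show "\<beta> p l * v p * w l = (if p = k then if l = k then \<beta> k k * v k * w k else 0 else 0)"
    proof (cases "\<beta> p l * v p * w l = 0")
      case True
      then show ?thesis using k kl by auto
    next
      case False
      then have pS: "p \<in> S" "p = l" "\<beta> p p \<noteq> 0"
        using key[of p l] pl wT[of l] by (auto simp: S_def)
      then have "p = k" using only[of k p] k by (auto simp: S_def)
      then show ?thesis using pS by simp
    qed
  qed
  also have "\<dots> = (\<Sum>p\<in>K. if p = k then \<beta> k k * v k * w k else 0)"
    by (rule sum.cong[OF refl]) (use fin kl in simp)
  also have "\<dots> = \<beta> k k * v k * w k" using fin kl by simp
  finally show False using vw k kl by (auto simp: S_def)
qed

section \<open>Semicontinuity of the dimension of a kernel\<close>

lemma regular_function_sum:
  "(\<And>i. i \<in> I \<Longrightarrow> regular_function (f i)) \<Longrightarrow> regular_function (\<lambda>A. \<Sum>i\<in>I. f i A)"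
proof (induction I rule: infinite_finite_induct)
  case (insert x F)
  then show ?case using regular_function.add[of "f x" "\<lambda>A. \<Sum>i\<in>F. f i A"] by simp
qed (simp_all add: regular_function.const)

lemma regular_function_prod:
  "(\<And>i. i \<in> I \<Longrightarrow> regular_function (f i)) \<Longrightarrow> regular_function (\<lambda>A. \<Prod>i\<in>I. f i A)"
proof (induction I rule: infinite_finite_induct)
  case (insert x F)
  then show ?case using regular_function.mult[of "f x" "\<lambda>A. \<Prod>i\<in>F. f i A"] by simp
qed (simp_all add: regular_function.const)

lemma regular_function_det:
  assumes "\<And>i j. i < n \<Longrightarrow> j < n \<Longrightarrow> regular_function (\<lambda>A. F A i j)"
  shows "regular_function (\<lambda>A. det (mat n n (\<lambda>(i, j). F A i j)))"
proof -
  have "det (mat n n (\<lambda>(i, j). F A i j))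
      = (\<Sum>p | p permutes {0..<n}. signof p * (\<Prod>i = 0..<n. F A i (p i)))" for A
  proof -
    have "(\<Prod>i = 0..<n. mat n n (\<lambda>(i, j). F A i j) $$ (i, p i)) = (\<Prod>i = 0..<n. F A i (p i))"
      if "p permutes {0..<n}" for p
      by (rule prod.cong) (use permutes_in_image[OF that] in auto)
    then show ?thesis by (simp add: det_def)
  qed
  moreover have "regular_function (\<lambda>A. \<Sum>p | p permutes {0..<n}. signof p * (\<Prod>i = 0..<n. F A i (p i)))"
  proof (intro regular_function_sum regular_function.mult regular_function.const regular_function_prod)
    fix p i assume "p \<in> {p. p permutes {0..<n}}" "i \<in> {0..<n}"
    then show "regular_function (\<lambda>A. F A i (p i))"
      using permutes_in_image[of p "{0..<n}" i] assms by auto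
  qed
  ultimately show ?thesis by simp
qed

lemma singular_iff_kernel:
  fixes F :: "nat \<Rightarrow> nat \<Rightarrow> complex"
  shows "det (mat n n (\<lambda>(i, j). F i j)) = 0
     \<longleftrightarrow> (\<exists>v. (\<exists>j<n. v j \<noteq> 0) \<and> (\<forall>i<n. (\<Sum>j<n. F i j * v j) = 0))"
proof -
  let ?A = "mat n n (\<lambda>(i, j). F i j)"
  have row: "(?A *\<^sub>v v) $ i = (\<Sum>j<n. F i j * v $ j)" if "v \<in> carrier_vec n" "i < n" for v i
    using that by (auto simp: scalar_prod_def atLeast0LessThan intro!: sum.cong)
  have "det ?A = 0 \<longleftrightarrow> (\<exists>v. v \<in> carrier_vec n \<and> v \<noteq> 0\<^sub>v n \<and> ?A *\<^sub>v v = 0\<^sub>v n)"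
    by (rule det_0_iff_vec_prod_zero) simp
  also have "\<dots> \<longleftrightarrow> (\<exists>v. (\<exists>j<n. v j \<noteq> 0) \<and> (\<forall>i<n. (\<Sum>j<n. F i j * v j) = 0))"
  proof
    assume "\<exists>v. v \<in> carrier_vec n \<and> v \<noteq> 0\<^sub>v n \<and> ?A *\<^sub>v v = 0\<^sub>v n"
    then obtain v where v: "v \<in> carrier_vec n" "v \<noteq> 0\<^sub>v n" "?A *\<^sub>v v = 0\<^sub>v n" by blast
    have "\<exists>j<n. v $ j \<noteq> 0" using v(1,2) by (metis carrier_vecD eq_vecI index_zero_vec(1) index_zero_vec(2))
    moreover have "\<forall>i<n. (\<Sum>j<n. F i j * v $ j) = 0"
      using row[OF v(1)] v(3) by (metis index_zero_vec(1))
    ultimately show "\<exists>v. (\<exists>j<n. v j \<noteq> 0) \<and> (\<forall>i<n. (\<Sum>j<n. F i j * v j) = 0)" by blast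
  next
    assume "\<exists>v. (\<exists>j<n. v j \<noteq> 0) \<and> (\<forall>i<n. (\<Sum>j<n. F i j * v j) = 0)"
    then obtain v where v: "\<exists>j<n. v j \<noteq> 0" "\<forall>i<n. (\<Sum>j<n. F i j * v j) = 0" by blast
    have "vec n v \<noteq> 0\<^sub>v n" using v(1) by (metis index_vec index_zero_vec(1))
    moreover have "?A *\<^sub>v vec n v = 0\<^sub>v n"
    proof (rule eq_vecI)
      fix i assume "i < Matrix.dim_vec (0\<^sub>v n)"
      then have i: "i < n" by simp
      have "(?A *\<^sub>v vec n v) $ i = (\<Sum>j<n. F i j * v j)" using row[of "vec n v" i] i by simp
      then show "(?A *\<^sub>v vec n v) $ i = 0\<^sub>v n $ i" using v(2) i by simp
    qed simp
    ultimately show "\<exists>v. v \<in> carrier_vec n \<and> v \<noteq> 0\<^sub>v n \<and> ?A *\<^sub>v v = 0\<^sub>v n"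
      by (intro exI[of _ "vec n v"]) simp
  qed
  finally show ?thesis .
qed

lemma homogeneous_system:
  fixes \<gamma> :: "nat \<Rightarrow> nat \<Rightarrow> complex"
  assumes "n < N"
  obtains c where "\<exists>j<N. c j \<noteq> 0" "\<And>i. i < n \<Longrightarrow> (\<Sum>j<N. \<gamma> i j * c j) = 0"
proof -
  define F where "F i j = (if i < n then \<gamma> i j else 0)" for i j
  let ?A = "mat N N (\<lambda>(i, j). F i j)"
  have "det (mat N N (\<lambda>(i, j). F j i)) = 0"
    unfolding singular_iff_kernel
  proof (intro exI[of _ "\<lambda>j. if j = n then 1 else 0"] conjI allI impI)
    show "\<exists>j<N. (if j = n then 1 else 0) \<noteq> (0::complex)" using assms by auto
    show "(\<Sum>j<N. F j i * (if j = n then 1 else 0)) = 0" for i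
      by (rule sum.neutral) (auto simp: F_def)
  qed
  moreover have "mat N N (\<lambda>(i, j). F j i) = transpose_mat ?A" by (auto intro!: eq_matI)
  ultimately have "det ?A = 0" using det_transpose[of ?A N] by simp
  then obtain v where "\<exists>j<N. v j \<noteq> 0" "\<forall>i<N. (\<Sum>j<N. F i j * v j) = 0"
    unfolding singular_iff_kernel by blast
  then have v: "\<exists>j<N. v j \<noteq> 0" "\<forall>i<N. (\<Sum>j<N. F i j * v j) = 0" by auto
  have "(\<Sum>j<N. \<gamma> i j * v j) = 0" if "i < n" for i
    using v(2)[rule_format, of i] that assms by (simp add: F_def)
  with v(1) show ?thesis using that by blast
qed

text \<open>
  Independence is tested on \<open>D\<close> only, because the members of \<open>S\<close> are solutions of linear systems
  with unknowns indexed by \<open>D\<close> and have arbitrary values elsewhere.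
\<close>

definition admits_indep :: "nat \<Rightarrow> 'd set \<Rightarrow> ('d \<Rightarrow> complex) set \<Rightarrow> bool" where
  "admits_indep n D S \<longleftrightarrow> (\<exists>z. (\<forall>j<n. z j \<in> S) \<and>
      (\<forall>c. (\<forall>\<delta>\<in>D. (\<Sum>j<n. c j * z j \<delta>) = 0) \<longrightarrow> (\<forall>j<n. c j = 0)))"

lemma admits_indep_le_card:
  assumes fin: "finite D" and "admits_indep n D S"
  shows "n \<le> card D"
proof (rule ccontr)
  assume "\<not> n \<le> card D"
  then have lt: "card D < n" by simp
  obtain z where z: "\<And>c. (\<forall>\<delta>\<in>D. (\<Sum>j<n. c j * z j \<delta>) = 0) \<Longrightarrow> (\<forall>j<n. c j = (0::complex))"
    using assms(2) unfolding admits_indep_def by blast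
  obtain e where e: "bij_betw e {..<card D} D"
    using ex_bij_betw_nat_finite[OF fin] by (auto simp: atLeast0LessThan)
  obtain c where c: "\<exists>j<n. c j \<noteq> 0" "\<And>i. i < card D \<Longrightarrow> (\<Sum>j<n. z j (e i) * c j) = 0"
    using homogeneous_system[OF lt, of "\<lambda>i j. z j (e i)"] by blast
  have "(\<Sum>j<n. c j * z j \<delta>) = 0" if \<delta>D: "\<delta> \<in> D" for \<delta>
  proof -
    obtain i where "i < card D" "\<delta> = e i" using \<delta>D e unfolding bij_betw_def by blast
    then show ?thesis using c(2)[of i] by (simp add: mult.commute)
  qed
  then show False using z[of c] c(1) by blast
qed

text \<open>
  Suppose that at \<open>A'\<close> the solution space has a basis \<open>y\<^sub>1, \<dots>, y\<^sub>s\<close> with \<open>s < n\<close>. One determinant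
  then separates \<open>A'\<close> from \<open>Y\<close>, namely that of \<open>F(A')\<^sup>* F(A) + \<Sum>\<^sub>j y\<^sub>j y\<^sub>j\<^sup>*\<close> as a function of \<open>A\<close>. At
  \<open>A'\<close> the matrix is positive definite. For \<open>A\<close> in \<open>Y\<close> there are \<open>n > s\<close> independent solutions, so
  some nonzero solution is orthogonal to all \<open>y\<^sub>j\<close>, and the matrix kills it.
\<close>

lemma kernel_dim_semicontinuous:
  fixes F :: "('i \<Rightarrow> complex) \<Rightarrow> 'r \<Rightarrow> 'd \<Rightarrow> complex"
  assumes finD: "finite D" and finR: "finite R"
    and reg: "\<And>\<rho> \<delta>. regular_function (\<lambda>A. F A \<rho> \<delta>)"
    and Y: "\<And>A. A \<in> Y \<Longrightarrow> admits_indep n D {x. \<forall>\<rho>\<in>R. (\<Sum>\<delta>\<in>D. F A \<rho> \<delta> * x \<delta>) = 0}"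
    and A': "A' \<in> zariski_closure Y"
  shows "admits_indep n D {x. \<forall>\<rho>\<in>R. (\<Sum>\<delta>\<in>D. F A' \<rho> \<delta> * x \<delta>) = 0}"
proof (rule ccontr)
  define Sol where "Sol A = {x. \<forall>\<rho>\<in>R. (\<Sum>\<delta>\<in>D. F A \<rho> \<delta> * x \<delta>) = 0}" for A
  let ?P = "\<lambda>k. admits_indep k D (Sol A')"
  assume "\<not> admits_indep n D {x. \<forall>\<rho>\<in>R. (\<Sum>\<delta>\<in>D. F A' \<rho> \<delta> * x \<delta>) = 0}"
  then have nP: "\<not> ?P n" by (simp add: Sol_def)
  moreover have "?P 0" by (simp add: admits_indep_def)
  ultimately obtain s where s: "s < n" "?P s" "\<not> ?P (Suc s)"
  proof -
    have "\<exists>s<n. ?P s \<and> \<not> ?P (Suc s)"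
    proof (rule ccontr)
      assume *: "\<not> (\<exists>s<n. ?P s \<and> \<not> ?P (Suc s))"
      have "k \<le> n \<Longrightarrow> ?P k" for k using * \<open>?P 0\<close> by (induction k) auto
      then show False using nP by blast
    qed
    then show ?thesis using that by blast
  qed
  then obtain y where y: "\<And>j. j < s \<Longrightarrow> y j \<in> Sol A'"
    "\<And>c. (\<forall>\<delta>\<in>D. (\<Sum>j<s. c j * y j \<delta>) = 0) \<Longrightarrow> (\<forall>j<s. c j = 0)"
    unfolding admits_indep_def by blast
  have span: "\<exists>a. \<forall>\<delta>\<in>D. x \<delta> = (\<Sum>j<s. a j * y j \<delta>)" if x: "x \<in> Sol A'" for x
  proof -
    define y' where "y' j = (if j < s then y j else x)" for j
    have "\<forall>j<Suc s. y' j \<in> Sol A'" using y(1) x by (auto simp: y'_def)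
    then obtain c j0 where c: "\<forall>\<delta>\<in>D. (\<Sum>j<Suc s. c j * y' j \<delta>) = 0" "j0 < Suc s" "c j0 \<noteq> 0"
      using s(3) unfolding admits_indep_def by blast
    have c': "(\<Sum>j<s. c j * y j \<delta>) + c s * x \<delta> = 0" if "\<delta> \<in> D" for \<delta>
      using c(1) that by (simp add: y'_def)
    have cs: "c s \<noteq> 0"
    proof
      assume "c s = 0"
      then have "\<forall>j<s. c j = 0" using c' y(2)[of c] by simp
      then show False using c(2,3) \<open>c s = 0\<close> by (metis less_antisym)
    qed
    have "x \<delta> = (\<Sum>j<s. (- c j / c s) * y j \<delta>)" if "\<delta> \<in> D" for \<delta>
    proof -
      have "c s * (\<Sum>j<s. (- c j / c s) * y j \<delta>) = - (\<Sum>j<s. c j * y j \<delta>)"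
        using cs by (simp add: sum_distrib_left sum_negf)
      also have "\<dots> = c s * x \<delta>" using c'[OF that] by (simp add: add_eq_0_iff2)
      finally show ?thesis using cs by simp
    qed
    then show ?thesis by (intro exI[of _ "\<lambda>j. - c j / c s"]) blast
  qed
  define M where "M A \<delta> \<delta>' = (\<Sum>\<rho>\<in>R. cnj (F A' \<rho> \<delta>) * F A \<rho> \<delta>') + (\<Sum>j<s. y j \<delta> * cnj (y j \<delta>'))"
    for A \<delta> \<delta>'
  have M_apply: "(\<Sum>\<delta>'\<in>D. M A \<delta> \<delta>' * v \<delta>') = (\<Sum>\<rho>\<in>R. cnj (F A' \<rho> \<delta>) * (\<Sum>\<delta>'\<in>D. F A \<rho> \<delta>' * v \<delta>'))
      + (\<Sum>j<s. y j \<delta> * (\<Sum>\<delta>'\<in>D. cnj (y j \<delta>') * v \<delta>'))" for A \<delta> v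
  proof -
    have "(\<Sum>\<delta>'\<in>D. M A \<delta> \<delta>' * v \<delta>') = (\<Sum>\<delta>'\<in>D. \<Sum>\<rho>\<in>R. cnj (F A' \<rho> \<delta>) * (F A \<rho> \<delta>' * v \<delta>'))
       + (\<Sum>\<delta>'\<in>D. \<Sum>j<s. y j \<delta> * (cnj (y j \<delta>') * v \<delta>'))"
      unfolding M_def by (simp add: algebra_simps sum_distrib_right sum_distrib_left sum.distrib)
    also have "\<dots> = (\<Sum>\<rho>\<in>R. \<Sum>\<delta>'\<in>D. cnj (F A' \<rho> \<delta>) * (F A \<rho> \<delta>' * v \<delta>'))
       + (\<Sum>j<s. \<Sum>\<delta>'\<in>D. y j \<delta> * (cnj (y j \<delta>') * v \<delta>'))"
      by (intro arg_cong2[where f = "(+)"] sum.swap)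
    finally show ?thesis by (simp add: sum_distrib_left)
  qed
  define N where "N = card D"
  obtain e where e: "bij_betw e {..<N} D"
    using ex_bij_betw_nat_finite[OF finD] by (auto simp: atLeast0LessThan N_def)
  have reidx: "(\<Sum>j<N. f (e j)) = (\<Sum>\<delta>\<in>D. f \<delta>)" for f :: "'d \<Rightarrow> complex"
    by (rule sum.reindex_bij_betw[OF e])
  have onto: "\<exists>j<N. \<delta> = e j" if "\<delta> \<in> D" for \<delta> using that e unfolding bij_betw_def by blast
  have into: "e j \<in> D" if "j < N" for j using that e by (auto simp: bij_betw_def)
  define p where "p A = det (mat N N (\<lambda>(i, j). M A (e i) (e j)))" for A
  have "regular_function p"
    unfolding p_def M_def
    by (intro regular_function_det regular_function.add regular_function_sum regular_function.mult
        regular_function.const reg)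
  moreover have "p A = 0" if AY: "A \<in> Y" for A
  proof -
    obtain z where z: "\<And>j. j < n \<Longrightarrow> z j \<in> Sol A"
      "\<And>c. (\<forall>\<delta>\<in>D. (\<Sum>j<n. c j * z j \<delta>) = 0) \<Longrightarrow> (\<forall>j<n. c j = 0)"
    proof -
      have "admits_indep n D (Sol A)" using Y[OF AY] by (simp add: Sol_def)
      then obtain z where "\<forall>j<n. z j \<in> Sol A"
        "\<forall>c. (\<forall>\<delta>\<in>D. (\<Sum>j<n. c j * z j \<delta>) = 0) \<longrightarrow> (\<forall>j<n. c j = 0)"
        unfolding admits_indep_def by blast
      then show ?thesis using that by blast
    qed
    obtain c where c: "\<exists>j<n. c j \<noteq> 0"
      "\<And>i. i < s \<Longrightarrow> (\<Sum>j<n. (\<Sum>\<delta>\<in>D. cnj (y i \<delta>) * z j \<delta>) * c j) = 0"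
      using homogeneous_system[OF s(1), of "\<lambda>i j. \<Sum>\<delta>\<in>D. cnj (y i \<delta>) * z j \<delta>"] by blast
    define x where "x \<delta> = (\<Sum>j<n. c j * z j \<delta>)" for \<delta>
    have lin: "(\<Sum>\<delta>\<in>D. g \<delta> * x \<delta>) = (\<Sum>j<n. (\<Sum>\<delta>\<in>D. g \<delta> * z j \<delta>) * c j)" for g
    proof -
      have "(\<Sum>\<delta>\<in>D. g \<delta> * x \<delta>) = (\<Sum>\<delta>\<in>D. \<Sum>j<n. g \<delta> * z j \<delta> * c j)"
        by (simp add: x_def sum_distrib_left algebra_simps)
      also have "\<dots> = (\<Sum>j<n. \<Sum>\<delta>\<in>D. g \<delta> * z j \<delta> * c j)" by (rule sum.swap)
      finally show ?thesis by (simp add: sum_distrib_right)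
    qed
    have x1: "(\<Sum>\<delta>\<in>D. F A \<rho> \<delta> * x \<delta>) = 0" if "\<rho> \<in> R" for \<rho>
      unfolding lin using z(1) that by (simp add: Sol_def)
    have x2: "(\<Sum>\<delta>\<in>D. cnj (y i \<delta>) * x \<delta>) = 0" if "i < s" for i
      unfolding lin using c(2)[OF that] .
    obtain \<delta>0 where \<delta>0: "\<delta>0 \<in> D" "x \<delta>0 \<noteq> 0" using z(2)[of c] c(1) unfolding x_def by blast
    have Mx: "(\<Sum>\<delta>'\<in>D. M A \<delta> \<delta>' * x \<delta>') = 0" for \<delta>
      unfolding M_apply using x1 x2 by simp
    show ?thesis unfolding p_def singular_iff_kernel
    proof (intro exI[of _ "\<lambda>j. x (e j)"] conjI allI impI)
      show "\<exists>j<N. x (e j) \<noteq> 0" using onto[OF \<delta>0(1)] \<delta>0(2) by auto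
      show "(\<Sum>j<N. M A (e i) (e j) * x (e j)) = 0" for i
        using reidx[of "\<lambda>\<delta>. M A (e i) \<delta> * x \<delta>"] Mx by simp
    qed
  qed
  ultimately have "p A' = 0" using A' unfolding zariski_closure_def by blast
  then obtain u where u: "\<exists>j<N. u j \<noteq> 0" "\<And>i. i < N \<Longrightarrow> (\<Sum>j<N. M A' (e i) (e j) * u j) = 0"
    unfolding p_def singular_iff_kernel by blast
  define v where "v \<delta> = u (the_inv_into {..<N} e \<delta>)" for \<delta>
  have ve: "v (e j) = u j" if "j < N" for j
    using that e unfolding v_def bij_betw_def by (simp add: the_inv_into_f_f)
  have Mv: "(\<Sum>\<delta>'\<in>D. M A' \<delta> \<delta>' * v \<delta>') = 0" if \<delta>D: "\<delta> \<in> D" for \<delta>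
  proof -
    obtain i where i: "i < N" "\<delta> = e i" using onto[OF \<delta>D] by blast
    have "(\<Sum>\<delta>'\<in>D. M A' \<delta> \<delta>' * v \<delta>') = (\<Sum>j<N. M A' (e i) (e j) * v (e j))"
      using reidx[of "\<lambda>\<delta>'. M A' \<delta> \<delta>' * v \<delta>'"] i by simp
    also have "\<dots> = (\<Sum>j<N. M A' (e i) (e j) * u j)" by (rule sum.cong) (auto simp: ve)
    finally show ?thesis using u(2)[OF i(1)] by simp
  qed
  define f where "f \<rho> = (\<Sum>\<delta>\<in>D. F A' \<rho> \<delta> * v \<delta>)" for \<rho>
  define g where "g j = (\<Sum>\<delta>\<in>D. cnj (y j \<delta>) * v \<delta>)" for j
  have "0 = (\<Sum>\<delta>\<in>D. cnj (v \<delta>) * (\<Sum>\<delta>'\<in>D. M A' \<delta> \<delta>' * v \<delta>'))" using Mv by simp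
  also have "\<dots> = (\<Sum>\<delta>\<in>D. \<Sum>\<rho>\<in>R. cnj (v \<delta>) * cnj (F A' \<rho> \<delta>) * f \<rho>)
      + (\<Sum>\<delta>\<in>D. \<Sum>j<s. cnj (v \<delta>) * y j \<delta> * g j)"
    unfolding M_apply f_def g_def by (simp add: algebra_simps sum.distrib sum_distrib_left)
  also have "\<dots> = (\<Sum>\<rho>\<in>R. \<Sum>\<delta>\<in>D. cnj (v \<delta>) * cnj (F A' \<rho> \<delta>) * f \<rho>)
      + (\<Sum>j<s. \<Sum>\<delta>\<in>D. cnj (v \<delta>) * y j \<delta> * g j)"
    by (intro arg_cong2[where f = "(+)"] sum.swap)
  also have "\<dots> = (\<Sum>\<rho>\<in>R. cnj (f \<rho>) * f \<rho>) + (\<Sum>j<s. cnj (g j) * g j)"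
  proof -
    have "cnj (f \<rho>) = (\<Sum>\<delta>\<in>D. cnj (v \<delta>) * cnj (F A' \<rho> \<delta>))" for \<rho>
      by (simp add: f_def mult.commute)
    moreover have "cnj (g j) = (\<Sum>\<delta>\<in>D. cnj (v \<delta>) * y j \<delta>)" for j
      by (simp add: g_def mult.commute)
    ultimately show ?thesis by (simp add: sum_distrib_right)
  qed
  also have "\<dots> = complex_of_real ((\<Sum>\<rho>\<in>R. (cmod (f \<rho>))\<^sup>2) + (\<Sum>j<s. (cmod (g j))\<^sup>2))"
    by (simp add: complex_norm_square mult.commute del: of_real_power)
  finally have "complex_of_real ((\<Sum>\<rho>\<in>R. (cmod (f \<rho>))\<^sup>2) + (\<Sum>j<s. (cmod (g j))\<^sup>2)) = 0" by simp
  then have "(\<Sum>\<rho>\<in>R. (cmod (f \<rho>))\<^sup>2) + (\<Sum>j<s. (cmod (g j))\<^sup>2) = 0"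
    by (simp only: of_real_eq_0_iff)
  moreover have "(\<Sum>\<rho>\<in>R. (cmod (f \<rho>))\<^sup>2) \<ge> 0" "(\<Sum>j<s. (cmod (g j))\<^sup>2) \<ge> 0"
    by (auto intro: sum_nonneg)
  ultimately have "(\<Sum>\<rho>\<in>R. (cmod (f \<rho>))\<^sup>2) = 0" "(\<Sum>j<s. (cmod (g j))\<^sup>2) = 0" by linarith+
  then have f0: "\<forall>\<rho>\<in>R. f \<rho> = 0" and g0: "\<forall>j<s. g j = 0"
    using finR by (auto simp: sum_nonneg_eq_0_iff)
  have "v \<in> Sol A'" using f0 by (simp add: Sol_def f_def)
  then obtain a where a: "\<forall>\<delta>\<in>D. v \<delta> = (\<Sum>j<s. a j * y j \<delta>)" using span by blast
  have "(\<Sum>\<delta>\<in>D. cnj (v \<delta>) * v \<delta>) = (\<Sum>\<delta>\<in>D. \<Sum>j<s. cnj (v \<delta>) * (a j * y j \<delta>))"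
  proof (rule sum.cong[OF refl])
    fix \<delta> assume "\<delta> \<in> D"
    then have "cnj (v \<delta>) * v \<delta> = cnj (v \<delta>) * (\<Sum>j<s. a j * y j \<delta>)"
      using a by (intro arg_cong[where f = "(*) (cnj (v \<delta>))"]) blast
    then show "cnj (v \<delta>) * v \<delta> = (\<Sum>j<s. cnj (v \<delta>) * (a j * y j \<delta>))"
      by (simp add: sum_distrib_left)
  qed
  also have "\<dots> = (\<Sum>j<s. \<Sum>\<delta>\<in>D. cnj (v \<delta>) * (a j * y j \<delta>))" by (rule sum.swap)
  also have "\<dots> = (\<Sum>j<s. a j * cnj (g j))"
    by (simp add: g_def sum_distrib_left algebra_simps)
  also have "\<dots> = 0" using g0 by simp
  finally have "complex_of_real (\<Sum>\<delta>\<in>D. (cmod (v \<delta>))\<^sup>2) = 0"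
    by (simp add: complex_norm_square mult.commute del: of_real_power)
  then have "(\<Sum>\<delta>\<in>D. (cmod (v \<delta>))\<^sup>2) = 0" by (simp only: of_real_eq_0_iff)
  then have "\<forall>\<delta>\<in>D. v \<delta> = 0" using finD by (simp add: sum_nonneg_eq_0_iff)
  then have "u j = 0" if "j < N" for j using ve[OF that] into[OF that] by simp
  then show False using u(1) by blast
qed

section \<open>Bases indexed by families\<close>

definition comb :: "'k set \<Rightarrow> ('k \<Rightarrow> 'v::complex_vector) \<Rightarrow> 'v set" where
  "comb J v = range (\<lambda>a. \<Sum>j\<in>J. a j *\<^sub>C v j)"

text \<open>
  Bases are families and not sets, because the strings of a representation are followed from vertex
  to vertex by their index.
\<close>

definition indep :: "'k set \<Rightarrow> ('k \<Rightarrow> 'v::complex_vector) \<Rightarrow> bool" where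
  "indep J v \<longleftrightarrow> (\<forall>a. (\<Sum>j\<in>J. a j *\<^sub>C v j) = 0 \<longrightarrow> (\<forall>j\<in>J. a j = 0))"

definition is_basis :: "'k set \<Rightarrow> ('k \<Rightarrow> 'v::complex_vector) \<Rightarrow> 'v set \<Rightarrow> bool" where
  "is_basis J v S \<longleftrightarrow> finite J \<and> v ` J \<subseteq> S \<and> indep J v \<and> S \<subseteq> comb J v"

definition coord :: "'k set \<Rightarrow> ('k \<Rightarrow> 'v::complex_vector) \<Rightarrow> 'v \<Rightarrow> 'k \<Rightarrow> complex" where
  "coord J v x j = (if j \<in> J then (SOME a. x = (\<Sum>j\<in>J. a j *\<^sub>C v j)) j else 0)"

lemma combI: "(\<Sum>j\<in>J. a j *\<^sub>C v j) \<in> comb J v"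
  by (auto simp: comb_def)

lemma comb_eqI: "x = (\<Sum>j\<in>J. a j *\<^sub>C v j) \<Longrightarrow> x \<in> comb J v"
  by (auto simp: comb_def)

lemma combE:
  assumes "x \<in> comb J v"
  obtains a where "x = (\<Sum>j\<in>J. a j *\<^sub>C v j)"
  using assms by (auto simp: comb_def)

lemma comb_subspace: "cvec.subspace (comb J v)"
proof (rule cvec.subspaceI)
  show "0 \<in> comb J v" using combI[of "\<lambda>_. 0" v J] by simp
  fix x y assume "x \<in> comb J v" "y \<in> comb J v"
  then obtain a b where "x = (\<Sum>j\<in>J. a j *\<^sub>C v j)" "y = (\<Sum>j\<in>J. b j *\<^sub>C v j)" by (metis combE)
  then have "x + y = (\<Sum>j\<in>J. (a j + b j) *\<^sub>C v j)"
    by (simp add: scaleC_add_left sum.distrib)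
  then show "x + y \<in> comb J v" by (rule comb_eqI)
next
  fix x t assume "x \<in> comb J v"
  then obtain a where "x = (\<Sum>j\<in>J. a j *\<^sub>C v j)" by (metis combE)
  then have "t *\<^sub>C x = (\<Sum>j\<in>J. (t * a j) *\<^sub>C v j)"
    by (simp add: cvec.scale_sum_right)
  then show "t *\<^sub>C x \<in> comb J v" by (rule comb_eqI)
qed

lemma comb_mono:
  assumes "finite J" "I \<subseteq> J"
  shows "comb I v \<subseteq> comb J v"
proof
  fix x assume "x \<in> comb I v"
  then obtain a where "x = (\<Sum>j\<in>I. a j *\<^sub>C v j)" by (metis combE)
  also have "\<dots> = (\<Sum>j\<in>J. (if j \<in> I then a j else 0) *\<^sub>C v j)"
    using assms by (intro sum.mono_neutral_cong_left) auto
  finally show "x \<in> comb J v" by (rule comb_eqI)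
qed

lemma comb_member:
  assumes "finite J" "k \<in> J"
  shows "v k \<in> comb J v"
proof -
  have "v k = (\<Sum>j\<in>J. (if j = k then 1 else 0) *\<^sub>C v j)"
    using assms by (subst sum.remove[of J k]) (auto intro!: sum.neutral)
  then show ?thesis by (rule comb_eqI)
qed

lemma comb_insert:
  assumes "finite J" "k \<notin> J"
  shows "comb (insert k J) v = {t *\<^sub>C v k + y |t y. y \<in> comb J v}"
proof (intro equalityI subsetI)
  fix x assume "x \<in> comb (insert k J) v"
  then obtain a where "x = (\<Sum>j\<in>insert k J. a j *\<^sub>C v j)" by (metis combE)
  then have "x = a k *\<^sub>C v k + (\<Sum>j\<in>J. a j *\<^sub>C v j)" using assms by simp
  then show "x \<in> {t *\<^sub>C v k + y |t y. y \<in> comb J v}" using combI by blast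
next
  fix x assume "x \<in> {t *\<^sub>C v k + y |t y. y \<in> comb J v}"
  then obtain t a where "x = t *\<^sub>C v k + (\<Sum>j\<in>J. a j *\<^sub>C v j)" by (auto simp: comb_def)
  also have "\<dots> = (\<Sum>j\<in>insert k J. (a(k := t)) j *\<^sub>C v j)"
    using assms by (simp, intro sum.cong) auto
  finally show "x \<in> comb (insert k J) v" by (rule comb_eqI)
qed

lemma comb_cong: "(\<And>j. j \<in> J \<Longrightarrow> v j = w j) \<Longrightarrow> comb J v = comb J w"
  unfolding comb_def by (intro arg_cong[where f = range] ext sum.cong) auto

lemma indep_cong: "(\<And>j. j \<in> J \<Longrightarrow> v j = w j) \<Longrightarrow> indep J v = indep J w"
  unfolding indep_def by (simp cong: sum.cong)

lemma is_basis_cong: "(\<And>j. j \<in> J \<Longrightarrow> v j = w j) \<Longrightarrow> is_basis J v S = is_basis J w S"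
  unfolding is_basis_def using comb_cong[of J v w] indep_cong[of J v w] by auto

lemma indep_insert:
  assumes fin: "finite J" and k: "k \<notin> J" and J: "indep J v" and x: "x \<notin> comb J v"
  shows "indep (insert k J) (v(k := x))"
  unfolding indep_def
proof (intro allI impI)
  fix a assume "(\<Sum>j\<in>insert k J. a j *\<^sub>C (v(k := x)) j) = 0"
  moreover have "(\<Sum>j\<in>J. a j *\<^sub>C (v(k := x)) j) = (\<Sum>j\<in>J. a j *\<^sub>C v j)"
    using k by (intro sum.cong) auto
  ultimately have eq: "a k *\<^sub>C x + (\<Sum>j\<in>J. a j *\<^sub>C v j) = 0" using fin k by simp
  have ak: "a k = 0"
  proof (rule ccontr)
    assume nz: "a k \<noteq> 0"
    have "inverse (a k) *\<^sub>C (a k *\<^sub>C x) = inverse (a k) *\<^sub>C (- (\<Sum>j\<in>J. a j *\<^sub>C v j))"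
      using eq by (simp add: add_eq_0_iff2)
    then have "x = inverse (a k) *\<^sub>C (- (\<Sum>j\<in>J. a j *\<^sub>C v j))"
      using nz by simp
    then have "x \<in> comb J v"
      using cvec.subspace_scale[OF comb_subspace] cvec.subspace_neg[OF comb_subspace] combI by metis
    then show False using x by blast
  qed
  then have "\<forall>j\<in>J. a j = 0" using eq J unfolding indep_def by simp
  then show "\<forall>j\<in>insert k J. a j = 0" using ak by simp
qed

lemma fin_dim_imp_subspace: "fin_dim_subspace S \<Longrightarrow> cvec.subspace S"
  unfolding fin_dim_subspace_def by auto

lemma fin_dim_subspace_subset:
  assumes "fin_dim_subspace S" "cvec.subspace T" "T \<subseteq> S"
  shows "fin_dim_subspace T"
proof -
  obtain A where A: "finite A" "S = cvec.span A" using assms(1) by (auto simp: fin_dim_subspace_def)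
  obtain B where B: "B \<subseteq> T" "cvec.independent B" "T \<subseteq> cvec.span B"
    using cvec.basis_exists[of T] by metis
  have "finite B" using cvec.independent_span_bound[OF A(1) B(2)] B(1) assms(3) A(2) by auto
  moreover have "T = cvec.span B" using B assms(2) by (simp add: cvec.span_subspace)
  ultimately show ?thesis by (auto simp: fin_dim_subspace_def)
qed

lemma indep_extend:
  fixes v :: "nat \<Rightarrow> 'v::complex_vector"
  assumes S: "fin_dim_subspace S" and J: "finite J" "v ` J \<subseteq> S" "indep J v"
    and J0: "finite J0" "J \<subseteq> J0"
  obtains J' v' where "finite J'" "J' \<inter> J0 = {}" "\<And>j. j \<in> J \<Longrightarrow> v' j = v j" "is_basis (J \<union> J') v' S"
proof -
  obtain B where B: "finite B" "S = cvec.span B" using S by (auto simp: fin_dim_subspace_def)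
  have "B' \<subseteq> S \<longrightarrow> (\<exists>J' v'. finite J' \<and> J' \<inter> J0 = {} \<and> (\<forall>j\<in>J. v' j = v j) \<and> v' ` (J \<union> J') \<subseteq> S
      \<and> indep (J \<union> J') v' \<and> B' \<subseteq> comb (J \<union> J') v')" if "finite B'" for B'
    using that
  proof (induction B' rule: finite_induct)
    case empty
    show ?case using J by (intro impI exI[of _ "{}"] exI[of _ v]) auto
  next
    case (insert x B')
    show ?case
    proof
      assume xB: "insert x B' \<subseteq> S"
      then obtain J' v' where IH: "finite J'" "J' \<inter> J0 = {}" "\<forall>j\<in>J. v' j = v j" "v' ` (J \<union> J') \<subseteq> S"
        "indep (J \<union> J') v'" "B' \<subseteq> comb (J \<union> J') v'"
        using insert by blast
      show "\<exists>J' v'. finite J' \<and> J' \<inter> J0 = {} \<and> (\<forall>j\<in>J. v' j = v j) \<and> v' ` (J \<union> J') \<subseteq> S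
         \<and> indep (J \<union> J') v' \<and> insert x B' \<subseteq> comb (J \<union> J') v'"
      proof (cases "x \<in> comb (J \<union> J') v'")
        case True
        then show ?thesis using IH by (intro exI[of _ J'] exI[of _ v']) simp
      next
        case False
        have fin: "finite (J0 \<union> J')" using IH(1) J0 by simp
        obtain k where k: "k \<notin> J0 \<union> J'"
          using ex_new_if_finite[OF infinite_UNIV_nat fin] by blast
        have kJ: "k \<notin> J \<union> J'" using k J0 by auto
        have finJ: "finite (J \<union> J')" using IH(1) J(1) by simp
        have eq: "J \<union> insert k J' = insert k (J \<union> J')" by auto
        have c: "comb (J \<union> J') (v'(k := x)) = comb (J \<union> J') v'"
          by (rule comb_cong) (use kJ in auto)
        have "insert x B' \<subseteq> comb (insert k (J \<union> J')) (v'(k := x))"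
        proof -
          have "x \<in> comb (insert k (J \<union> J')) (v'(k := x))"
            using comb_member[of "insert k (J \<union> J')" k "v'(k := x)"] finJ by simp
          moreover have "comb (J \<union> J') (v'(k := x)) \<subseteq> comb (insert k (J \<union> J')) (v'(k := x))"
            by (rule comb_mono) (use finJ in auto)
          ultimately show ?thesis using IH(6) c by auto
        qed
        moreover have "indep (insert k (J \<union> J')) (v'(k := x))"
          by (rule indep_insert[OF finJ kJ IH(5) False])
        moreover have "(v'(k := x)) ` (insert k (J \<union> J')) \<subseteq> S"
          using IH(4) xB kJ by auto
        moreover have "\<forall>j\<in>J. (v'(k := x)) j = v j" using IH(3) kJ by auto
        moreover have "finite (insert k J')" "insert k J' \<inter> J0 = {}" using IH k by auto
        ultimately show ?thesis
          by (intro exI[of _ "insert k J'"] exI[of _ "v'(k := x)"]) (simp only: eq)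
      qed
    qed
  qed
  from this[OF B(1)] obtain J' v' where R: "finite J'" "J' \<inter> J0 = {}" "\<forall>j\<in>J. v' j = v j"
    "v' ` (J \<union> J') \<subseteq> S" "indep (J \<union> J') v'" "B \<subseteq> comb (J \<union> J') v'"
  proof -
    have "B \<subseteq> S" using B cvec.span_superset[of B] by simp
    then show ?thesis
      using that \<open>B \<subseteq> S \<longrightarrow> _\<close> by auto
  qed
  have "S \<subseteq> comb (J \<union> J') v'" using R(6) B(2) comb_subspace cvec.span_minimal by blast
  then have "is_basis (J \<union> J') v' S" using R J(1) by (simp add: is_basis_def)
  then show ?thesis using that R by blast
qed

lemma basis_exists_nat:
  fixes S :: "'v::complex_vector set"
  assumes "fin_dim_subspace S" "finite J0"
  obtains J :: "nat set" and v where "J \<inter> J0 = {}" "is_basis J v S"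
proof -
  obtain J' :: "nat set" and v' where "J' \<inter> J0 = {}" "is_basis ({} \<union> J') v' S"
    by (rule indep_extend[OF assms(1), of "{}" "\<lambda>_. 0" J0]) (auto simp: indep_def assms(2))
  then show ?thesis using that[of J' v'] by simp
qed

lemma is_basis_finite: "is_basis J v S \<Longrightarrow> finite J"
  by (simp add: is_basis_def)

lemma is_basis_mem: "is_basis J v S \<Longrightarrow> j \<in> J \<Longrightarrow> v j \<in> S"
  by (auto simp: is_basis_def)

lemma is_basis_indep:
  "is_basis J v S \<Longrightarrow> (\<Sum>j\<in>J. a j *\<^sub>C v j) = 0 \<Longrightarrow> j \<in> J \<Longrightarrow> a j = 0"
  by (auto simp: is_basis_def indep_def)

lemma coord_sum:
  assumes "is_basis J v S" "x \<in> S"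
  shows "(\<Sum>j\<in>J. coord J v x j *\<^sub>C v j) = x"
proof -
  have "x \<in> comb J v" using assms by (auto simp: is_basis_def)
  then have "\<exists>a. x = (\<Sum>j\<in>J. a j *\<^sub>C v j)" by (metis combE)
  then have "x = (\<Sum>j\<in>J. (SOME a. x = (\<Sum>j\<in>J. a j *\<^sub>C v j)) j *\<^sub>C v j)" by (rule someI_ex)
  then show ?thesis by (simp add: coord_def cong: sum.cong)
qed

lemma coord_outside: "j \<notin> J \<Longrightarrow> coord J v x j = 0"
  by (simp add: coord_def)

lemma indep_unique:
  assumes "is_basis J v S" "(\<Sum>j\<in>J. a j *\<^sub>C v j) = (\<Sum>j\<in>J. b j *\<^sub>C v j)" "j \<in> J"
  shows "a j = b j"
proof -
  have "(\<Sum>j\<in>J. (a j - b j) *\<^sub>C v j) = 0"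
    using assms(2) by (simp add: cvec.scale_left_diff_distrib sum_subtractf)
  then show ?thesis using is_basis_indep[OF assms(1) _ assms(3), of "\<lambda>j. a j - b j"] by simp
qed

lemma coord_eqI:
  assumes "is_basis J v S" "x = (\<Sum>j\<in>J. a j *\<^sub>C v j)" "x \<in> S" "j \<in> J"
  shows "coord J v x j = a j"
  using indep_unique[OF assms(1) _ assms(4), of "coord J v x" a] coord_sum[OF assms(1,3)] assms(2) by simp

lemma coord_add:
  assumes "is_basis J v S" "cvec.subspace S" "x \<in> S" "y \<in> S"
  shows "coord J v (x + y) j = coord J v x j + coord J v y j"
proof (cases "j \<in> J")
  case True
  show ?thesis
  proof (rule coord_eqI[OF assms(1) _ _ True])
    show "x + y = (\<Sum>j\<in>J. (coord J v x j + coord J v y j) *\<^sub>C v j)"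
      using coord_sum[OF assms(1,3)] coord_sum[OF assms(1,4)]
      by (simp add: scaleC_add_left sum.distrib)
  qed (use assms cvec.subspace_add in blast)
qed (simp add: coord_outside)

lemma coord_scale:
  assumes "is_basis J v S" "cvec.subspace S" "x \<in> S"
  shows "coord J v (t *\<^sub>C x) j = t * coord J v x j"
proof (cases "j \<in> J")
  case True
  show ?thesis
  proof (rule coord_eqI[OF assms(1) _ _ True])
    show "t *\<^sub>C x = (\<Sum>j\<in>J. (t * coord J v x j) *\<^sub>C v j)"
      using arg_cong[OF coord_sum[OF assms(1,3)], of "scaleC t"]
      by (simp add: cvec.scale_sum_right)
  qed (use assms cvec.subspace_scale in blast)
qed (simp add: coord_outside)

lemma coord_basis:
  assumes "is_basis J v S" "k \<in> J"
  shows "coord J v (v k) j = (if j = k then 1 else 0)"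
proof (cases "j \<in> J")
  case True
  show ?thesis
  proof (rule coord_eqI[OF assms(1) _ _ True])
    show "v k = (\<Sum>j\<in>J. (if j = k then 1 else 0) *\<^sub>C v j)"
      using assms(2) is_basis_finite[OF assms(1)]
      by (subst sum.remove[of J k]) (auto intro!: sum.neutral)
  qed (rule is_basis_mem[OF assms])
qed (use assms in \<open>auto simp: coord_outside\<close>)

text \<open>
  Adding a combination of the other members to one member is an invertible change of coordinates.
\<close>

lemma is_basis_shear:
  assumes B: "is_basis J v S" and S: "cvec.subspace S" and x: "x \<in> J"
  shows "is_basis J (v(x := v x + (\<Sum>l\<in>J - {x}. a l *\<^sub>C v l))) S"
proof -
  let ?w = "v(x := v x + (\<Sum>l\<in>J - {x}. a l *\<^sub>C v l))"
  have fin: "finite J" using B by (simp add: is_basis_def)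
  have key: "(\<Sum>j\<in>J. c j *\<^sub>C ?w j) = (\<Sum>j\<in>J. (if j = x then c x else c j + c x * a j) *\<^sub>C v j)" for c
  proof -
    have "(\<Sum>j\<in>J. c j *\<^sub>C ?w j) = c x *\<^sub>C ?w x + (\<Sum>j\<in>J - {x}. c j *\<^sub>C ?w j)"
      using fin x by (simp add: sum.remove)
    also have "(\<Sum>j\<in>J - {x}. c j *\<^sub>C ?w j) = (\<Sum>j\<in>J - {x}. c j *\<^sub>C v j)" by (rule sum.cong) auto
    also have "c x *\<^sub>C ?w x + (\<Sum>j\<in>J - {x}. c j *\<^sub>C v j)
       = c x *\<^sub>C v x + (\<Sum>j\<in>J - {x}. (c j + c x * a j) *\<^sub>C v j)"
      by (simp add: scaleC_add_right scaleC_add_left sum.distrib cvec.scale_sum_right algebra_simps)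
    also have "\<dots> = (\<Sum>j\<in>J. (if j = x then c x else c j + c x * a j) *\<^sub>C v j)"
      using fin x by (subst sum.remove[of J x]) auto
    finally show ?thesis .
  qed
  have "?w j \<in> S" if j: "j \<in> J" for j
  proof -
    have "(\<Sum>l\<in>J - {x}. a l *\<^sub>C v l) \<in> S"
      by (intro cvec.subspace_sum[OF S] cvec.subspace_scale[OF S]) (auto intro: is_basis_mem[OF B])
    then show ?thesis using B x j is_basis_mem[OF B] cvec.subspace_add[OF S] by simp
  qed
  moreover have "indep J ?w" unfolding indep_def
  proof (intro allI impI ballI)
    fix c j assume 0: "(\<Sum>j\<in>J. c j *\<^sub>C ?w j) = 0" and j: "j \<in> J"
    then have *: "(if i = x then c x else c i + c x * a i) = 0" if "i \<in> J" for i
      using is_basis_indep[OF B _ that, of "\<lambda>j. if j = x then c x else c j + c x * a j"] key by simp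
    show "c j = 0" using *[OF j] *[OF x] by (auto split: if_splits)
  qed
  moreover have "S \<subseteq> comb J ?w"
  proof
    fix y assume "y \<in> S"
    then have "y = (\<Sum>j\<in>J. coord J v y j *\<^sub>C v j)" using coord_sum[OF B] by simp
    also have "\<dots> = (\<Sum>j\<in>J. (if j = x then coord J v y x
          else coord J v y j - coord J v y x * a j) *\<^sub>C ?w j)"
      unfolding key by (rule sum.cong) auto
    finally show "y \<in> comb J ?w" by (rule comb_eqI)
  qed
  ultimately show ?thesis using fin unfolding is_basis_def by blast
qed

section \<open>Linear maps between subspaces\<close>

lemma linear_mem: "linear_between S T f \<Longrightarrow> x \<in> S \<Longrightarrow> f x \<in> T"
  by (auto simp: linear_between_def)

lemma linear_add:
  "linear_between S T f \<Longrightarrow> x \<in> S \<Longrightarrow> y \<in> S \<Longrightarrow> f (x + y) = f x + f y"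
  by (auto simp: linear_between_def)

lemma linear_scale:
  "linear_between S T f \<Longrightarrow> x \<in> S \<Longrightarrow> f (a *\<^sub>C x) = a *\<^sub>C f x"
  by (auto simp: linear_between_def)

lemma linear_zero:
  "linear_between S T f \<Longrightarrow> cvec.subspace S \<Longrightarrow> f 0 = 0"
  using linear_scale[of S T f 0 0] cvec.subspace_0[of S] by simp

lemma linear_diff:
  assumes "linear_between S T f" "cvec.subspace S" "x \<in> S" "y \<in> S"
  shows "f (x - y) = f x - f y"
  using linear_add[OF assms(1) cvec.subspace_diff[OF assms(2-4)] assms(4)]
  by (simp add: algebra_simps)

lemma linear_sum:
  assumes f: "linear_between S T f" and S: "cvec.subspace S" and v: "\<And>j. j \<in> J \<Longrightarrow> v j \<in> S"
  shows "f (\<Sum>j\<in>J. a j *\<^sub>C v j) = (\<Sum>j\<in>J. a j *\<^sub>C f (v j))"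
  using v
proof (induction J rule: infinite_finite_induct)
  case (insert x F)
  have "(\<Sum>j\<in>F. a j *\<^sub>C v j) \<in> S"
    by (intro cvec.subspace_sum[OF S] cvec.subspace_scale[OF S]) (use insert in auto)
  moreover have "a x *\<^sub>C v x \<in> S" using insert cvec.subspace_scale[OF S] by simp
  ultimately show ?case
    using insert linear_add[OF f] linear_scale[OF f] by simp
qed (simp_all add: linear_zero[OF f S])

lemma linear_comp:
  assumes "linear_between S T f" "linear_between T U g"
  shows "linear_between S U (\<lambda>x. g (f x))"
  using assms unfolding linear_between_def by (auto simp: image_subset_iff)

lemma linear_kernel:
  assumes "linear_between S T f" "cvec.subspace S"
  shows "cvec.subspace {x \<in> S. f x = 0}"
  using assms
  by (intro cvec.subspaceI)
     (auto simp: linear_zero linear_add linear_scale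
        cvec.subspace_0 cvec.subspace_add cvec.subspace_scale)

lemma linear_image:
  assumes "linear_between S T f" "cvec.subspace S"
  shows "cvec.subspace (f ` S)"
proof (intro cvec.subspaceI)
  show "0 \<in> f ` S" using linear_zero[OF assms] cvec.subspace_0[OF assms(2)] by (metis imageI)
next
  fix x y assume "x \<in> f ` S" "y \<in> f ` S"
  then obtain u v where uv: "u \<in> S" "v \<in> S" "x = f u" "y = f v" by blast
  then have "x + y = f (u + v)" using linear_add[OF assms(1)] by simp
  then show "x + y \<in> f ` S" using uv cvec.subspace_add[OF assms(2)] by blast
next
  fix c x assume "x \<in> f ` S"
  then obtain u where u: "u \<in> S" "x = f u" by blast
  then have "c *\<^sub>C x = f (c *\<^sub>C u)" using linear_scale[OF assms(1)] by simp
  then show "c *\<^sub>C x \<in> f ` S" using u cvec.subspace_scale[OF assms(2)] by blast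
qed

section \<open>String bases\<close>

text \<open>
  Consider intervals with a common vertex to the right of their left ends \<open>c\<close> and \<open>c'\<close>. Whether the
  identity at that vertex extends to a map between their left parts depends only on the last arrow
  before the larger of the two ends. Powers of two let this arrow dominate all earlier ones, so that
  \<open>depth \<Gamma> c \<le> depth \<Gamma> c'\<close> expresses that the part starting at \<open>c\<close> maps to the part starting at
  \<open>c'\<close>; in particular, this relation is total and transitive.
\<close>

primrec depth :: "quiver \<Rightarrow> nat \<Rightarrow> int" where
  "depth \<Gamma> 0 = 0"
| "depth \<Gamma> (Suc e) = (if rightward \<Gamma> e then depth \<Gamma> e - 2 ^ e else depth \<Gamma> e + 2 ^ e)"

lemma depth_diff: "x \<le> y \<Longrightarrow> \<bar>depth \<Gamma> y - depth \<Gamma> x\<bar> \<le> 2 ^ y - 2 ^ x"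
proof (induction y)
  case (Suc y)
  show ?case
  proof (cases "x = Suc y")
    case False
    then have "\<bar>depth \<Gamma> y - depth \<Gamma> x\<bar> \<le> 2 ^ y - 2 ^ x" using Suc by simp
    moreover have "\<bar>depth \<Gamma> (Suc y) - depth \<Gamma> y\<bar> \<le> 2 ^ y" by simp
    moreover have "(2::int) ^ Suc y = 2 ^ y + 2 ^ y" by simp
    ultimately show ?thesis by linarith
  qed simp
qed simp

lemma depth_less_iff:
  assumes "c < c'"
  shows "depth \<Gamma> c \<le> depth \<Gamma> c' \<longleftrightarrow> \<not> rightward \<Gamma> (c' - 1)"
    and "depth \<Gamma> c' \<le> depth \<Gamma> c \<longleftrightarrow> rightward \<Gamma> (c' - 1)"
proof -
  obtain e where e: "c' = Suc e" using assms by (cases c') auto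
  have "\<bar>depth \<Gamma> e - depth \<Gamma> c\<bar> \<le> 2 ^ e - 2 ^ c" using depth_diff[of c e \<Gamma>] assms e by simp
  moreover have "(2::int) ^ c > 0" by simp
  ultimately have "- (2 ^ e) < depth \<Gamma> e - depth \<Gamma> c" "depth \<Gamma> e - depth \<Gamma> c < 2 ^ e"
    by linarith+
  then show "depth \<Gamma> c \<le> depth \<Gamma> c' \<longleftrightarrow> \<not> rightward \<Gamma> (c' - 1)"
    and "depth \<Gamma> c' \<le> depth \<Gamma> c \<longleftrightarrow> rightward \<Gamma> (c' - 1)"
    using e by auto
qed

definition through :: "nat set \<Rightarrow> (nat \<Rightarrow> nat) \<Rightarrow> (nat \<Rightarrow> nat) \<Rightarrow> nat \<Rightarrow> nat set" where
  "through I c d i = {k \<in> I. c k \<le> i \<and> i \<le> d k}"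

text \<open>
  A decomposition of the restriction of \<open>M\<close> to the vertices \<open>1, \<dots>, m\<close> into intervals: the string
  \<open>k\<close> is the interval from \<open>c k\<close> to \<open>d k\<close>, spanned by the vectors \<open>b k i\<close>. As these are \<open>0\<close> outside
  the interval, the last clause also says that arrows leaving the interval kill the string.
\<close>

definition string_basis :: "quiver \<Rightarrow> nat \<Rightarrow> 'v::complex_vector rep \<Rightarrow> nat set \<Rightarrow> (nat \<Rightarrow> nat) \<Rightarrow> (nat \<Rightarrow> nat)
    \<Rightarrow> (nat \<Rightarrow> nat \<Rightarrow> 'v) \<Rightarrow> bool" where
  "string_basis \<Gamma> m M I c d b \<longleftrightarrow>
     finite I \<and> (\<forall>k\<in>I. 1 \<le> c k \<and> c k \<le> d k \<and> d k \<le> m) \<and>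
     (\<forall>k i. k \<in> I \<longrightarrow> \<not> (c k \<le> i \<and> i \<le> d k) \<longrightarrow> b k i = 0) \<and>
     (\<forall>i\<in>{1..m}. is_basis (through I c d i) (\<lambda>k. b k i) (rep_space M i)) \<and>
     (\<forall>k\<in>I. \<forall>e\<in>{1..<m}. c k \<le> arrow_tail \<Gamma> e \<and> arrow_tail \<Gamma> e \<le> d k \<longrightarrow>
        rep_map M e (b k (arrow_tail \<Gamma> e)) = b k (arrow_head \<Gamma> e))"

lemma is_rep_map:
  assumes "is_rep \<Gamma> M" "e \<in> q_arrows \<Gamma>"
  shows "linear_between (rep_space M (arrow_tail \<Gamma> e)) (rep_space M (arrow_head \<Gamma> e)) (rep_map M e)"
  using assms by (simp add: is_rep_def)

lemmas arrow_mem = linear_mem[OF is_rep_map]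
  and arrow_add = linear_add[OF is_rep_map]
  and arrow_scale = linear_scale[OF is_rep_map]
  and arrow_zero = linear_zero[OF is_rep_map]
  and arrow_diff = linear_diff[OF is_rep_map]
  and arrow_sum = linear_sum[OF is_rep_map]

lemma is_rep_space:
  assumes "is_rep \<Gamma> M" "i \<in> q_verts \<Gamma>"
  shows "fin_dim_subspace (rep_space M i)" "cvec.subspace (rep_space M i)"
  using assms fin_dim_imp_subspace by (auto simp: is_rep_def)

lemma arrow_in_verts:
  assumes "e \<in> q_arrows \<Gamma>"
  shows "arrow_tail \<Gamma> e \<in> q_verts \<Gamma>" "arrow_head \<Gamma> e \<in> q_verts \<Gamma>"
  using assms by (auto simp: q_arrows_def q_verts_def arrow_tail_def arrow_head_def)

text \<open>
  The assumption on depths says that the string \<open>x\<close> maps to each string \<open>l\<close> in \<open>S\<close>, all of them ending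
  at \<open>m\<close>. The new basis is the image of the old one under the automorphism that adds multiples of
  these maps.
\<close>

lemma string_basis_shear:
  assumes rep: "is_rep \<Gamma> M" and m: "m \<le> num_verts \<Gamma>"
    and sb: "string_basis \<Gamma> m M I c d b"
    and x: "x \<in> I" "d x = m" and S: "S \<subseteq> through I c d m - {x}"
    and le: "\<And>l. l \<in> S \<Longrightarrow> depth \<Gamma> (c x) \<le> depth \<Gamma> (c l)"
  shows "string_basis \<Gamma> m M I c d
     (b(x := (\<lambda>i. if c x \<le> i \<and> i \<le> m then b x i + (\<Sum>l\<in>S. a l *\<^sub>C b l i) else 0)))"
    (is "string_basis \<Gamma> m M I c d ?b")
proof -
  have fin: "finite I" and itv: "\<And>k. k \<in> I \<Longrightarrow> 1 \<le> c k \<and> c k \<le> d k \<and> d k \<le> m"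
    and out: "\<And>k i. k \<in> I \<Longrightarrow> \<not> (c k \<le> i \<and> i \<le> d k) \<Longrightarrow> b k i = 0"
    and bas: "\<And>i. 1 \<le> i \<Longrightarrow> i \<le> m \<Longrightarrow> is_basis (through I c d i) (\<lambda>k. b k i) (rep_space M i)"
    and arr: "\<And>k e. k \<in> I \<Longrightarrow> 1 \<le> e \<Longrightarrow> e < m \<Longrightarrow> c k \<le> arrow_tail \<Gamma> e \<Longrightarrow> arrow_tail \<Gamma> e \<le> d k
        \<Longrightarrow> rep_map M e (b k (arrow_tail \<Gamma> e)) = b k (arrow_head \<Gamma> e)"
    using sb unfolding string_basis_def by auto
  have SI: "l \<in> I \<and> d l = m \<and> c l \<le> m \<and> l \<noteq> x" if "l \<in> S" for l
    using S that itv unfolding through_def by fastforce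
  have finS: "finite S" using S fin finite_subset unfolding through_def by fastforce
  have sub: "cvec.subspace (rep_space M i)" if "1 \<le> i" "i \<le> m" for i
    using is_rep_space(2)[OF rep] that m by (simp add: q_verts_def)
  have bin: "b k i \<in> rep_space M i" if "k \<in> I" "1 \<le> i" "i \<le> m" for k i
  proof (cases "c k \<le> i \<and> i \<le> d k")
    case True
    then show ?thesis using is_basis_mem[OF bas, of i k] that by (auto simp: through_def)
  next
    case False
    then show ?thesis using out that sub cvec.subspace_0 by metis
  qed
  have out': "?b k i = 0" if "k \<in> I" "\<not> (c k \<le> i \<and> i \<le> d k)" for k i
    using that out x by auto
  have bas': "is_basis (through I c d i) (\<lambda>k. ?b k i) (rep_space M i)" if i: "1 \<le> i" "i \<le> m" for i
  proof (cases "c x \<le> i")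
    case False
    then have "is_basis (through I c d i) (\<lambda>k. ?b k i) (rep_space M i)
      = is_basis (through I c d i) (\<lambda>k. b k i) (rep_space M i)"
      by (intro is_basis_cong) (auto simp: through_def)
    then show ?thesis using bas[OF i] by blast
  next
    case True
    let ?J = "through I c d i"
    have finJ: "finite ?J" using fin by (simp add: through_def)
    have "(\<Sum>l\<in>S. a l *\<^sub>C b l i) = (\<Sum>l\<in>?J - {x}. (if l \<in> S then a l else 0) *\<^sub>C b l i)"
    proof -
      have "(\<Sum>l\<in>S. a l *\<^sub>C b l i) = (\<Sum>l\<in>S \<inter> ?J. a l *\<^sub>C b l i)"
        by (rule sum.mono_neutral_right) (use finS SI out in \<open>auto simp: through_def\<close>)
      also have "\<dots> = (\<Sum>l\<in>?J - {x}. (if l \<in> S then a l else 0) *\<^sub>C b l i)"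
        by (rule sum.mono_neutral_cong_left) (use finJ SI in auto)
      finally show ?thesis .
    qed
    then have eq: "(\<lambda>k. ?b k i) = (\<lambda>k. b k i)(x := b x i + (\<Sum>l\<in>?J - {x}. (if l \<in> S then a l else 0) *\<^sub>C b l i))"
      using True i by auto
    have "x \<in> ?J" using True i x by (simp add: through_def)
    then show ?thesis unfolding eq using is_basis_shear[OF bas[OF i] sub[OF i]] by simp
  qed
  have arr': "rep_map M e (?b k (arrow_tail \<Gamma> e)) = ?b k (arrow_head \<Gamma> e)"
    if k: "k \<in> I" and e: "1 \<le> e" "e < m" and t: "c k \<le> arrow_tail \<Gamma> e" "arrow_tail \<Gamma> e \<le> d k" for k e
  proof (cases "k = x")
    case False
    then show ?thesis using arr[OF k e t] by simp
  next
    case True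
    let ?t = "arrow_tail \<Gamma> e" and ?h = "arrow_head \<Gamma> e"
    have th: "1 \<le> ?t" "?t \<le> m" "1 \<le> ?h" "?h \<le> m" using e by (auto simp: arrow_tail_def arrow_head_def)
    have eQ: "e \<in> q_arrows \<Gamma>" using e m by (simp add: q_arrows_def)
    note lin = is_rep_map[OF rep eQ]
    have l1: "rep_map M e (b l ?t) = (if c x \<le> ?h then b l ?h else 0)" if l: "l \<in> S" for l
    proof (cases "c l \<le> ?t")
      case True
      then have eq: "rep_map M e (b l ?t) = b l ?h" using arr[of l e] SI[OF l] e th by simp
      have "b l ?h = 0" if lt: "?h < c x"
      proof (rule ccontr)
        assume "b l ?h \<noteq> 0"
        then have "c l \<le> ?h" using out[of l ?h] SI[OF l] by auto
        then have "rightward \<Gamma> (c x - 1)" using depth_less_iff(2)[of "c l" "c x" \<Gamma>] le[OF l] lt by simp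
        moreover have "\<not> rightward \<Gamma> e" "c x = Suc e" using lt t \<open>k = x\<close>
          by (auto simp: arrow_tail_def arrow_head_def split: if_splits)
        ultimately show False by simp
      qed
      then show ?thesis using eq by auto
    next
      case False
      then have "b l ?t = 0" using out[of l ?t] SI[OF l] by simp
      moreover have "rep_map M e 0 = 0"
        using linear_zero[OF lin sub] th by simp
      moreover have "b l ?h = 0"
      proof (rule ccontr)
        assume "b l ?h \<noteq> 0"
        then have h: "c l \<le> ?h" using out[of l ?h] SI[OF l] by auto
        have cx: "c x < c l" using t False True by simp
        then have "\<not> rightward \<Gamma> (c l - 1)" using depth_less_iff(1)[of "c x" "c l" \<Gamma>] le[OF l] by simp
        moreover have "c l = ?h \<and> ?h = Suc ?t"
          using h False by (auto simp: arrow_tail_def arrow_head_def split: if_splits)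
        ultimately show False by (auto simp: arrow_tail_def arrow_head_def split: if_splits)
      qed
      ultimately show ?thesis by simp
    qed
    have sS: "(\<Sum>l\<in>S. a l *\<^sub>C b l ?t) \<in> rep_space M ?t"
      by (intro cvec.subspace_sum[OF sub] cvec.subspace_scale[OF sub] bin) (use th SI in auto)
    have "rep_map M e (b x ?t + (\<Sum>l\<in>S. a l *\<^sub>C b l ?t))
        = rep_map M e (b x ?t) + rep_map M e (\<Sum>l\<in>S. a l *\<^sub>C b l ?t)"
      using linear_add[OF lin _ sS] bin[OF x(1)] th by simp
    also have "rep_map M e (\<Sum>l\<in>S. a l *\<^sub>C b l ?t) = (\<Sum>l\<in>S. a l *\<^sub>C rep_map M e (b l ?t))"
      by (rule linear_sum[OF lin sub]) (use th SI bin in auto)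
    also have "rep_map M e (b x ?t) = b x ?h" using arr[OF k e t] True by simp
    also have "(\<Sum>l\<in>S. a l *\<^sub>C rep_map M e (b l ?t)) = (if c x \<le> ?h then (\<Sum>l\<in>S. a l *\<^sub>C b l ?h) else 0)"
      using l1 by (auto intro!: sum.cong sum.neutral)
    also have "b x ?h + (if c x \<le> ?h then (\<Sum>l\<in>S. a l *\<^sub>C b l ?h) else 0) = ?b x ?h"
      using out[OF x(1), of ?h] th x by auto
    finally show ?thesis using True t th by simp
  qed
  show ?thesis unfolding string_basis_def
    using fin itv out' bas' arr' by (auto simp del: fun_upd_apply)
qed

lemma string_basisD:
  assumes "string_basis \<Gamma> m M I c d b"
  shows "finite I"
    and "\<And>k. k \<in> I \<Longrightarrow> 1 \<le> c k \<and> c k \<le> d k \<and> d k \<le> m"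
    and "\<And>k i. k \<in> I \<Longrightarrow> \<not> (c k \<le> i \<and> i \<le> d k) \<Longrightarrow> b k i = 0"
    and "\<And>i. 1 \<le> i \<Longrightarrow> i \<le> m \<Longrightarrow> is_basis (through I c d i) (\<lambda>k. b k i) (rep_space M i)"
    and "\<And>k e. k \<in> I \<Longrightarrow> 1 \<le> e \<Longrightarrow> e < m \<Longrightarrow> c k \<le> arrow_tail \<Gamma> e \<Longrightarrow> arrow_tail \<Gamma> e \<le> d k
        \<Longrightarrow> rep_map M e (b k (arrow_tail \<Gamma> e)) = b k (arrow_head \<Gamma> e)"
  using assms unfolding string_basis_def by auto

text \<open>
  Gaussian elimination within the group of admissible base changes. The strings are processed in the
  order of decreasing depth, so that each of them may be corrected by all earlier ones; it is moved
  into \<open>U\<close> if some correction achieves this.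
\<close>

lemma string_basis_adapted:
  assumes rep: "is_rep \<Gamma> M" and m: "m \<le> num_verts \<Gamma>"
    and sb0: "string_basis \<Gamma> m M I c d b0" and U: "cvec.subspace U"
    and S: "S \<subseteq> through I c d m"
  shows "\<exists>b E. string_basis \<Gamma> m M I c d b \<and> E \<subseteq> S \<and> (\<forall>k\<in>E. b k m \<in> U)
      \<and> U \<inter> comb S (\<lambda>k. b k m) \<subseteq> comb E (\<lambda>k. b k m)"
proof -
  have finI: "finite I" using string_basisD(1)[OF sb0] .
  have "finite S" using finite_subset[OF S] finI by (simp add: through_def)
  then show ?thesis using S
  proof (induction S rule: finite_ranking_induct[where f = "\<lambda>k. - depth \<Gamma> (c k)"])
    case empty
    show ?case using sb0 by (intro exI[of _ b0] exI[of _ "{}"]) simp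
  next
    case (insert x S)
    show ?case
    proof (cases "x \<in> S")
      case True
      then show ?thesis using insert.IH insert.prems by (simp add: insert_absorb)
    next
      case xS: False
      obtain b E where IH: "string_basis \<Gamma> m M I c d b" "E \<subseteq> S" "\<forall>k\<in>E. b k m \<in> U"
        "U \<inter> comb S (\<lambda>k. b k m) \<subseteq> comb E (\<lambda>k. b k m)"
        using insert.IH insert.prems by auto
      have finE: "finite E" using IH(2) insert.hyps(1) finite_subset by auto
      have xI: "x \<in> I" "d x = m" "c x \<le> m"
        using insert.prems string_basisD(2)[OF sb0, of x] by (auto simp: through_def)
      show ?thesis
      proof (cases "\<exists>a. b x m + (\<Sum>l\<in>S. a l *\<^sub>C b l m) \<in> U")
        case False
        have "U \<inter> comb (insert x S) (\<lambda>k. b k m) \<subseteq> comb E (\<lambda>k. b k m)"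
        proof
          fix y assume y: "y \<in> U \<inter> comb (insert x S) (\<lambda>k. b k m)"
          then obtain t s where ts: "y = t *\<^sub>C b x m + s" "s \<in> comb S (\<lambda>k. b k m)"
            using comb_insert[OF insert.hyps(1) xS, of "\<lambda>k. b k m"] by auto
          have "t = 0"
          proof (rule ccontr)
            assume t: "t \<noteq> 0"
            have "inverse t *\<^sub>C y \<in> U" using y cvec.subspace_scale[OF U] by simp
            moreover have "inverse t *\<^sub>C y = b x m + inverse t *\<^sub>C s"
              using ts t by (simp add: scaleC_add_right)
            moreover obtain a where "inverse t *\<^sub>C s = (\<Sum>l\<in>S. a l *\<^sub>C b l m)"
              using cvec.subspace_scale[OF comb_subspace ts(2)] by (rule combE)
            ultimately have "b x m + (\<Sum>l\<in>S. a l *\<^sub>C b l m) \<in> U" by simp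
            then show False using False by blast
          qed
          then have "y \<in> U \<inter> comb S (\<lambda>k. b k m)" using ts y by simp
          then show "y \<in> comb E (\<lambda>k. b k m)" using IH(4) by blast
        qed
        then show ?thesis using IH by (intro exI[of _ b] exI[of _ E]) auto
      next
        case True
        then obtain a where a: "b x m + (\<Sum>l\<in>S. a l *\<^sub>C b l m) \<in> U" by blast
        define b' where "b' = b(x := (\<lambda>i. if c x \<le> i \<and> i \<le> m then b x i + (\<Sum>l\<in>S. a l *\<^sub>C b l i) else 0))"
        have sb': "string_basis \<Gamma> m M I c d b'" unfolding b'_def
          by (rule string_basis_shear[OF rep m IH(1) xI(1,2)]) (use insert xS in auto)
        have b'x: "b' x m = b x m + (\<Sum>l\<in>S. a l *\<^sub>C b l m)" using xI by (simp add: b'_def)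
        have b'S: "b' k m = b k m" if "k \<in> S" for k using that xS by (auto simp: b'_def)
        have cS: "comb S (\<lambda>k. b' k m) = comb S (\<lambda>k. b k m)" by (rule comb_cong) (rule b'S)
        have cE: "comb E (\<lambda>k. b' k m) = comb E (\<lambda>k. b k m)" by (rule comb_cong) (use b'S IH(2) in auto)
        have xE: "x \<notin> E" using xS IH(2) by blast
        have "U \<inter> comb (insert x S) (\<lambda>k. b' k m) \<subseteq> comb (insert x E) (\<lambda>k. b' k m)"
        proof
          fix y assume y: "y \<in> U \<inter> comb (insert x S) (\<lambda>k. b' k m)"
          then obtain t s where ts: "y = t *\<^sub>C b' x m + s" "s \<in> comb S (\<lambda>k. b' k m)"
            using comb_insert[OF insert.hyps(1) xS, of "\<lambda>k. b' k m"] by auto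
          have "s = y - t *\<^sub>C b' x m" using ts by simp
          also have "\<dots> \<in> U"
            using y a b'x cvec.subspace_diff[OF U] cvec.subspace_scale[OF U] by simp
          finally have "s \<in> comb E (\<lambda>k. b' k m)" using ts(2) IH(4) cS cE by blast
          then show "y \<in> comb (insert x E) (\<lambda>k. b' k m)"
            using comb_insert[OF finE xE, of "\<lambda>k. b' k m"] ts(1) by auto
        qed
        moreover have "\<forall>k\<in>insert x E. b' k m \<in> U" using b'x a b'S IH(2,3) by auto
        ultimately show ?thesis using sb' IH(2)
          by (intro exI[of _ b'] exI[of _ "insert x E"]) auto
      qed
    qed
  qed
qed

text \<open>
  The strings in \<open>E\<close> are continued to the vertex \<open>Suc m\<close> by the vectors \<open>v k\<close>, the other strings
  ending at \<open>m\<close> stop there, and the indices in \<open>J'\<close> start new strings at \<open>Suc m\<close>.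
\<close>

lemma string_basis_prolong:
  assumes sb: "string_basis \<Gamma> m M I c d b" and m: "1 \<le> m"
    and E: "E \<subseteq> through I c d m" and J': "J' \<inter> I = {}"
    and bas: "is_basis (E \<union> J') v (rep_space M (Suc m))"
    and right: "\<And>k. rightward \<Gamma> m \<Longrightarrow> k \<in> through I c d m \<Longrightarrow>
        rep_map M m (b k m) = (if k \<in> E then v k else 0)"
    and left: "\<And>k. \<not> rightward \<Gamma> m \<Longrightarrow> k \<in> E \<union> J' \<Longrightarrow>
        rep_map M m (v k) = (if k \<in> E then b k m else 0)"
  shows "string_basis \<Gamma> (Suc m) M (I \<union> J') (\<lambda>k. if k \<in> J' then Suc m else c k)
     (\<lambda>k. if k \<in> E \<union> J' then Suc m else d k)
     (\<lambda>k i. if i = Suc m then (if k \<in> E \<union> J' then v k else 0) else if k \<in> J' then 0 else b k i)"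
    (is "string_basis _ _ _ ?I ?c ?d ?b")
proof -
  note D = string_basisD[OF sb]
  have fin: "finite ?I" using D(1) is_basis_finite[OF bas] by simp
  have EI: "k \<in> I \<and> d k = m \<and> c k \<le> m \<and> k \<notin> J'" if "k \<in> E" for k
    using that E D(2)[of k] J' by (auto simp: through_def)
  have itv: "1 \<le> ?c k \<and> ?c k \<le> ?d k \<and> ?d k \<le> Suc m" if "k \<in> ?I" for k
    using that EI[of k] D(2)[of k] by auto
  have out: "?b k i = 0" if "k \<in> ?I" "\<not> (?c k \<le> i \<and> i \<le> ?d k)" for k i
    using that EI[of k] D(2)[of k] D(3)[of k i] by (auto split: if_splits)
  have bas': "is_basis (through ?I ?c ?d i) (\<lambda>k. ?b k i) (rep_space M i)" if i: "1 \<le> i" "i \<le> Suc m" for i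
  proof (cases "i = Suc m")
    case True
    have "k \<in> through ?I ?c ?d i \<longleftrightarrow> k \<in> E \<union> J'" for k
      using True EI[of k] D(2)[of k] by (auto simp: through_def)
    then have "through ?I ?c ?d i = E \<union> J'" by blast
    moreover have "is_basis (E \<union> J') (\<lambda>k. ?b k i) (rep_space M i)
        = is_basis (E \<union> J') v (rep_space M i)"
      by (rule is_basis_cong) (use True in auto)
    ultimately show ?thesis using bas True by simp
  next
    case False
    then have im: "i \<le> m" using i by simp
    have "k \<in> through ?I ?c ?d i \<longleftrightarrow> k \<in> through I c d i" for k
      using im EI[of k] J' by (auto simp: through_def)
    then have eq: "through ?I ?c ?d i = through I c d i" by blast
    have "is_basis (through I c d i) (\<lambda>k. ?b k i) (rep_space M i)
       = is_basis (through I c d i) (\<lambda>k. b k i) (rep_space M i)"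
      by (rule is_basis_cong) (use False J' in \<open>auto simp: through_def\<close>)
    then show ?thesis using D(4)[OF i(1) im] eq by simp
  qed
  have arr: "rep_map M e (?b k (arrow_tail \<Gamma> e)) = ?b k (arrow_head \<Gamma> e)"
    if k: "k \<in> ?I" and e: "1 \<le> e" "e < Suc m"
      and t: "?c k \<le> arrow_tail \<Gamma> e" "arrow_tail \<Gamma> e \<le> ?d k" for k e
  proof (cases "e < m")
    case True
    then have th: "arrow_tail \<Gamma> e \<le> m" "arrow_head \<Gamma> e \<le> m"
      by (auto simp: arrow_tail_def arrow_head_def)
    then have kJ: "k \<notin> J'" using t by auto
    then have kI: "k \<in> I" using k by blast
    have "c k \<le> arrow_tail \<Gamma> e" "arrow_tail \<Gamma> e \<le> d k"
      using t kJ EI[of k] th by (auto split: if_splits)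
    from D(5)[OF kI e(1) True this] show ?thesis using th kJ by simp
  next
    case False
    then have em: "e = m" using e by simp
    show ?thesis
    proof (cases "rightward \<Gamma> m")
      case True
      then have th: "arrow_tail \<Gamma> e = m" "arrow_head \<Gamma> e = Suc m"
        using em by (auto simp: arrow_tail_def arrow_head_def)
      then have kJ: "k \<notin> J'" using t by auto
      then have "k \<in> through I c d m" using k t th EI[of k] by (auto simp: through_def split: if_splits)
      from right[OF True this] show ?thesis using th kJ em by simp
    next
      case False
      then have th: "arrow_tail \<Gamma> e = Suc m" "arrow_head \<Gamma> e = m"
        using em by (auto simp: arrow_tail_def arrow_head_def)
      then have kE: "k \<in> E \<union> J'" using t k D(2)[of k] by (auto split: if_splits)
      from left[OF False this] show ?thesis using th kE em EI[of k] by auto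
    qed
  qed
  show ?thesis unfolding string_basis_def
    using fin itv out bas' arr by (auto simp del: fun_upd_apply)
qed

lemma indep_image:
  assumes fin: "finite J" and bas: "is_basis J v S" and S: "cvec.subspace S"
    and f: "linear_between S T f" and E: "E \<subseteq> J"
    and ker: "{x \<in> S. f x = 0} \<inter> comb J v \<subseteq> comb (J - E) v"
  shows "indep E (\<lambda>k. f (v k))"
  unfolding indep_def
proof (intro allI impI ballI)
  fix a k assume 0: "(\<Sum>k\<in>E. a k *\<^sub>C f (v k)) = 0" and k: "k \<in> E"
  let ?x = "\<Sum>k\<in>E. a k *\<^sub>C v k"
  have v: "v k \<in> S" if "k \<in> J" for k using is_basis_mem[OF bas that] .
  have "f ?x = 0" using linear_sum[OF f S, of E v a] v E 0 by auto
  moreover have "?x \<in> S"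
    by (intro cvec.subspace_sum[OF S] cvec.subspace_scale[OF S]) (use v E in auto)
  moreover have "?x \<in> comb J v" using combI[of a v E] comb_mono[OF fin E, of v] by blast
  ultimately have "?x \<in> comb (J - E) v" using ker by blast
  then obtain a' where a': "?x = (\<Sum>k\<in>J - E. a' k *\<^sub>C v k)" by (rule combE)
  have "(\<Sum>k\<in>J. (if k \<in> E then a k else 0) *\<^sub>C v k) = ?x"
    using fin E by (intro sum.mono_neutral_cong_right) auto
  moreover have "(\<Sum>k\<in>J. (if k \<in> E then 0 else a' k) *\<^sub>C v k) = (\<Sum>k\<in>J - E. a' k *\<^sub>C v k)"
    using fin E by (intro sum.mono_neutral_cong_right) auto
  ultimately have "(if k \<in> E then a k else 0) = (if k \<in> E then 0 else a' k)"
    using indep_unique[OF bas, of "\<lambda>k. if k \<in> E then a k else 0" "\<lambda>k. if k \<in> E then 0 else a' k" k] a' k E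
    by auto
  then show "a k = 0" using k by simp
qed

lemma basis_from_kernel_and_image:
  assumes f: "linear_between S T f" and S: "cvec.subspace S"
    and EJ: "finite E" "E \<inter> J = {}"
    and w: "indep E w" and image: "f ` S \<subseteq> comb E w"
    and g: "\<And>k. k \<in> E \<Longrightarrow> g k \<in> S \<and> f (g k) = w k"
    and ker: "is_basis J u {x \<in> S. f x = 0}"
  shows "is_basis (E \<union> J) (\<lambda>k. if k \<in> E then g k else u k) S"
    (is "is_basis _ ?v _")
proof -
  have finJ: "finite J" using ker by (simp add: is_basis_def)
  have u: "u k \<in> S" "f (u k) = 0" if "k \<in> J" for k using is_basis_mem[OF ker that] by auto
  have split: "(\<Sum>k\<in>E \<union> J. a k *\<^sub>C ?v k) = (\<Sum>k\<in>E. a k *\<^sub>C g k) + (\<Sum>k\<in>J. a k *\<^sub>C u k)" for a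
  proof -
    have "(\<Sum>k\<in>J. a k *\<^sub>C ?v k) = (\<Sum>k\<in>J. a k *\<^sub>C u k)" using EJ(2) by (intro sum.cong) auto
    then show ?thesis using EJ finJ by (simp add: sum.union_disjoint)
  qed
  have gS: "(\<Sum>k\<in>E. a k *\<^sub>C g k) \<in> S" for a
    by (intro cvec.subspace_sum[OF S] cvec.subspace_scale[OF S]) (use g in auto)
  have uS: "(\<Sum>k\<in>J. a k *\<^sub>C u k) \<in> S" for a
    by (intro cvec.subspace_sum[OF S] cvec.subspace_scale[OF S]) (use u in auto)
  have fg: "f (\<Sum>k\<in>E. a k *\<^sub>C g k) = (\<Sum>k\<in>E. a k *\<^sub>C w k)" for a
    using linear_sum[OF f S, of E g a] g by simp
  have fu: "f (\<Sum>k\<in>J. a k *\<^sub>C u k) = 0" for a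
    using linear_sum[OF f S, of J u a] u by simp
  have "indep (E \<union> J) ?v" unfolding indep_def
  proof (intro allI impI ballI)
    fix a k assume 0: "(\<Sum>k\<in>E \<union> J. a k *\<^sub>C ?v k) = 0" and k: "k \<in> E \<union> J"
    have "f ((\<Sum>k\<in>E. a k *\<^sub>C g k) + (\<Sum>k\<in>J. a k *\<^sub>C u k)) = 0"
      using 0 split[of a] linear_zero[OF f S] by simp
    then have "(\<Sum>k\<in>E. a k *\<^sub>C w k) = 0"
      using linear_add[OF f gS uS] fg fu by simp
    then have aE: "\<forall>k\<in>E. a k = 0" using w by (auto simp: indep_def)
    then have "(\<Sum>k\<in>J. a k *\<^sub>C u k) = 0" using 0 split[of a] by simp
    then show "a k = 0" using aE k is_basis_indep[OF ker] by blast
  qed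
  moreover have "S \<subseteq> comb (E \<union> J) ?v"
  proof
    fix x assume x: "x \<in> S"
    then obtain a where a: "f x = (\<Sum>k\<in>E. a k *\<^sub>C w k)" using image by (auto elim: combE)
    let ?y = "x - (\<Sum>k\<in>E. a k *\<^sub>C g k)"
    have "?y \<in> {x \<in> S. f x = 0}"
      using x gS cvec.subspace_diff[OF S] linear_diff[OF f S x gS] a fg by simp
    then have "(\<Sum>k\<in>J. coord J u ?y k *\<^sub>C u k) = ?y" using coord_sum[OF ker] by blast
    then have "x = (\<Sum>k\<in>E. a k *\<^sub>C g k) + (\<Sum>k\<in>J. coord J u ?y k *\<^sub>C u k)" by simp
    also have "\<dots> = (\<Sum>k\<in>E \<union> J. (if k \<in> E then a k else coord J u ?y k) *\<^sub>C ?v k)"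
    proof -
      have "(\<Sum>k\<in>J. (if k \<in> E then a k else coord J u ?y k) *\<^sub>C u k) = (\<Sum>k\<in>J. coord J u ?y k *\<^sub>C u k)"
        using EJ(2) by (intro sum.cong) auto
      then show ?thesis unfolding split by simp
    qed
    finally show "x \<in> comb (E \<union> J) ?v" by (rule comb_eqI)
  qed
  ultimately show ?thesis unfolding is_basis_def using EJ(1) finJ u g by auto
qed

text \<open>
  If the new arrow points to the right, the basis at \<open>m\<close> is adapted to its kernel, and the strings
  outside the kernel are continued by their images. If it points to the left, the basis is adapted to
  its image, and the strings inside the image are continued by preimages.
\<close>

lemma string_basis_step:
  assumes rep: "is_rep \<Gamma> M" and m: "1 \<le> m" "Suc m \<le> num_verts \<Gamma>"
    and sb0: "string_basis \<Gamma> m M I c d b0"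
  shows "\<exists>I c d b. string_basis \<Gamma> (Suc m) M I c d b"
proof -
  have mQ: "m \<in> q_arrows \<Gamma>" and verts: "m \<in> q_verts \<Gamma>" "Suc m \<in> q_verts \<Gamma>"
    using m by (auto simp: q_arrows_def q_verts_def)
  have mle: "m \<le> num_verts \<Gamma>" using m by simp
  let ?Op = "through I c d m" and ?f = "rep_map M m"
  let ?A = "rep_space M m" and ?B = "rep_space M (Suc m)"
  have A: "cvec.subspace ?A" and B: "cvec.subspace ?B" "fin_dim_subspace ?B"
    using is_rep_space[OF rep] verts by auto
  have finI: "finite I" by (rule string_basisD(1)[OF sb0])
  have finOp: "finite ?Op" using finI by (simp add: through_def)
  show ?thesis
  proof (cases "rightward \<Gamma> m")
    case True
    have f: "linear_between ?A ?B ?f"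
      using is_rep_map[OF rep mQ] True by (simp add: arrow_tail_def arrow_head_def)
    let ?U = "{x \<in> ?A. ?f x = 0}"
    obtain b E0 where sb: "string_basis \<Gamma> m M I c d b" and E0: "E0 \<subseteq> ?Op" "\<forall>k\<in>E0. b k m \<in> ?U"
      "?U \<inter> comb ?Op (\<lambda>k. b k m) \<subseteq> comb E0 (\<lambda>k. b k m)"
      using string_basis_adapted[OF rep mle sb0 linear_kernel[OF f A] subset_refl] by blast
    define E where "E = ?Op - E0"
    have bas: "is_basis ?Op (\<lambda>k. b k m) ?A" using string_basisD(4)[OF sb m(1)] by simp
    have EE: "?Op - E = E0" using E0(1) by (auto simp: E_def)
    have "indep E (\<lambda>k. ?f (b k m))"
      by (rule indep_image[OF finOp bas A f]) (use E0(3) EE in \<open>auto simp: E_def\<close>)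
    moreover have "(\<lambda>k. ?f (b k m)) ` E \<subseteq> ?B"
      using is_basis_mem[OF bas] linear_mem[OF f] by (auto simp: E_def)
    moreover have "finite E" "E \<subseteq> I" using finOp by (auto simp: E_def through_def)
    ultimately obtain J' v where J': "J' \<inter> I = {}" "\<And>k. k \<in> E \<Longrightarrow> v k = ?f (b k m)"
      "is_basis (E \<union> J') v ?B"
      using indep_extend[OF B(2), of E "\<lambda>k. ?f (b k m)" I] finI by metis
    have "\<exists>c' d' b'. string_basis \<Gamma> (Suc m) M (I \<union> J') c' d' b'"
      by (rule exI, rule exI, rule exI, rule string_basis_prolong[OF sb m(1) _ J'(1,3)])
        (use True E0(2) J'(2) in \<open>auto simp: E_def\<close>)
    then show ?thesis by blast
  next
    case False
    have f: "linear_between ?B ?A ?f"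
      using is_rep_map[OF rep mQ] False by (simp add: arrow_tail_def arrow_head_def)
    let ?U = "?f ` ?B"
    obtain b E where sb: "string_basis \<Gamma> m M I c d b" and E: "E \<subseteq> ?Op" "\<forall>k\<in>E. b k m \<in> ?U"
      "?U \<inter> comb ?Op (\<lambda>k. b k m) \<subseteq> comb E (\<lambda>k. b k m)"
      using string_basis_adapted[OF rep mle sb0 linear_image[OF f B(1)] subset_refl] by blast
    have bas: "is_basis ?Op (\<lambda>k. b k m) ?A" using string_basisD(4)[OF sb m(1)] by simp
    have finE: "finite E" using E(1) finOp finite_subset by blast
    have "\<forall>k\<in>E. \<exists>y. y \<in> ?B \<and> ?f y = b k m"
    proof
      fix k assume "k \<in> E"
      then have "b k m \<in> ?U" using E(2) by blast
      then obtain y where "b k m = ?f y" "y \<in> ?B" by (rule imageE)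
      then show "\<exists>y. y \<in> ?B \<and> ?f y = b k m" by auto
    qed
    then obtain g where g: "\<And>k. k \<in> E \<Longrightarrow> g k \<in> ?B \<and> ?f (g k) = b k m" by metis
    have "fin_dim_subspace {x \<in> ?B. ?f x = 0}"
      by (rule fin_dim_subspace_subset[OF B(2) linear_kernel[OF f B(1)]]) auto
    then obtain J' :: "nat set" and u where J': "J' \<inter> I = {}" "is_basis J' u {x \<in> ?B. ?f x = 0}"
      using basis_exists_nat finI by blast
    have "indep E (\<lambda>k. b k m)" unfolding indep_def
    proof (intro allI impI ballI)
      fix a k assume 0: "(\<Sum>k\<in>E. a k *\<^sub>C b k m) = 0" and k: "k \<in> E"
      have "(\<Sum>k\<in>?Op. (if k \<in> E then a k else 0) *\<^sub>C b k m) = (\<Sum>k\<in>E. a k *\<^sub>C b k m)"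
        using finOp E(1) by (intro sum.mono_neutral_cong_right) auto
      then show "a k = 0"
        using is_basis_indep[OF bas, of "\<lambda>k. if k \<in> E then a k else 0" k] 0 k E(1) by auto
    qed
    moreover have "?f ` ?B \<subseteq> comb E (\<lambda>k. b k m)"
    proof -
      have "?f ` ?B \<subseteq> ?A" using linear_mem[OF f] by blast
      moreover have "?A \<subseteq> comb ?Op (\<lambda>k. b k m)" using bas by (simp add: is_basis_def)
      ultimately show ?thesis using E(3) by blast
    qed
    moreover have EJ: "E \<inter> J' = {}" using E(1) J'(1) by (auto simp: through_def)
    ultimately have bas': "is_basis (E \<union> J') (\<lambda>k. if k \<in> E then g k else u k) ?B"
      by (intro basis_from_kernel_and_image[OF f B(1) finE EJ _ _ g J'(2)])
    have u0: "?f (u k) = 0" if "k \<in> J'" for k using is_basis_mem[OF J'(2) that] by simp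
    have "\<exists>c' d' b'. string_basis \<Gamma> (Suc m) M (I \<union> J') c' d' b'"
      by (rule exI, rule exI, rule exI, rule string_basis_prolong[OF sb m(1) E(1) J'(1) bas'])
        (use False g u0 EJ in auto)
    then show ?thesis by blast
  qed
qed

text \<open>
  The Krull--Schmidt decomposition for a quiver of type \<open>A\<^sub>n\<close> with arbitrary orientation.
\<close>

theorem string_basis_exists:
  assumes rep: "is_rep \<Gamma> M" and n: "1 \<le> num_verts \<Gamma>"
  obtains I c d b where "string_basis \<Gamma> (num_verts \<Gamma>) M I c d b"
proof -
  have "Suc m \<le> num_verts \<Gamma> \<Longrightarrow> \<exists>I c d b. string_basis \<Gamma> (Suc m) M I c d b" for m
  proof (induction m)
    case 0
    then have "1 \<in> q_verts \<Gamma>" by (simp add: q_verts_def)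
    then obtain J :: "nat set" and v where J: "is_basis J v (rep_space M 1)"
      using basis_exists_nat[OF is_rep_space(1)[OF rep], of 1 "{}"] by auto
    have "string_basis \<Gamma> (Suc 0) M J (\<lambda>_. 1) (\<lambda>_. 1) (\<lambda>k i. if i = 1 then v k else 0)"
      using J is_basis_finite[OF J] by (auto simp: string_basis_def through_def)
    then show ?case by blast
  next
    case (Suc m)
    then obtain I c d b where "string_basis \<Gamma> (Suc m) M I c d b" by auto
    then show ?case using string_basis_step[OF rep _ Suc.prems] by simp
  qed
  from this[of "num_verts \<Gamma> - 1"] n that show ?thesis by auto
qed

lemma linear_restrict:
  "linear_between S T f \<Longrightarrow> S' \<subseteq> S \<Longrightarrow> (\<And>x. x \<in> S' \<Longrightarrow> f x \<in> T') \<Longrightarrow> linear_between S' T' f"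
  unfolding linear_between_def by (intro conjI ballI allI) (auto simp: subset_iff)

section \<open>Homomorphisms\<close>

lemma linear_between_lincomb:
  assumes "linear_between S T f" "linear_between S T g" "cvec.subspace T"
  shows "linear_between S T (\<lambda>x. f x + t *\<^sub>C g x)"
  unfolding linear_between_def
proof (intro conjI ballI allI)
  show "(\<lambda>x. f x + t *\<^sub>C g x) ` S \<subseteq> T"
    using assms linear_mem cvec.subspace_add[OF assms(3)] cvec.subspace_scale[OF assms(3)] by blast
qed (simp_all add: linear_add[OF assms(1)] linear_add[OF assms(2)]
    linear_scale[OF assms(1)] linear_scale[OF assms(2)] scaleC_add_right mult.commute)

lemma linear_between_scale_vec:
  assumes "linear_between S UNIV f" "cvec.subspace T" "z \<in> T"
  shows "linear_between S T (\<lambda>x. f x *\<^sub>C z)"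
  unfolding linear_between_def
  by (intro conjI ballI allI)
    (auto simp: linear_add[OF assms(1)] linear_scale[OF assms(1)] scaleC_add_left
      scaleC_complex_def cvec.subspace_scale[OF assms(2,3)])

lemma linear_between_const_zero: "cvec.subspace T \<Longrightarrow> linear_between S T (\<lambda>x. 0)"
  by (auto simp: linear_between_def cvec.subspace_0)

lemma is_hom_lin: "is_hom \<Gamma> L M f \<Longrightarrow> i \<in> q_verts \<Gamma> \<Longrightarrow> linear_between (rep_space L i) (rep_space M i) (f i)"
  by (simp add: is_hom_def)

lemmas hom_mem = linear_mem[OF is_hom_lin]
  and hom_add = linear_add[OF is_hom_lin]
  and hom_scale = linear_scale[OF is_hom_lin]
  and hom_zero = linear_zero[OF is_hom_lin]
  and hom_diff = linear_diff[OF is_hom_lin]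

lemma is_hom_arrow:
  "is_hom \<Gamma> L M f \<Longrightarrow> e \<in> q_arrows \<Gamma> \<Longrightarrow> x \<in> rep_space L (arrow_tail \<Gamma> e)
    \<Longrightarrow> f (arrow_head \<Gamma> e) (rep_map L e x) = rep_map M e (f (arrow_tail \<Gamma> e) x)"
  by (simp add: is_hom_def)

lemma is_hom_id: "is_hom \<Gamma> M M (\<lambda>i x. x)"
  by (auto simp: is_hom_def linear_between_def)

lemma is_hom_comp:
  assumes "is_hom \<Gamma> L M f" "is_hom \<Gamma> M N g"
  shows "is_hom \<Gamma> L N (\<lambda>i x. g i (f i x))"
  unfolding is_hom_def
proof (intro conjI ballI)
  fix i assume i: "i \<in> q_verts \<Gamma>"
  show "linear_between (rep_space L i) (rep_space N i) (\<lambda>x. g i (f i x))"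
    by (rule linear_comp[OF is_hom_lin[OF assms(1) i] is_hom_lin[OF assms(2) i]])
next
  fix e x assume e: "e \<in> q_arrows \<Gamma>" and x: "x \<in> rep_space L (arrow_tail \<Gamma> e)"
  show "g (arrow_head \<Gamma> e) (f (arrow_head \<Gamma> e) (rep_map L e x)) = rep_map N e (g (arrow_tail \<Gamma> e) (f (arrow_tail \<Gamma> e) x))"
    using is_hom_arrow[OF assms(1) e x]
      is_hom_arrow[OF assms(2) e hom_mem[OF assms(1) arrow_in_verts(1)[OF e] x]]
    by simp
qed

lemma is_hom_lincomb:
  assumes f: "is_hom \<Gamma> L M f" and g: "is_hom \<Gamma> L M g" and M: "is_rep \<Gamma> M"
  shows "is_hom \<Gamma> L M (\<lambda>i x. f i x + t *\<^sub>C g i x)"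
  unfolding is_hom_def
proof (intro conjI ballI)
  fix i assume i: "i \<in> q_verts \<Gamma>"
  show "linear_between (rep_space L i) (rep_space M i) (\<lambda>x. f i x + t *\<^sub>C g i x)"
    by (rule linear_between_lincomb[OF is_hom_lin[OF f i] is_hom_lin[OF g i] is_rep_space(2)[OF M i]])
next
  fix e x assume e: "e \<in> q_arrows \<Gamma>" and x: "x \<in> rep_space L (arrow_tail \<Gamma> e)"
  note t = arrow_in_verts(1)[OF e]
  have fx: "f (arrow_tail \<Gamma> e) x \<in> rep_space M (arrow_tail \<Gamma> e)"
    and gx: "g (arrow_tail \<Gamma> e) x \<in> rep_space M (arrow_tail \<Gamma> e)"
    using hom_mem[OF f t x] hom_mem[OF g t x] .
  show "f (arrow_head \<Gamma> e) (rep_map L e x) + t *\<^sub>C g (arrow_head \<Gamma> e) (rep_map L e x)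
      = rep_map M e (f (arrow_tail \<Gamma> e) x + t *\<^sub>C g (arrow_tail \<Gamma> e) x)" for t
    using is_hom_arrow[OF f e x] is_hom_arrow[OF g e x]
      arrow_add[OF M e fx cvec.subspace_scale[OF is_rep_space(2)[OF M t] gx, of t]]
      arrow_scale[OF M e gx, of t]
    by simp
qed

text \<open>
  A homomorphism from \<open>M\<close> to the interval representation on \<open>c, \<dots>, d\<close>, whose spaces are
  one-dimensional, is a family of functionals.
\<close>

definition covec :: "quiver \<Rightarrow> 'v::complex_vector rep \<Rightarrow> nat \<Rightarrow> nat \<Rightarrow> (nat \<Rightarrow> 'v \<Rightarrow> complex) \<Rightarrow> bool" where
  "covec \<Gamma> M c d f \<longleftrightarrow>
     (\<forall>i\<in>q_verts \<Gamma>. linear_between (rep_space M i) UNIV (f i)) \<and>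
     (\<forall>e\<in>q_arrows \<Gamma>. \<forall>x\<in>rep_space M (arrow_tail \<Gamma> e). arrow_head \<Gamma> e \<in> {c..d} \<longrightarrow>
        f (arrow_head \<Gamma> e) (rep_map M e x) = (if arrow_tail \<Gamma> e \<in> {c..d} then f (arrow_tail \<Gamma> e) x else 0))"

text \<open>
  Dually, a homomorphism from the interval representation on \<open>c, \<dots>, d\<close> to \<open>M\<close> is the family of
  images of the basis vectors.
\<close>

definition stringvec :: "quiver \<Rightarrow> 'v::complex_vector rep \<Rightarrow> nat \<Rightarrow> nat \<Rightarrow> (nat \<Rightarrow> 'v) \<Rightarrow> bool" where
  "stringvec \<Gamma> M c d z \<longleftrightarrow>
     (\<forall>i\<in>q_verts \<Gamma>. i \<in> {c..d} \<longrightarrow> z i \<in> rep_space M i) \<and>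
     (\<forall>e\<in>q_arrows \<Gamma>. arrow_tail \<Gamma> e \<in> {c..d} \<longrightarrow>
        rep_map M e (z (arrow_tail \<Gamma> e)) = (if arrow_head \<Gamma> e \<in> {c..d} then z (arrow_head \<Gamma> e) else 0))"

lemma covecD:
  assumes "covec \<Gamma> M c d f"
  shows "i \<in> q_verts \<Gamma> \<Longrightarrow> linear_between (rep_space M i) UNIV (f i)"
    and "e \<in> q_arrows \<Gamma> \<Longrightarrow> x \<in> rep_space M (arrow_tail \<Gamma> e) \<Longrightarrow> arrow_head \<Gamma> e \<in> {c..d} \<Longrightarrow>
        f (arrow_head \<Gamma> e) (rep_map M e x) = (if arrow_tail \<Gamma> e \<in> {c..d} then f (arrow_tail \<Gamma> e) x else 0)"
  using assms unfolding covec_def by blast+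

lemma stringvecD:
  assumes "stringvec \<Gamma> M c d z"
  shows "i \<in> q_verts \<Gamma> \<Longrightarrow> i \<in> {c..d} \<Longrightarrow> z i \<in> rep_space M i"
    and "e \<in> q_arrows \<Gamma> \<Longrightarrow> arrow_tail \<Gamma> e \<in> {c..d} \<Longrightarrow>
        rep_map M e (z (arrow_tail \<Gamma> e)) = (if arrow_head \<Gamma> e \<in> {c..d} then z (arrow_head \<Gamma> e) else 0)"
  using assms unfolding stringvec_def by blast+

text \<open>
  The composite of a homomorphism to an interval representation with one from it.
\<close>

definition through_string :: "nat \<Rightarrow> nat \<Rightarrow> (nat \<Rightarrow> 'v \<Rightarrow> complex) \<Rightarrow> (nat \<Rightarrow> 'w::complex_vector) \<Rightarrow> nat \<Rightarrow> 'v \<Rightarrow> 'w" where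
  "through_string c d f z = (\<lambda>i x. if i \<in> {c..d} then f i x *\<^sub>C z i else 0)"

lemma through_string_is_hom:
  assumes f: "covec \<Gamma> M c d f" and z: "stringvec \<Gamma> N c d z" and M: "is_rep \<Gamma> M" and N: "is_rep \<Gamma> N"
  shows "is_hom \<Gamma> M N (through_string c d f z)"
  unfolding is_hom_def
proof (intro conjI ballI)
  fix i assume i: "i \<in> q_verts \<Gamma>"
  show "linear_between (rep_space M i) (rep_space N i) (through_string c d f z i)"
  proof (cases "i \<in> {c..d}")
    case True
    show ?thesis unfolding through_string_def if_P[OF True]
      by (rule linear_between_scale_vec[OF covecD(1)[OF f i] is_rep_space(2)[OF N i] stringvecD(1)[OF z i True]])
  next
    case False
    show ?thesis unfolding through_string_def if_not_P[OF False]
      by (rule linear_between_const_zero[OF is_rep_space(2)[OF N i]])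
  qed
next
  fix e x assume e: "e \<in> q_arrows \<Gamma>" and x: "x \<in> rep_space M (arrow_tail \<Gamma> e)"
  let ?t = "arrow_tail \<Gamma> e" and ?h = "arrow_head \<Gamma> e"
  note tv = arrow_in_verts[OF e]
  note lin = is_rep_map[OF N e]
  show "through_string c d f z ?h (rep_map M e x) = rep_map N e (through_string c d f z ?t x)"
  proof (cases "?t \<in> {c..d}")
    case True
    then have "rep_map N e (f ?t x *\<^sub>C z ?t) = f ?t x *\<^sub>C (if ?h \<in> {c..d} then z ?h else 0)"
      using linear_scale[OF lin stringvecD(1)[OF z tv(1) True]] stringvecD(2)[OF z e True] by simp
    then show ?thesis using True covecD(2)[OF f e x] unfolding through_string_def by auto
  next
    case False
    then show ?thesis using covecD(2)[OF f e x] linear_zero[OF lin is_rep_space(2)[OF N tv(1)]]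
      unfolding through_string_def by auto
  qed
qed

lemma covec_stringvec_const:
  assumes f: "covec \<Gamma> M c d f" and z: "stringvec \<Gamma> M a b z"
    and i: "i \<in> {c..d} \<inter> {a..b} \<inter> q_verts \<Gamma>" and j: "j \<in> {c..d} \<inter> {a..b} \<inter> q_verts \<Gamma>"
  shows "f i (z i) = f j (z j)"
proof -
  have step: "f (Suc k) (z (Suc k)) = f k (z k)"
    if k: "k \<in> {c..d} \<inter> {a..b} \<inter> q_verts \<Gamma>" "Suc k \<in> {c..d} \<inter> {a..b} \<inter> q_verts \<Gamma>" for k
  proof -
    have e: "k \<in> q_arrows \<Gamma>" using k by (auto simp: q_arrows_def q_verts_def)
    let ?t = "arrow_tail \<Gamma> k" and ?h = "arrow_head \<Gamma> k"
    have th: "?t \<in> {c..d}" "?t \<in> {a..b}" "?h \<in> {c..d}" "?h \<in> {a..b}"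
      using k by (auto simp: arrow_tail_def arrow_head_def)
    have "f ?h (z ?h) = f ?t (z ?t)"
      using stringvecD(2)[OF z e th(2)] th
        covecD(2)[OF f e stringvecD(1)[OF z arrow_in_verts(1)[OF e] th(2)] th(3)] by simp
    then show ?thesis by (auto simp: arrow_tail_def arrow_head_def split: if_splits)
  qed
  have up: "f j (z j) = f i (z i)"
    if "i \<le> j" "i \<in> {c..d} \<inter> {a..b} \<inter> q_verts \<Gamma>" "j \<in> {c..d} \<inter> {a..b} \<inter> q_verts \<Gamma>" for i j
    using that
  proof (induction j rule: dec_induct)
    case (step k)
    then have "k \<in> {c..d} \<inter> {a..b} \<inter> q_verts \<Gamma>" by (auto simp: q_verts_def)
    then show ?case using step \<open>\<And>k. _ \<Longrightarrow> _ \<Longrightarrow> f (Suc k) (z (Suc k)) = f k (z k)\<close>[of k] by simp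
  qed simp
  show ?thesis using up[of i j] up[of j i] i j by (cases "i \<le> j") auto
qed

section \<open>Representations with a string basis\<close>

locale string_rep =
  fixes \<Gamma> :: quiver and M :: "'v::complex_vector rep"
    and I :: "nat set" and c d :: "nat \<Rightarrow> nat" and b :: "nat \<Rightarrow> nat \<Rightarrow> 'v"
  assumes rep: "is_rep \<Gamma> M" and strings: "string_basis \<Gamma> (num_verts \<Gamma>) M I c d b"
begin

definition cf :: "nat \<Rightarrow> nat \<Rightarrow> 'v \<Rightarrow> complex" where
  "cf k i x = coord (through I c d i) (\<lambda>k. b k i) x k"

lemma finite_I: "finite I" by (rule string_basisD(1)[OF strings])

lemma finite_through: "finite (through I c d i)"
  using finite_I by (simp add: through_def)

lemma basis_at: "i \<in> q_verts \<Gamma> \<Longrightarrow> is_basis (through I c d i) (\<lambda>k. b k i) (rep_space M i)"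
  using string_basisD(4)[OF strings] by (simp add: q_verts_def)

lemma sub: "i \<in> q_verts \<Gamma> \<Longrightarrow> cvec.subspace (rep_space M i)"
  by (rule is_rep_space(2)[OF rep])

lemma b_outside: "k \<in> I \<Longrightarrow> i \<notin> {c k..d k} \<Longrightarrow> b k i = 0"
  using string_basisD(3)[OF strings, of k i] by auto

lemma b_mem:
  assumes "k \<in> I" "i \<in> q_verts \<Gamma>"
  shows "b k i \<in> rep_space M i"
  using is_basis_mem[OF basis_at[OF assms(2)], of k] b_outside[OF assms(1), of i]
    cvec.subspace_0[OF sub[OF assms(2)]] assms(1)
  by (cases "i \<in> {c k..d k}") (auto simp: through_def)

lemma b_arrow:
  assumes "k \<in> I" "e \<in> q_arrows \<Gamma>" "arrow_tail \<Gamma> e \<in> {c k..d k}"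
  shows "rep_map M e (b k (arrow_tail \<Gamma> e)) = b k (arrow_head \<Gamma> e)"
  using string_basisD(5)[OF strings assms(1), of e] assms by (auto simp: q_arrows_def)

lemma b_stringvec:
  assumes "k \<in> I"
  shows "stringvec \<Gamma> M (c k) (d k) (b k)"
  unfolding stringvec_def
  using assms b_mem b_arrow[OF assms] b_outside[OF assms] by auto

lemma cf_outside: "i \<notin> {c k..d k} \<Longrightarrow> cf k i x = 0"
  unfolding cf_def by (rule coord_outside) (auto simp: through_def)

lemma cf_linear:
  assumes "i \<in> q_verts \<Gamma>"
  shows "linear_between (rep_space M i) UNIV (cf k i)"
  unfolding linear_between_def cf_def
  using coord_add[OF basis_at sub, OF assms assms] coord_scale[OF basis_at sub, OF assms assms]
  by (simp add: scaleC_complex_def)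

lemma expand:
  assumes i: "i \<in> q_verts \<Gamma>" and x: "x \<in> rep_space M i"
  shows "x = (\<Sum>k\<in>through I c d i. cf k i x *\<^sub>C b k i)"
  unfolding cf_def using coord_sum[OF basis_at[OF i] x] by simp

lemma cf_b:
  assumes "i \<in> q_verts \<Gamma>" "k \<in> through I c d i"
  shows "cf l i (b k i) = (if l = k then 1 else 0)"
  unfolding cf_def by (rule coord_basis[OF basis_at[OF assms(1)] assms(2)])

lemma cf_arrow:
  assumes e: "e \<in> q_arrows \<Gamma>" and x: "x \<in> rep_space M (arrow_tail \<Gamma> e)"
    and k: "k \<in> I" "arrow_head \<Gamma> e \<in> {c k..d k}"
  shows "cf k (arrow_head \<Gamma> e) (rep_map M e x) = cf k (arrow_tail \<Gamma> e) x"
proof -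
  let ?t = "arrow_tail \<Gamma> e" and ?h = "arrow_head \<Gamma> e"
  note tv = arrow_in_verts[OF e]
  have "rep_map M e x = rep_map M e (\<Sum>l\<in>through I c d ?t. cf l ?t x *\<^sub>C b l ?t)"
    using expand[OF tv(1) x] by simp
  also have "\<dots> = (\<Sum>l\<in>through I c d ?t. cf l ?t x *\<^sub>C rep_map M e (b l ?t))"
    by (rule arrow_sum[OF rep e sub[OF tv(1)]])
      (auto intro: is_basis_mem[OF basis_at[OF tv(1)]])
  also have "\<dots> = (\<Sum>l\<in>through I c d ?t. cf l ?t x *\<^sub>C b l ?h)"
    by (rule sum.cong) (use b_arrow[OF _ e] in \<open>auto simp: through_def\<close>)
  also have "\<dots> = (\<Sum>l\<in>I. cf l ?t x *\<^sub>C b l ?h)"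
    by (rule sum.mono_neutral_left) (use finite_I cf_outside in \<open>auto simp: through_def\<close>)
  also have "\<dots> = (\<Sum>l\<in>through I c d ?h. cf l ?t x *\<^sub>C b l ?h)"
    by (rule sum.mono_neutral_right) (use finite_I b_outside in \<open>auto simp: through_def\<close>)
  finally have eq: "rep_map M e x = (\<Sum>l\<in>through I c d ?h. cf l ?t x *\<^sub>C b l ?h)" .
  show ?thesis
    using coord_eqI[OF basis_at[OF tv(2)] eq arrow_mem[OF rep e x], of k] k
    unfolding cf_def[of k ?h] by (simp add: through_def)
qed

lemma cf_covec:
  assumes "k \<in> I"
  shows "covec \<Gamma> M (c k) (d k) (cf k)"
  unfolding covec_def using assms cf_linear cf_arrow cf_outside by auto

end

section \<open>The form of an \<open>\<epsilon>\<close>-representation\<close>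

text \<open>
  Induction on \<open>G\<close>, restricting to the kernel of one of the functionals.
\<close>

lemma functional_in_span:
  assumes S: "cvec.subspace S" and fin: "finite G"
    and g: "\<And>y. y \<in> G \<Longrightarrow> linear_between S UNIV (g y)" and f: "linear_between S UNIV f"
    and ker: "\<And>x. x \<in> S \<Longrightarrow> (\<And>y. y \<in> G \<Longrightarrow> g y x = 0) \<Longrightarrow> f x = (0::complex)"
  shows "\<exists>a. \<forall>x\<in>S. f x = (\<Sum>y\<in>G. a y * g y x)"
  using fin S g f ker
proof (induction G arbitrary: S f rule: finite_induct)
  case empty
  then show ?case by simp
next
  case (insert y0 G)
  note S = insert.prems(1) and g = insert.prems(2) and f = insert.prems(3) and ker = insert.prems(4)
  let ?S = "{x \<in> S. g y0 x = 0}"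
  have S': "cvec.subspace ?S" by (rule linear_kernel[OF g S]) simp
  have res: "linear_between ?S UNIV h" if "linear_between S UNIV h" for h :: "'a \<Rightarrow> complex"
    by (rule linear_restrict[OF that]) auto
  have "\<exists>a. \<forall>x\<in>?S. f x = (\<Sum>y\<in>G. a y * g y x)"
  proof (rule insert.IH[OF S'])
    show "linear_between ?S UNIV (g y)" if "y \<in> G" for y using res[OF g] that by simp
    show "linear_between ?S UNIV f" by (rule res[OF f])
    show "f x = 0" if "x \<in> ?S" "\<And>y. y \<in> G \<Longrightarrow> g y x = 0" for x
      by (rule ker) (use that in auto)
  qed
  then obtain a where a: "\<And>x. x \<in> S \<Longrightarrow> g y0 x = 0 \<Longrightarrow> f x = (\<Sum>y\<in>G. a y * g y x)" by auto
  show ?case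
  proof (cases "\<exists>x\<in>S. g y0 x \<noteq> 0")
    case False
    then have "\<forall>x\<in>S. f x = (\<Sum>y\<in>insert y0 G. a y * g y x)" using a insert.hyps by simp
    then show ?thesis by (rule exI[of _ a])
  next
    case True
    then obtain x0 where x0: "x0 \<in> S" "g y0 x0 \<noteq> 0" by blast
    define t where "t = (f x0 - (\<Sum>y\<in>G. a y * g y x0)) / g y0 x0"
    have "f x = (\<Sum>y\<in>insert y0 G. (a(y0 := t)) y * g y x)" if x: "x \<in> S" for x
    proof -
      define s where "s = g y0 x / g y0 x0"
      have sx: "s *\<^sub>C x0 \<in> S" using cvec.subspace_scale[OF S x0(1)] .
      have xs: "x - s *\<^sub>C x0 \<in> S" using cvec.subspace_diff[OF S x sx] .
      have diff: "h (x - s *\<^sub>C x0) = h x - s * h x0" if "linear_between S UNIV h" for h :: "'a \<Rightarrow> complex"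
        using linear_diff[OF that S x sx] linear_scale[OF that x0(1)]
        by (simp add: scaleC_complex_def)
      have "g y0 (x - s *\<^sub>C x0) = 0" using diff[OF g[of y0]] x0 by (simp add: s_def)
      from a[OF xs this] have "f x - s * f x0 = (\<Sum>y\<in>G. a y * (g y x - s * g y x0))"
        using diff[OF f] diff[OF g] by simp
      also have "\<dots> = (\<Sum>y\<in>G. a y * g y x) - s * (\<Sum>y\<in>G. a y * g y x0)"
        by (simp add: algebra_simps sum_subtractf sum_distrib_left)
      finally have "f x = (\<Sum>y\<in>G. a y * g y x) + s * (f x0 - (\<Sum>y\<in>G. a y * g y x0))"
        by (simp add: algebra_simps)
      also have "s * (f x0 - (\<Sum>y\<in>G. a y * g y x0)) = t * g y0 x"
        using x0 by (simp add: s_def t_def)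
      also have "(\<Sum>y\<in>G. a y * g y x) = (\<Sum>y\<in>G. (a(y0 := t)) y * g y x)"
        using insert.hyps by (intro sum.cong) auto
      finally show ?thesis using insert.hyps by simp
    qed
    then show ?thesis by blast
  qed
qed

locale eps_rep =
  fixes \<Gamma> :: quiver and \<epsilon> :: complex and V :: "nat \<Rightarrow> 'v::complex_vector set"
    and B :: "nat \<Rightarrow> nat \<Rightarrow> 'v \<Rightarrow> 'v \<Rightarrow> complex" and M :: "'v rep"
  assumes n2: "num_verts \<Gamma> \<ge> 2" and symq: "symmetric_quiver \<Gamma>"
    and epsrep: "eps_representation \<Gamma> \<epsilon> V B M"
    and eps: "\<epsilon> = 1 \<or> \<epsilon> = - 1"
begin

abbreviation \<sigma> :: "nat \<Rightarrow> nat" where "\<sigma> \<equiv> vert_inv \<Gamma>"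
abbreviation \<tau> :: "nat \<Rightarrow> nat" where "\<tau> \<equiv> arrow_inv \<Gamma>"

lemma M_rep: "is_rep \<Gamma> M"
  using epsrep by (simp add: eps_representation_def)

lemma \<sigma>_verts [simp]: "i \<in> q_verts \<Gamma> \<Longrightarrow> \<sigma> i \<in> q_verts \<Gamma>"
  by (auto simp: q_verts_def vert_inv_def)

lemma \<sigma>_invol [simp]: "i \<in> q_verts \<Gamma> \<Longrightarrow> \<sigma> (\<sigma> i) = i"
  by (auto simp: q_verts_def vert_inv_def)

lemma \<tau>_arrows [simp]: "e \<in> q_arrows \<Gamma> \<Longrightarrow> \<tau> e \<in> q_arrows \<Gamma>"
  by (auto simp: q_arrows_def arrow_inv_def)

lemma \<tau>_invol [simp]: "e \<in> q_arrows \<Gamma> \<Longrightarrow> \<tau> (\<tau> e) = e"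
  by (auto simp: q_arrows_def arrow_inv_def)

lemma \<tau>_ends [simp]:
  assumes "e \<in> q_arrows \<Gamma>"
  shows "arrow_tail \<Gamma> (\<tau> e) = \<sigma> (arrow_head \<Gamma> e)" "arrow_head \<Gamma> (\<tau> e) = \<sigma> (arrow_tail \<Gamma> e)"
  using symq assms by (auto simp: symmetric_quiver_def)

lemma rightward_\<tau>:
  assumes "e \<in> q_arrows \<Gamma>"
  shows "rightward \<Gamma> (num_verts \<Gamma> - e) = rightward \<Gamma> e"
  using \<tau>_ends(1)[OF assms] assms
  by (auto simp: arrow_tail_def arrow_head_def arrow_inv_def vert_inv_def q_arrows_def split: if_splits)

lemma form:
  assumes i: "i \<in> q_verts \<Gamma>" and j: "j \<in> q_verts \<Gamma>"
  shows form_right: "v \<in> rep_space M i \<Longrightarrow> linear_between (rep_space M j) UNIV (\<lambda>w. B i j v w)"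
    and form_left: "w \<in> rep_space M j \<Longrightarrow> linear_between (rep_space M i) UNIV (\<lambda>v. B i j v w)"
    and form_orth: "j \<noteq> \<sigma> i \<Longrightarrow> v \<in> rep_space M i \<Longrightarrow> w \<in> rep_space M j \<Longrightarrow> B i j v w = 0"
    and form_sym: "v \<in> rep_space M i \<Longrightarrow> w \<in> rep_space M j \<Longrightarrow> B i j v w = \<epsilon> * B j i w v"
proof -
  have q: "quadratic_space \<Gamma> \<epsilon> V B" and V: "\<And>i. i \<in> q_verts \<Gamma> \<Longrightarrow> rep_space M i = V i"
    using epsrep by (auto simp: eps_representation_def)
  have *: "(\<forall>v\<in>V i. linear_between (V j) UNIV (\<lambda>w. B i j v w)) \<and>
        (\<forall>w\<in>V j. linear_between (V i) UNIV (\<lambda>v. B i j v w)) \<and>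
        (j \<noteq> \<sigma> i \<longrightarrow> (\<forall>v\<in>V i. \<forall>w\<in>V j. B i j v w = 0)) \<and>
        (\<forall>v\<in>V i. \<forall>w\<in>V j. B i j v w = \<epsilon> * B j i w v)"
    using conjunct1[OF conjunct2[OF q[unfolded quadratic_space_def]], rule_format, OF i j] .
  show "v \<in> rep_space M i \<Longrightarrow> linear_between (rep_space M j) UNIV (\<lambda>w. B i j v w)"
    and "w \<in> rep_space M j \<Longrightarrow> linear_between (rep_space M i) UNIV (\<lambda>v. B i j v w)"
    and "j \<noteq> \<sigma> i \<Longrightarrow> v \<in> rep_space M i \<Longrightarrow> w \<in> rep_space M j \<Longrightarrow> B i j v w = 0"
    and "v \<in> rep_space M i \<Longrightarrow> w \<in> rep_space M j \<Longrightarrow> B i j v w = \<epsilon> * B j i w v"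
    using * unfolding V[OF i] V[OF j] by blast+
qed

lemma form_nondeg:
  assumes i: "i \<in> q_verts \<Gamma>" and v: "v \<in> rep_space M i"
    and 0: "\<And>w. w \<in> rep_space M (\<sigma> i) \<Longrightarrow> B i (\<sigma> i) v w = 0"
  shows "v = 0"
proof -
  have q: "quadratic_space \<Gamma> \<epsilon> V B" and V: "\<And>i. i \<in> q_verts \<Gamma> \<Longrightarrow> rep_space M i = V i"
    using epsrep by (auto simp: eps_representation_def)
  have "\<forall>j\<in>q_verts \<Gamma>. \<forall>w\<in>V j. B i j v w = 0"
  proof (intro ballI)
    fix j w assume j: "j \<in> q_verts \<Gamma>" and w: "w \<in> V j"
    show "B i j v w = 0"
      using 0[of w] form_orth[OF i j _ v, of w] j w V by (cases "j = \<sigma> i") auto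
  qed
  moreover have "v \<in> V i" using v V[OF i] by simp
  ultimately show ?thesis
    using conjunct2[OF conjunct2[OF q[unfolded quadratic_space_def]]] i by blast
qed

lemma form_nondeg_right:
  assumes i: "i \<in> q_verts \<Gamma>" and v: "v \<in> rep_space M i"
    and 0: "\<And>w. w \<in> rep_space M (\<sigma> i) \<Longrightarrow> B (\<sigma> i) i w v = 0"
  shows "v = 0"
  using form_nondeg[OF i v] 0 form_sym[OF i \<sigma>_verts[OF i] v] by simp

lemma form_adjoint:
  assumes e: "e \<in> q_arrows \<Gamma>" and v: "v \<in> rep_space M (arrow_tail \<Gamma> e)"
    and w: "w \<in> rep_space M (\<sigma> (arrow_head \<Gamma> e))"
  shows "B (arrow_head \<Gamma> e) (\<sigma> (arrow_head \<Gamma> e)) (rep_map M e v) w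
       = - B (arrow_tail \<Gamma> e) (\<sigma> (arrow_tail \<Gamma> e)) v (rep_map M (\<tau> e) w)"
proof -
  have V: "\<And>i. i \<in> q_verts \<Gamma> \<Longrightarrow> rep_space M i = V i"
    using epsrep by (auto simp: eps_representation_def)
  have "B (arrow_head \<Gamma> e) (\<sigma> (arrow_head \<Gamma> e)) (rep_map M e v) w
       + B (arrow_tail \<Gamma> e) (\<sigma> (arrow_tail \<Gamma> e)) v (rep_map M (\<tau> e) w) = 0"
    using epsrep e v w V[OF arrow_in_verts(1)[OF e]] V[OF \<sigma>_verts[OF arrow_in_verts(2)[OF e]]]
    unfolding eps_representation_def by auto
  then show ?thesis by (simp add: eq_neg_iff_add_eq_0)
qed

lemma form_represents:
  assumes i: "i \<in> q_verts \<Gamma>" and f: "linear_between (rep_space M i) UNIV f"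
  obtains y where "y \<in> rep_space M (\<sigma> i)" "\<And>x. x \<in> rep_space M i \<Longrightarrow> B i (\<sigma> i) x y = f x"
proof -
  have j: "\<sigma> i \<in> q_verts \<Gamma>" using i by simp
  obtain J :: "nat set" and v where bas: "is_basis J v (rep_space M (\<sigma> i))"
    using basis_exists_nat[OF is_rep_space(1)[OF M_rep j], of "{}"] by auto
  have S: "cvec.subspace (rep_space M i)" "cvec.subspace (rep_space M (\<sigma> i))"
    using is_rep_space(2)[OF M_rep] i j by auto
  have "\<exists>a. \<forall>x\<in>rep_space M i. f x = (\<Sum>k\<in>J. a k * B i (\<sigma> i) x (v k))"
  proof (rule functional_in_span[OF S(1) is_basis_finite[OF bas] _ f])
    show "linear_between (rep_space M i) UNIV (\<lambda>x. B i (\<sigma> i) x (v k))" if "k \<in> J" for k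
      by (rule form_left[OF i j is_basis_mem[OF bas that]])
    fix x assume x: "x \<in> rep_space M i" and 0: "\<And>k. k \<in> J \<Longrightarrow> B i (\<sigma> i) x (v k) = 0"
    have "B i (\<sigma> i) x w = 0" if w: "w \<in> rep_space M (\<sigma> i)" for w
    proof -
      have "B i (\<sigma> i) x w = B i (\<sigma> i) x (\<Sum>k\<in>J. coord J v w k *\<^sub>C v k)"
        using coord_sum[OF bas w] by simp
      also have "\<dots> = (\<Sum>k\<in>J. coord J v w k *\<^sub>C B i (\<sigma> i) x (v k))"
        by (rule linear_sum[OF form_right[OF i j x] S(2)]) (rule is_basis_mem[OF bas])
      also have "\<dots> = 0" using 0 by simp
      finally show ?thesis .
    qed
    then have "x = 0" using form_nondeg[OF i x] by blast
    then show "f x = 0" using linear_zero[OF f S(1)] by simp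
  qed
  then obtain a where a: "\<And>x. x \<in> rep_space M i \<Longrightarrow> f x = (\<Sum>k\<in>J. a k * B i (\<sigma> i) x (v k))" by blast
  show ?thesis
  proof (rule that[of "\<Sum>k\<in>J. a k *\<^sub>C v k"])
    show "(\<Sum>k\<in>J. a k *\<^sub>C v k) \<in> rep_space M (\<sigma> i)"
      by (intro cvec.subspace_sum[OF S(2)] cvec.subspace_scale[OF S(2)] is_basis_mem[OF bas])
    fix x assume x: "x \<in> rep_space M i"
    have "B i (\<sigma> i) x (\<Sum>k\<in>J. a k *\<^sub>C v k) = (\<Sum>k\<in>J. a k *\<^sub>C B i (\<sigma> i) x (v k))"
      by (rule linear_sum[OF form_right[OF i j x] S(2)]) (rule is_basis_mem[OF bas])
    then show "B i (\<sigma> i) x (\<Sum>k\<in>J. a k *\<^sub>C v k) = f x" using a[OF x] by (simp add: scaleC_complex_def)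
  qed
qed

lemma form_represents_left:
  assumes i: "i \<in> q_verts \<Gamma>" and f: "linear_between (rep_space M (\<sigma> i)) UNIV f"
  obtains y where "y \<in> rep_space M i" "\<And>x. x \<in> rep_space M (\<sigma> i) \<Longrightarrow> B i (\<sigma> i) y x = f x"
proof -
  have j: "\<sigma> i \<in> q_verts \<Gamma>" using i by simp
  obtain y where y: "y \<in> rep_space M (\<sigma> (\<sigma> i))"
    "\<And>x. x \<in> rep_space M (\<sigma> i) \<Longrightarrow> B (\<sigma> i) (\<sigma> (\<sigma> i)) x y = f x"
    using form_represents[OF j f] by blast
  have sub: "cvec.subspace (rep_space M i)" using is_rep_space(2)[OF M_rep i] .
  have yi: "y \<in> rep_space M i" using y(1) i by simp
  show ?thesis
  proof (rule that[of "\<epsilon> *\<^sub>C y"])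
    show "\<epsilon> *\<^sub>C y \<in> rep_space M i" using cvec.subspace_scale[OF sub yi] .
    fix x assume x: "x \<in> rep_space M (\<sigma> i)"
    have "B i (\<sigma> i) (\<epsilon> *\<^sub>C y) x = \<epsilon> * B i (\<sigma> i) y x"
      using linear_scale[OF form_left[OF i j x] yi] by (simp add: scaleC_complex_def)
    also have "\<dots> = \<epsilon> * (\<epsilon> * B (\<sigma> i) i x y)" using form_sym[OF i j yi x] by simp
    also have "\<dots> = f x" using y(2)[OF x] i eps by auto
    finally show "B i (\<sigma> i) (\<epsilon> *\<^sub>C y) x = f x" .
  qed
qed

text \<open>
  The adjointness of \<open>M\<^sub>e\<close> and \<open>M\<^sub>\<sigma>\<^sub>(\<^sub>e\<^sub>)\<close> in terms of two strings: their pairing changes its sign along an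
  arrow on which both continue, and it vanishes next to an arrow at which exactly one of them stops.
\<close>

lemma stringvec_pairing:
  assumes u: "stringvec \<Gamma> M c d u" and v: "stringvec \<Gamma> M c' d' v" and e: "e \<in> q_arrows \<Gamma>"
    and t: "arrow_tail \<Gamma> e \<in> {c..d}" and h: "\<sigma> (arrow_head \<Gamma> e) \<in> {c'..d'}"
  defines "pr \<equiv> \<lambda>i. B i (\<sigma> i) (u i) (v (\<sigma> i))"
  shows "(if arrow_head \<Gamma> e \<in> {c..d} then pr (arrow_head \<Gamma> e) else 0)
       = - (if \<sigma> (arrow_tail \<Gamma> e) \<in> {c'..d'} then pr (arrow_tail \<Gamma> e) else 0)"
proof -
  let ?t = "arrow_tail \<Gamma> e" and ?h = "arrow_head \<Gamma> e"
  note tv = arrow_in_verts[OF e]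
  note \<tau>e = \<tau>_arrows[OF e]
  have sub: "cvec.subspace (rep_space M i)" if "i \<in> q_verts \<Gamma>" for i using is_rep_space(2)[OF M_rep that] .
  have ut: "u ?t \<in> rep_space M ?t" using stringvecD(1)[OF u tv(1) t] .
  have vh: "v (\<sigma> ?h) \<in> rep_space M (\<sigma> ?h)" using stringvecD(1)[OF v \<sigma>_verts[OF tv(2)] h] .
  have l: "B ?h (\<sigma> ?h) 0 (v (\<sigma> ?h)) = 0"
    by (rule linear_zero[OF form_left[OF tv(2) \<sigma>_verts[OF tv(2)] vh] sub[OF tv(2)]])
  have r: "B ?t (\<sigma> ?t) (u ?t) 0 = 0"
    by (rule linear_zero[OF form_right[OF tv(1) \<sigma>_verts[OF tv(1)] ut] sub[OF \<sigma>_verts[OF tv(1)]]])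
  have mu: "rep_map M e (u ?t) = (if ?h \<in> {c..d} then u ?h else 0)" using stringvecD(2)[OF u e t] .
  have mv: "rep_map M (\<tau> e) (v (\<sigma> ?h)) = (if \<sigma> ?t \<in> {c'..d'} then v (\<sigma> ?t) else 0)"
    using stringvecD(2)[OF v \<tau>e] h unfolding \<tau>_ends[OF e] by blast
  have "(if ?h \<in> {c..d} then pr ?h else 0) = B ?h (\<sigma> ?h) (rep_map M e (u ?t)) (v (\<sigma> ?h))"
    unfolding mu pr_def by (cases "?h \<in> {c..d}") (simp_all only: l if_True if_False)
  also have "\<dots> = - B ?t (\<sigma> ?t) (u ?t) (rep_map M (\<tau> e) (v (\<sigma> ?h)))" by (rule form_adjoint[OF e ut vh])
  also have "\<dots> = - (if \<sigma> ?t \<in> {c'..d'} then pr ?t else 0)"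
    unfolding mv pr_def by (cases "\<sigma> ?t \<in> {c'..d'}") (simp_all only: r if_True if_False)
  finally show ?thesis .
qed

lemma stringvec_pairing_step:
  assumes u: "stringvec \<Gamma> M c d u" and v: "stringvec \<Gamma> M c' d' v"
    and i: "i \<in> q_verts \<Gamma>" "Suc i \<in> q_verts \<Gamma>" "i \<in> {c..d}" "Suc i \<in> {c..d}" "\<sigma> i \<in> {c'..d'}" "\<sigma> (Suc i) \<in> {c'..d'}"
  shows "B (Suc i) (\<sigma> (Suc i)) (u (Suc i)) (v (\<sigma> (Suc i))) = - B i (\<sigma> i) (u i) (v (\<sigma> i))"
proof -
  have e: "i \<in> q_arrows \<Gamma>" using i by (auto simp: q_arrows_def q_verts_def)
  show ?thesis
  proof (cases "rightward \<Gamma> i")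
    case True
    then have "arrow_tail \<Gamma> i = i" "arrow_head \<Gamma> i = Suc i" by (auto simp: arrow_tail_def arrow_head_def)
    then show ?thesis using stringvec_pairing[OF u v e] i by simp
  next
    case False
    then have "arrow_tail \<Gamma> i = Suc i" "arrow_head \<Gamma> i = i" by (auto simp: arrow_tail_def arrow_head_def)
    then have "B i (\<sigma> i) (u i) (v (\<sigma> i)) = - B (Suc i) (\<sigma> (Suc i)) (u (Suc i)) (v (\<sigma> (Suc i)))"
      using stringvec_pairing[OF u v e] i by simp
    then show ?thesis by simp
  qed
qed

lemma \<sigma>_antimono: "i \<le> j \<Longrightarrow> \<sigma> j \<le> \<sigma> i"
  by (simp add: vert_inv_def)

lemma stringvec_pairing_nonzero:
  assumes u: "stringvec \<Gamma> M c d u" and v: "stringvec \<Gamma> M c' d' v"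
    and i: "i \<in> q_verts \<Gamma>" "i \<in> {c..d}" "\<sigma> i \<in> {c'..d'}"
    and j: "j \<in> q_verts \<Gamma>" "j \<in> {c..d}" "\<sigma> j \<in> {c'..d'}"
    and nz: "B i (\<sigma> i) (u i) (v (\<sigma> i)) \<noteq> 0"
  shows "B j (\<sigma> j) (u j) (v (\<sigma> j)) \<noteq> 0"
proof -
  define pr where "pr i = B i (\<sigma> i) (u i) (v (\<sigma> i))" for i
  define D where "D = {i \<in> q_verts \<Gamma>. i \<in> {c..d} \<and> \<sigma> i \<in> {c'..d'}}"
  have conv: "k \<in> D" if "i \<le> k" "k \<le> j" "i \<in> D" "j \<in> D" for i j k
    using that \<sigma>_antimono[of i k] \<sigma>_antimono[of k j] by (auto simp: D_def q_verts_def)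
  have up: "(pr j = 0) = (pr i = 0)" if "i \<le> j" "i \<in> D" "j \<in> D" for i j
    using that
  proof (induction j rule: dec_induct)
    case (step k)
    have "k \<in> D" using conv[of i k "Suc k"] step by simp
    then show ?case
      using step stringvec_pairing_step[OF u v, of k] unfolding D_def pr_def by auto
  qed simp
  have "i \<in> D" "j \<in> D" using i j by (auto simp: D_def)
  then show ?thesis using up[of i j] up[of j i] nz unfolding pr_def by (cases "i \<le> j") auto
qed

text \<open>
  If the depths were in the other order, at the larger of the two left ends exactly one of the
  interval \<open>c, \<dots>, d\<close> and the mirror image of \<open>c', \<dots>, d'\<close> would continue, with an arrow oriented so
  that \<open>stringvec_pairing\<close> makes the pairing zero.
\<close>

lemma stringvec_pairing_depth:
  assumes u: "stringvec \<Gamma> M c d u" and v: "stringvec \<Gamma> M c' d' v"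
    and cd: "1 \<le> c" "d' \<le> num_verts \<Gamma>" "1 \<le> c'"
    and i: "i \<in> q_verts \<Gamma>" "i \<in> {c..d}" "\<sigma> i \<in> {c'..d'}"
    and nz: "B i (\<sigma> i) (u i) (v (\<sigma> i)) \<noteq> 0"
  shows "depth \<Gamma> c \<le> depth \<Gamma> (\<sigma> d')"
proof (rule ccontr)
  assume neg: "\<not> depth \<Gamma> c \<le> depth \<Gamma> (\<sigma> d')"
  note non0 = stringvec_pairing_nonzero[OF u v i _ _ _ nz]
  have d': "1 \<le> d'" using cd i by auto
  consider "c < \<sigma> d'" | "\<sigma> d' < c" using neg by (metis linorder_neqE_nat order_refl)
  then show False
  proof cases
    case 1
    then have R: "rightward \<Gamma> (\<sigma> d' - 1)" using neg depth_less_iff(1)[OF 1] by blast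
    define e where "e = \<sigma> d' - 1"
    have ends: "arrow_tail \<Gamma> e = \<sigma> d' - 1" "arrow_head \<Gamma> e = \<sigma> d'"
      using R 1 by (auto simp: e_def arrow_tail_def arrow_head_def)
    have e: "e \<in> q_arrows \<Gamma>" using 1 cd d' by (auto simp: e_def q_arrows_def vert_inv_def)
    have le: "\<sigma> d' \<le> i" using i by (auto simp: vert_inv_def q_verts_def)
    have "\<sigma> (\<sigma> d') = d'" using d' cd by (simp add: vert_inv_def)
    moreover have "\<sigma> (\<sigma> d' - 1) = Suc d'" using 1 cd d' by (auto simp: vert_inv_def)
    ultimately have t1: "\<sigma> d' - 1 \<in> {c..d}" and h1: "\<sigma> (\<sigma> d') \<in> {c'..d'}"
      and h2: "\<sigma> d' \<in> {c..d}" and t2: "\<sigma> (\<sigma> d' - 1) \<notin> {c'..d'}"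
      using 1 le i by auto
    have "B (\<sigma> d') (\<sigma> (\<sigma> d')) (u (\<sigma> d')) (v (\<sigma> (\<sigma> d'))) = 0"
      using stringvec_pairing[OF u v e, unfolded ends, OF t1 h1]
      unfolding if_P[OF h2] if_not_P[OF t2] by simp
    moreover have "B (\<sigma> d') (\<sigma> (\<sigma> d')) (u (\<sigma> d')) (v (\<sigma> (\<sigma> d'))) \<noteq> 0"
      by (rule non0) (use 1 le i cd d' \<open>\<sigma> (\<sigma> d') = d'\<close> in \<open>auto simp: q_verts_def\<close>)
    ultimately show False by blast
  next
    case 2
    then have R: "\<not> rightward \<Gamma> (c - 1)" using neg depth_less_iff(2)[OF 2] by blast
    define e where "e = c - 1"
    have ends: "arrow_tail \<Gamma> e = c" "arrow_head \<Gamma> e = c - 1"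
      using R 2 by (auto simp: e_def arrow_tail_def arrow_head_def)
    have ci: "c \<le> i" "i \<le> num_verts \<Gamma>" using i by (auto simp: q_verts_def)
    have e: "e \<in> q_arrows \<Gamma>" using 2 cd d' ci by (auto simp: e_def q_arrows_def vert_inv_def)
    have s1: "\<sigma> (c - 1) \<in> {c'..d'}" "\<sigma> c \<in> {c'..d'}"
      using 2 cd d' ci i by (auto simp: vert_inv_def)
    have h2: "c - 1 \<notin> {c..d}" and t1: "c \<in> {c..d}" using 2 ci i by auto
    have "B c (\<sigma> c) (u c) (v (\<sigma> c)) = 0"
      using stringvec_pairing[OF u v e, unfolded ends, OF t1 s1(1)]
      unfolding if_P[OF s1(2)] if_not_P[OF h2] by simp
    moreover have "B c (\<sigma> c) (u c) (v (\<sigma> c)) \<noteq> 0"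
      by (rule non0) (use s1 ci i cd in \<open>auto simp: q_verts_def\<close>)
    ultimately show False by blast
  qed
qed

text \<open>
  The inequality of depths says that the identity on the common vertices is a map from the interval
  \<open>c, \<dots>, d\<close> to its dual, the interval from \<open>\<sigma> d\<close> to \<open>\<sigma> c\<close>. The family \<open>z\<close> is the composite of this map with the dual of \<open>f\<close> and with the
  isomorphism between \<open>\<nabla>M\<close> and \<open>M\<close>. The sign \<open>(- 1) ^ i\<close> absorbs the minus sign in the maps of
  \<open>\<nabla>M\<close>.
\<close>

lemma dual_stringvec:
  assumes cd: "1 \<le> c" "c \<le> d" "d \<le> num_verts \<Gamma>" and f: "covec \<Gamma> M c d f"
    and le: "depth \<Gamma> c \<le> depth \<Gamma> (\<sigma> d)"
  obtains z where "stringvec \<Gamma> M c d z"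
    "\<And>i x. i \<in> {c..d} \<Longrightarrow> x \<in> rep_space M (\<sigma> i) \<Longrightarrow>
        B i (\<sigma> i) (z i) x = (- 1) ^ i * (if \<sigma> i \<in> {c..d} then f (\<sigma> i) x else 0)"
proof -
  let ?g = "\<lambda>i x. (- 1) ^ i * (if \<sigma> i \<in> {c..d} then f (\<sigma> i) x else 0)"
  have "\<forall>i\<in>q_verts \<Gamma>. \<exists>y. y \<in> rep_space M i \<and> (\<forall>x\<in>rep_space M (\<sigma> i). B i (\<sigma> i) y x = ?g i x)"
  proof
    fix i assume i: "i \<in> q_verts \<Gamma>"
    have "linear_between (rep_space M (\<sigma> i)) UNIV (?g i)"
      using covecD(1)[OF f \<sigma>_verts[OF i]]
      by (cases "\<sigma> i \<in> {c..d}") (auto simp: linear_between_def scaleC_complex_def algebra_simps)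
    then obtain y where "y \<in> rep_space M i" "\<And>x. x \<in> rep_space M (\<sigma> i) \<Longrightarrow> B i (\<sigma> i) y x = ?g i x"
      using form_represents_left[OF i] by blast
    then show "\<exists>y. y \<in> rep_space M i \<and> (\<forall>x\<in>rep_space M (\<sigma> i). B i (\<sigma> i) y x = ?g i x)" by blast
  qed
  from bchoice[OF this] obtain z where
    z: "\<forall>i\<in>q_verts \<Gamma>. z i \<in> rep_space M i \<and> (\<forall>x\<in>rep_space M (\<sigma> i). B i (\<sigma> i) (z i) x = ?g i x)" ..
  have zm: "z i \<in> rep_space M i" if "i \<in> q_verts \<Gamma>" for i using z that by blast
  have zB: "B i (\<sigma> i) (z i) x = ?g i x" if "i \<in> q_verts \<Gamma>" "x \<in> rep_space M (\<sigma> i)" for i x using z that by blast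
  have vc: "i \<in> q_verts \<Gamma>" if "i \<in> {c..d}" for i using that cd by (auto simp: q_verts_def)
  have "rep_map M e (z (arrow_tail \<Gamma> e)) = (if arrow_head \<Gamma> e \<in> {c..d} then z (arrow_head \<Gamma> e) else 0)"
    if e: "e \<in> q_arrows \<Gamma>" and tcd: "arrow_tail \<Gamma> e \<in> {c..d}" for e
  proof -
    let ?t = "arrow_tail \<Gamma> e" and ?h = "arrow_head \<Gamma> e"
    note tv = arrow_in_verts[OF e]
    have sub: "cvec.subspace (rep_space M i)" if "i \<in> q_verts \<Gamma>" for i using is_rep_space(2)[OF M_rep that] .
    have zh: "(if ?h \<in> {c..d} then z ?h else 0) \<in> rep_space M ?h"
      using zm[OF tv(2)] cvec.subspace_0[OF sub[OF tv(2)]] by simp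
    have mz: "rep_map M e (z ?t) \<in> rep_space M ?h"
      using arrow_mem[OF M_rep e zm[OF tv(1)]] .
    have sgn: "(- 1) ^ ?h = - ((- 1) ^ ?t :: complex)"
      by (auto simp: arrow_tail_def arrow_head_def)
    have en: "1 \<le> e" "e < num_verts \<Gamma>" using e by (auto simp: q_arrows_def)
    \<comment> \<open>A violation is an arrow that leaves one of the interval and its mirror image but not the other. There
      are at most two candidates, mirror images of each other, and the inequality of depths orients them
      so that they do not violate the claim.\<close>
    have comp: "(?h \<in> {c..d} \<longrightarrow> \<sigma> ?h \<in> {c..d} \<longrightarrow> \<sigma> ?t \<in> {c..d})
        \<and> (?h \<notin> {c..d} \<longrightarrow> \<not> (\<sigma> ?t \<in> {c..d} \<and> \<sigma> ?h \<in> {c..d}))"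
    proof (cases "\<sigma> d < c")
      case True
      then have R: "rightward \<Gamma> (c - 1)" using le depth_less_iff(2)[OF True] by simp
      have c1: "c - 1 \<in> q_arrows \<Gamma>" using True cd by (auto simp: q_arrows_def vert_inv_def)
      have R2: "rightward \<Gamma> (num_verts \<Gamma> - (c - 1))" using rightward_\<tau>[OF c1] R by simp
      have ne: "\<not> (\<not> rightward \<Gamma> e \<and> (e = c - 1 \<or> e = num_verts \<Gamma> - (c - 1)))" using R R2 by auto
      show ?thesis using ne True tcd cd en
        by (auto simp: arrow_tail_def arrow_head_def vert_inv_def split: if_splits)
    next
      case False
      show ?thesis
      proof (cases "c = \<sigma> d")
        case True
        then show ?thesis using tcd cd en
          by (auto simp: arrow_tail_def arrow_head_def vert_inv_def split: if_splits)
      next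
        case neq: False
        then have lt: "c < \<sigma> d" using False by simp
        then have R: "\<not> rightward \<Gamma> (\<sigma> d - 1)" using le depth_less_iff(1)[OF lt] by simp
        have c1: "\<sigma> d - 1 \<in> q_arrows \<Gamma>" using lt cd by (auto simp: q_arrows_def vert_inv_def)
        have R2: "\<not> rightward \<Gamma> (num_verts \<Gamma> - (\<sigma> d - 1))" using rightward_\<tau>[OF c1] R by simp
        have ne: "\<not> (rightward \<Gamma> e \<and> (e = \<sigma> d - 1 \<or> e = num_verts \<Gamma> - (\<sigma> d - 1)))" using R R2 by auto
        show ?thesis using ne lt tcd cd en
          by (auto simp: arrow_tail_def arrow_head_def vert_inv_def split: if_splits)
      qed
    qed
    have "rep_map M e (z ?t) - (if ?h \<in> {c..d} then z ?h else 0) = 0"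
    proof (rule form_nondeg[OF tv(2)])
      show "rep_map M e (z ?t) - (if ?h \<in> {c..d} then z ?h else 0) \<in> rep_space M ?h"
        using cvec.subspace_diff[OF sub[OF tv(2)] mz zh] .
      fix x assume x: "x \<in> rep_space M (\<sigma> ?h)"
      have \<tau>x: "rep_map M (\<tau> e) x \<in> rep_space M (\<sigma> ?t)"
        using arrow_mem[OF M_rep \<tau>_arrows[OF e], of x] x e by simp
      have 0: "B ?h (\<sigma> ?h) 0 x = 0"
        by (rule linear_zero[OF form_left[OF tv(2) \<sigma>_verts[OF tv(2)] x] sub[OF tv(2)]])
      have "B ?h (\<sigma> ?h) (rep_map M e (z ?t)) x = - B ?t (\<sigma> ?t) (z ?t) (rep_map M (\<tau> e) x)"
        using form_adjoint[OF e zm[OF tv(1)] x] .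
      also have "\<dots> = (- 1) ^ ?h * (if \<sigma> ?t \<in> {c..d} then f (\<sigma> ?t) (rep_map M (\<tau> e) x) else 0)"
        using zB[OF tv(1) \<tau>x] sgn by simp
      also have "(if \<sigma> ?t \<in> {c..d} then f (\<sigma> ?t) (rep_map M (\<tau> e) x) else 0)
          = (if \<sigma> ?t \<in> {c..d} then if \<sigma> ?h \<in> {c..d} then f (\<sigma> ?h) x else 0 else 0)"
        using covecD(2)[OF f \<tau>_arrows[OF e], of x] x e by simp
      also have "(- 1) ^ ?h * \<dots> = B ?h (\<sigma> ?h) (if ?h \<in> {c..d} then z ?h else 0) x"
        using zB[OF tv(2) x] 0 comp by auto
      finally have "B ?h (\<sigma> ?h) (rep_map M e (z ?t)) x = B ?h (\<sigma> ?h) (if ?h \<in> {c..d} then z ?h else 0) x" .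
      then show "B ?h (\<sigma> ?h) (rep_map M e (z ?t) - (if ?h \<in> {c..d} then z ?h else 0)) x = 0"
        using linear_diff[OF form_left[OF tv(2) \<sigma>_verts[OF tv(2)] x] sub[OF tv(2)] mz zh] by simp
    qed
    then show ?thesis by simp
  qed
  then have "stringvec \<Gamma> M c d z" unfolding stringvec_def using zm by blast
  then show ?thesis using that zB vc by blast
qed

end

section \<open>Interval representations\<close>

text \<open>
  An interval representation with support \<open>a, \<dots>, z\<close> and chosen basis vectors \<open>l i\<close>.
\<close>

locale thin_rep =
  fixes \<Gamma> :: quiver and L :: "'u::complex_vector rep" and a z :: nat and l :: "nat \<Rightarrow> 'u"
  assumes L_rep: "is_rep \<Gamma> L" and az: "1 \<le> a" "a \<le> z" "z \<le> num_verts \<Gamma>"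
    and l_nz: "i \<in> {a..z} \<Longrightarrow> l i \<noteq> 0"
    and space: "i \<in> q_verts \<Gamma> \<Longrightarrow> rep_space L i = (if i \<in> {a..z} then range (\<lambda>t. t *\<^sub>C l i) else {0})"
    and l_out: "i \<notin> {a..z} \<Longrightarrow> l i = 0"
    and l_arrow: "e \<in> q_arrows \<Gamma> \<Longrightarrow> arrow_tail \<Gamma> e \<in> {a..z} \<Longrightarrow>
        rep_map L e (l (arrow_tail \<Gamma> e)) = l (arrow_head \<Gamma> e)"
begin

lemma az_vert: "i \<in> {a..z} \<Longrightarrow> i \<in> q_verts \<Gamma>"
  using az by (auto simp: q_verts_def)

lemma l_mem: "i \<in> q_verts \<Gamma> \<Longrightarrow> l i \<in> rep_space L i"
  using space[of i] l_out[of i] rangeI[of "\<lambda>t. t *\<^sub>C l i" 1] by simp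

lemma L_sub: "i \<in> q_verts \<Gamma> \<Longrightarrow> cvec.subspace (rep_space L i)"
  by (rule is_rep_space(2)[OF L_rep])

lemma spaceE:
  assumes "i \<in> q_verts \<Gamma>" "y \<in> rep_space L i"
  obtains t where "y = t *\<^sub>C l i"
proof (cases "i \<in> {a..z}")
  case True
  then show ?thesis using space[OF assms(1)] assms(2) that by auto
next
  case False
  have "y = 0 *\<^sub>C l i" using assms(2) unfolding space[OF assms(1)] if_not_P[OF False] by simp
  then show ?thesis by (rule that)
qed

lemma hom_stringvec:
  assumes u: "is_hom \<Gamma> L N u"
  shows "stringvec \<Gamma> N a z (\<lambda>i. u i (l i))"
  unfolding stringvec_def
proof (intro conjI ballI impI)
  fix i assume "i \<in> q_verts \<Gamma>"
  then show "u i (l i) \<in> rep_space N i" using linear_mem[OF is_hom_lin[OF u]] l_mem by blast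
next
  fix e assume e: "e \<in> q_arrows \<Gamma>" and t: "arrow_tail \<Gamma> e \<in> {a..z}"
  note tv = arrow_in_verts[OF e]
  have "rep_map N e (u (arrow_tail \<Gamma> e) (l (arrow_tail \<Gamma> e))) = u (arrow_head \<Gamma> e) (l (arrow_head \<Gamma> e))"
    using is_hom_arrow[OF u e l_mem[OF tv(1)]] l_arrow[OF e t] by simp
  also have "\<dots> = (if arrow_head \<Gamma> e \<in> {a..z} then u (arrow_head \<Gamma> e) (l (arrow_head \<Gamma> e)) else 0)"
    using l_out[of "arrow_head \<Gamma> e"] hom_zero[OF u tv(2) L_sub[OF tv(2)]] by auto
  finally show "rep_map N e (u (arrow_tail \<Gamma> e) (l (arrow_tail \<Gamma> e)))
     = (if arrow_head \<Gamma> e \<in> {a..z} then u (arrow_head \<Gamma> e) (l (arrow_head \<Gamma> e)) else 0)" .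
qed

definition lam :: "nat \<Rightarrow> 'u \<Rightarrow> complex" where
  "lam i y = (if i \<in> {a..z} then THE t. y = t *\<^sub>C l i else 0)"

lemma lam_l: "i \<in> {a..z} \<Longrightarrow> lam i (t *\<^sub>C l i) = t"
  using l_nz[of i] unfolding lam_def by auto

lemma lam_covec: "covec \<Gamma> L a z lam"
  unfolding covec_def
proof (intro conjI ballI impI)
  fix i assume i: "i \<in> q_verts \<Gamma>"
  show "linear_between (rep_space L i) UNIV (lam i)"
  proof (cases "i \<in> {a..z}")
    case True
    have add: "lam i (x + y) = lam i x + lam i y" if x: "x \<in> rep_space L i" and y: "y \<in> rep_space L i" for x y
    proof -
      obtain s where "x = s *\<^sub>C l i" by (rule spaceE[OF i x])
      moreover obtain t where "y = t *\<^sub>C l i" by (rule spaceE[OF i y])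
      ultimately show ?thesis using lam_l[OF True] by (simp flip: scaleC_add_left)
    qed
    have scale: "lam i (r *\<^sub>C x) = r * lam i x" if x: "x \<in> rep_space L i" for r x
    proof -
      obtain s where s: "x = s *\<^sub>C l i" by (rule spaceE[OF i x])
      then have "r *\<^sub>C x = (r * s) *\<^sub>C l i" by simp
      then show ?thesis using lam_l[OF True] s by simp
    qed
    show ?thesis using add scale by (simp add: linear_between_def scaleC_complex_def)
  next
    case False
    then have "lam i = (\<lambda>x. 0)" by (auto simp: lam_def)
    then show ?thesis by (simp add: linear_between_def)
  qed
next
  fix e x assume e: "e \<in> q_arrows \<Gamma>" and x: "x \<in> rep_space L (arrow_tail \<Gamma> e)"
    and h: "arrow_head \<Gamma> e \<in> {a..z}"
  note tv = arrow_in_verts[OF e]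
  show "lam (arrow_head \<Gamma> e) (rep_map L e x) = (if arrow_tail \<Gamma> e \<in> {a..z} then lam (arrow_tail \<Gamma> e) x else 0)"
  proof (cases "arrow_tail \<Gamma> e \<in> {a..z}")
    case True
    obtain t where t: "x = t *\<^sub>C l (arrow_tail \<Gamma> e)" by (rule spaceE[OF tv(1) x])
    have "rep_map L e x = t *\<^sub>C l (arrow_head \<Gamma> e)"
      using arrow_scale[OF L_rep e l_mem[OF tv(1)], of t] l_arrow[OF e True] t by simp
    then show ?thesis using t lam_l[OF True] lam_l[OF h] True by simp
  next
    case False
    have "x = 0" using x unfolding space[OF tv(1)] if_not_P[OF False] by simp
    then have "rep_map L e x = 0 *\<^sub>C l (arrow_head \<Gamma> e)"
      using arrow_zero[OF L_rep e L_sub[OF tv(1)]] by simp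
    then show ?thesis unfolding if_not_P[OF False] using lam_l[OF h, of 0] by simp
  qed
qed

lemma hom_from_stringvec:
  assumes "stringvec \<Gamma> N a z x" "is_rep \<Gamma> N"
  shows "is_hom \<Gamma> L N (through_string a z lam x)"
    and "i \<in> {a..z} \<Longrightarrow> through_string a z lam x i (l i) = x i"
  using through_string_is_hom[OF lam_covec assms(1) L_rep assms(2)] lam_l[of i 1]
  by (simp_all add: through_string_def)

end

section \<open>Automorphisms\<close>

lemma is_iso_comp:
  assumes "is_iso \<Gamma> L M f" "is_iso \<Gamma> M N g"
  shows "is_iso \<Gamma> L N (\<lambda>i x. g i (f i x))"
  using is_hom_comp[of \<Gamma> L M f N g] assms bij_betw_trans unfolding is_iso_def comp_def by blast

lemma is_iso_id: "is_iso \<Gamma> M M (\<lambda>i x. x)"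
  using is_hom_id by (auto simp: is_iso_def bij_betw_def)

lemma automorphism_one_plus_square_zero:
  assumes M: "is_rep \<Gamma> M" and N: "is_hom \<Gamma> M M N"
    and sq: "\<And>i x. i \<in> q_verts \<Gamma> \<Longrightarrow> x \<in> rep_space M i \<Longrightarrow> N i (N i x) = 0"
  shows "is_automorphism \<Gamma> M (\<lambda>i x. x + t *\<^sub>C N i x)"
proof -
  have hom: "is_hom \<Gamma> M M (\<lambda>i x. x + s *\<^sub>C N i x)" for s by (rule is_hom_lincomb[OF is_hom_id N M])
  have inv: "(x + s *\<^sub>C N i x) + (- s) *\<^sub>C N i (x + s *\<^sub>C N i x) = x"
    if i: "i \<in> q_verts \<Gamma>" and x: "x \<in> rep_space M i" for i x s
  proof -
    note lin = is_hom_lin[OF N i] and S = is_rep_space(2)[OF M i]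
    have Nx: "N i x \<in> rep_space M i" using linear_mem[OF lin x] .
    have "N i (x + s *\<^sub>C N i x) = N i x"
      using linear_add[OF lin x cvec.subspace_scale[OF S Nx]] linear_scale[OF lin Nx] sq[OF i x]
      by simp
    then show ?thesis by simp
  qed
  have "bij_betw (\<lambda>x. x + t *\<^sub>C N i x) (rep_space M i) (rep_space M i)" if i: "i \<in> q_verts \<Gamma>" for i
  proof (rule bij_betw_byWitness[where f' = "\<lambda>x. x + (- t) *\<^sub>C N i x"])
    show "\<forall>x\<in>rep_space M i. (x + t *\<^sub>C N i x) + (- t) *\<^sub>C N i (x + t *\<^sub>C N i x) = x"
      using inv[OF i] by blast
    show "\<forall>x\<in>rep_space M i. (x + (- t) *\<^sub>C N i x) + t *\<^sub>C N i (x + (- t) *\<^sub>C N i x) = x"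
      using inv[OF i, of _ "- t"] by simp
    show "(\<lambda>x. x + t *\<^sub>C N i x) ` rep_space M i \<subseteq> rep_space M i"
      using hom_mem[OF hom i] by blast
    show "(\<lambda>x. x + (- t) *\<^sub>C N i x) ` rep_space M i \<subseteq> rep_space M i"
      using hom_mem[OF hom i] by blast
  qed
  then show ?thesis using hom by (simp add: is_iso_def)
qed

context string_rep
begin

definition proj :: "nat \<Rightarrow> nat \<Rightarrow> 'v \<Rightarrow> 'v" where
  "proj k = through_string (c k) (d k) (cf k) (b k)"

lemma proj_hom: "k \<in> I \<Longrightarrow> is_hom \<Gamma> M M (proj k)"
  unfolding proj_def by (rule through_string_is_hom[OF cf_covec b_stringvec rep rep])

lemma proj_eq: "proj k i x = cf k i x *\<^sub>C b k i"
  using cf_outside[of i k x] by (auto simp: proj_def through_string_def)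

lemma cf_scale: "i \<in> q_verts \<Gamma> \<Longrightarrow> x \<in> rep_space M i \<Longrightarrow> cf k i (t *\<^sub>C x) = t * cf k i x"
  using linear_scale[OF cf_linear] by (simp add: scaleC_complex_def)

lemma cf_add: "i \<in> q_verts \<Gamma> \<Longrightarrow> x \<in> rep_space M i \<Longrightarrow> y \<in> rep_space M i
    \<Longrightarrow> cf k i (x + y) = cf k i x + cf k i y"
  by (rule linear_add[OF cf_linear])

lemma cf_zero: "i \<in> q_verts \<Gamma> \<Longrightarrow> cf k i 0 = 0"
  by (rule linear_zero[OF cf_linear sub])

lemma cf_b_other:
  assumes "i \<in> q_verts \<Gamma>" "k \<in> I" "l \<noteq> k"
  shows "cf l i (b k i) = 0"
proof (cases "k \<in> through I c d i")
  case True
  then show ?thesis using cf_b[OF assms(1) True, of l] assms(3) by simp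
next
  case False
  then have "b k i = 0" using b_outside[OF assms(2), of i] assms(2) by (auto simp: through_def)
  then show ?thesis using cf_zero[OF assms(1)] by simp
qed

lemma shear_automorphism:
  assumes m: "m \<in> q_verts \<Gamma>" and k: "k \<in> through I c d m" and l: "l \<in> through I c d m" and kl: "k \<noteq> l"
    and phi: "is_hom \<Gamma> M M \<phi>" "cf l m (\<phi> m (b k m)) \<noteq> 0"
  obtains g where "is_automorphism \<Gamma> M g"
    "\<And>x j. x \<in> rep_space M m \<Longrightarrow> cf j m (g m x) = cf j m x + (if j = l then t * cf k m x else 0)"
proof -
  define N where "N i x = proj l i (\<phi> i (proj k i x))" for i x
  have kI: "k \<in> I" and lI: "l \<in> I" using k l by (auto simp: through_def)
  have N: "is_hom \<Gamma> M M N"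
    unfolding N_def
    using is_hom_comp[OF is_hom_comp[OF proj_hom[OF kI] phi(1)] proj_hom[OF lI]] .
  have \<phi>0: "\<phi> i 0 = 0" if "i \<in> q_verts \<Gamma>" for i
    using hom_zero[OF phi(1) that sub[OF that]] .
  have sq: "N i (N i x) = 0" if i: "i \<in> q_verts \<Gamma>" and x: "x \<in> rep_space M i" for i x
  proof -
    have "proj k i (N i x) = 0"
      unfolding N_def proj_eq using cf_scale[OF i b_mem[OF lI i]] cf_b_other[OF i lI kl] by simp
    then have "N i (N i x) = proj l i 0" unfolding N_def[of i "N i x"] using \<phi>0[OF i] by simp
    then show ?thesis unfolding proj_eq using cf_zero[OF i] by simp
  qed
  define \<alpha> where "\<alpha> = cf l m (\<phi> m (b k m))"
  have Nm: "N m x = (cf k m x * \<alpha>) *\<^sub>C b l m" if x: "x \<in> rep_space M m" for x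
  proof -
    have bk: "b k m \<in> rep_space M m" by (rule b_mem[OF kI m])
    have "\<phi> m (proj k m x) = cf k m x *\<^sub>C \<phi> m (b k m)"
      unfolding proj_eq by (rule hom_scale[OF phi(1) m bk])
    then show ?thesis
      unfolding N_def proj_eq[of l] \<alpha>_def
      using cf_scale[OF m hom_mem[OF phi(1) m bk]] by simp
  qed
  show ?thesis
  proof (rule that)
    show "is_automorphism \<Gamma> M (\<lambda>i x. x + (t / \<alpha>) *\<^sub>C N i x)"
      by (rule automorphism_one_plus_square_zero[OF rep N sq])
    fix x j assume x: "x \<in> rep_space M m"
    have "cf j m (x + (t / \<alpha>) *\<^sub>C N m x) = cf j m x + (t / \<alpha>) * cf j m (N m x)"
      using cf_add[OF m x] cf_scale[OF m] hom_mem[OF N m x] cvec.subspace_scale[OF sub[OF m]]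
      by simp
    also have "cf j m (N m x) = cf k m x * \<alpha> * (if j = l then 1 else 0)"
      unfolding Nm[OF x] using cf_scale[OF m b_mem[OF lI m]] cf_b[OF m l] by simp
    finally show "cf j m (x + (t / \<alpha>) *\<^sub>C N m x) = cf j m x + (if j = l then t * cf k m x else 0)"
      using phi(2) by (simp add: \<alpha>_def)
  qed
qed

lemma is_hom_sum:
  assumes "\<And>k. k \<in> J \<Longrightarrow> is_hom \<Gamma> M M (f k)"
  shows "is_hom \<Gamma> M M (\<lambda>i x. \<Sum>k\<in>J. \<gamma> k *\<^sub>C f k i x)"
  using assms
proof (induction J rule: infinite_finite_induct)
  case (insert k J)
  then have "is_hom \<Gamma> M M (\<lambda>i x. (\<Sum>k\<in>J. \<gamma> k *\<^sub>C f k i x) + \<gamma> k *\<^sub>C f k i x)"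
    by (intro is_hom_lincomb[OF _ _ rep]) auto
  then show ?case using insert by (simp add: add.commute)
next
  case (infinite J)
  have "is_hom \<Gamma> M M (\<lambda>i x. x + (- 1) *\<^sub>C x)" by (rule is_hom_lincomb[OF is_hom_id is_hom_id rep])
  then show ?case using infinite by simp
next
  case empty
  have "is_hom \<Gamma> M M (\<lambda>i x. x + (- 1) *\<^sub>C x)" by (rule is_hom_lincomb[OF is_hom_id is_hom_id rep])
  then show ?case by simp
qed

lemma torus_automorphism:
  assumes nz: "\<And>k. k \<in> I \<Longrightarrow> \<gamma> k \<noteq> 0"
  obtains g where "is_automorphism \<Gamma> M g"
    "\<And>i x k. i \<in> q_verts \<Gamma> \<Longrightarrow> x \<in> rep_space M i \<Longrightarrow> k \<in> I \<Longrightarrow> cf k i (g i x) = \<gamma> k * cf k i x"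
proof -
  define D where "D \<gamma> i x = (\<Sum>k\<in>I. \<gamma> k *\<^sub>C proj k i x)" for \<gamma> i x
  have hom: "is_hom \<Gamma> M M (D \<gamma>)" for \<gamma>
    unfolding D_def by (rule is_hom_sum[OF proj_hom])
  have D_eq: "D \<gamma> i x = (\<Sum>k\<in>through I c d i. (\<gamma> k * cf k i x) *\<^sub>C b k i)" for \<gamma> i x
  proof -
    have "D \<gamma> i x = (\<Sum>k\<in>I. (\<gamma> k * cf k i x) *\<^sub>C b k i)" by (simp add: D_def proj_eq)
    also have "\<dots> = (\<Sum>k\<in>through I c d i. (\<gamma> k * cf k i x) *\<^sub>C b k i)"
      by (rule sum.mono_neutral_right) (use finite_I cf_outside in \<open>auto simp: through_def\<close>)
    finally show ?thesis .
  qed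
  have cfD: "cf k i (D \<gamma> i x) = \<gamma> k * cf k i x"
    if i: "i \<in> q_verts \<Gamma>" and x: "x \<in> rep_space M i" and k: "k \<in> I" for \<gamma> i x k
  proof (cases "k \<in> through I c d i")
    case True
    show ?thesis
      using coord_eqI[OF basis_at[OF i] D_eq[of \<gamma> i x] hom_mem[OF hom i x] True]
      by (simp add: cf_def)
  next
    case False
    then show ?thesis using k cf_outside[of i k] by (auto simp: through_def)
  qed
  have inv: "D \<gamma>' i (D \<gamma> i x) = x"
    if i: "i \<in> q_verts \<Gamma>" and x: "x \<in> rep_space M i" and g: "\<And>k. k \<in> I \<Longrightarrow> \<gamma>' k * \<gamma> k = 1" for \<gamma> \<gamma>' i x
  proof -
    have "D \<gamma>' i (D \<gamma> i x) = (\<Sum>k\<in>through I c d i. (\<gamma>' k * (\<gamma> k * cf k i x)) *\<^sub>C b k i)"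
      unfolding D_eq[of \<gamma>'] using cfD[OF i x] by (intro sum.cong) (auto simp: through_def)
    also have "\<dots> = (\<Sum>k\<in>through I c d i. cf k i x *\<^sub>C b k i)"
      using g by (intro sum.cong) (auto simp: through_def simp flip: mult.assoc)
    finally show ?thesis using expand[OF i x] by simp
  qed
  show ?thesis
  proof (rule that)
    show "is_automorphism \<Gamma> M (D \<gamma>)"
      unfolding is_iso_def
    proof (intro conjI ballI hom)
      fix i assume i: "i \<in> q_verts \<Gamma>"
      show "bij_betw (D \<gamma> i) (rep_space M i) (rep_space M i)"
      proof (rule bij_betw_byWitness[where f' = "D (\<lambda>k. inverse (\<gamma> k)) i"])
        show "\<forall>x\<in>rep_space M i. D (\<lambda>k. inverse (\<gamma> k)) i (D \<gamma> i x) = x"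
          using inv[OF i] nz by simp
        show "\<forall>x\<in>rep_space M i. D \<gamma> i (D (\<lambda>k. inverse (\<gamma> k)) i x) = x"
          using inv[OF i] nz by simp
        show "D \<gamma> i ` rep_space M i \<subseteq> rep_space M i"
          and "D (\<lambda>k. inverse (\<gamma> k)) i ` rep_space M i \<subseteq> rep_space M i"
          using hom_mem[OF hom i] by blast+
      qed
    qed
    show "cf k i (D \<gamma> i x) = \<gamma> k * cf k i x" if "i \<in> q_verts \<Gamma>" "x \<in> rep_space M i" "k \<in> I" for i x k
      by (rule cfD[OF that])
  qed
qed

end

section \<open>The form at the middle vertex\<close>

context eps_rep
begin

text \<open>
  For even \<open>n\<close> the two middle vertices are joined by an arrow that the symmetry fixes. Taking \<open>mid\<close> as
  the tail of this arrow, and \<open>tr\<close> below as its map, turns the pairing of the two middle spaces into a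
  form \<open>bt\<close> on one of them, as for odd \<open>n\<close>.
\<close>

definition mid :: nat where
  "mid = (if odd (num_verts \<Gamma>) then (num_verts \<Gamma> + 1) div 2 else arrow_tail \<Gamma> (num_verts \<Gamma> div 2))"

definition tr :: "'v \<Rightarrow> 'v" where
  "tr x = (if odd (num_verts \<Gamma>) then x else rep_map M (num_verts \<Gamma> div 2) x)"

definition bt :: "'v \<Rightarrow> 'v \<Rightarrow> complex" where
  "bt x y = B mid (\<sigma> mid) x (tr y)"

lemma mid_odd: "odd (num_verts \<Gamma>) \<Longrightarrow> \<sigma> mid = mid"
  by (auto simp: mid_def vert_inv_def elim!: oddE)

lemma mid_even:
  assumes "even (num_verts \<Gamma>)"
  shows "num_verts \<Gamma> div 2 \<in> q_arrows \<Gamma>" "arrow_tail \<Gamma> (num_verts \<Gamma> div 2) = mid"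
    "arrow_head \<Gamma> (num_verts \<Gamma> div 2) = \<sigma> mid" "\<tau> (num_verts \<Gamma> div 2) = num_verts \<Gamma> div 2"
  using assms n2
  by (auto simp: mid_def vert_inv_def q_arrows_def arrow_inv_def arrow_tail_def arrow_head_def elim!: evenE)

lemma mid_cases:
  obtains h where "num_verts \<Gamma> = 2 * h + 1" "mid = h + 1"
  | h where "num_verts \<Gamma> = 2 * h" "mid = h \<or> mid = h + 1"
proof (cases "odd (num_verts \<Gamma>)")
  case True
  then obtain h where "num_verts \<Gamma> = 2 * h + 1" by (rule oddE)
  then show ?thesis using that(1)[of h] by (simp add: mid_def)
next
  case False
  then obtain h where "num_verts \<Gamma> = 2 * h" by auto
  then show ?thesis using that(2)[of h] by (simp add: mid_def arrow_tail_def)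
qed

lemma mid_vert: "mid \<in> q_verts \<Gamma>" "\<sigma> mid \<in> q_verts \<Gamma>"
proof -
  show "mid \<in> q_verts \<Gamma>" using n2 by (cases rule: mid_cases) (auto simp: q_verts_def)
  then show "\<sigma> mid \<in> q_verts \<Gamma>" by simp
qed

lemma mid_between:
  assumes "i \<in> q_verts \<Gamma>" "i \<in> {p..q}" "\<sigma> i \<in> {p..q}"
  shows "mid \<in> {p..q} \<and> \<sigma> mid \<in> {p..q}"
  using assms by (cases rule: mid_cases) (auto simp: vert_inv_def q_verts_def)

lemma tr_linear: "linear_between (rep_space M mid) (rep_space M (\<sigma> mid)) tr"
proof (cases "odd (num_verts \<Gamma>)")
  case True
  then show ?thesis using mid_odd by (auto simp: tr_def linear_between_def)
next
  case False
  then have "tr = rep_map M (num_verts \<Gamma> div 2)" by (auto simp: tr_def)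
  then show ?thesis using is_rep_map[OF M_rep mid_even(1)] mid_even(2,3) False by simp
qed

lemma tr_stringvec:
  assumes u: "stringvec \<Gamma> M p q u" and m: "mid \<in> {p..q}"
  shows "tr (u mid) = (if \<sigma> mid \<in> {p..q} then u (\<sigma> mid) else 0)"
proof (cases "odd (num_verts \<Gamma>)")
  case True
  then show ?thesis using mid_odd m by (auto simp: tr_def)
next
  case False
  then show ?thesis using stringvecD(2)[OF u mid_even(1)] mid_even m by (simp add: tr_def)
qed

lemma bt_left: "y \<in> rep_space M mid \<Longrightarrow> linear_between (rep_space M mid) UNIV (\<lambda>x. bt x y)"
  unfolding bt_def by (rule form_left[OF mid_vert linear_mem[OF tr_linear]])

lemma bt_right: "x \<in> rep_space M mid \<Longrightarrow> linear_between (rep_space M mid) UNIV (\<lambda>y. bt x y)"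
  unfolding bt_def by (rule linear_comp[OF tr_linear form_right[OF mid_vert]])

text \<open>
  For even \<open>n\<close> the sign \<open>\<epsilon> = - 1\<close> cancels the sign from the adjointness of the middle arrow. This
  symmetry is what distinguishes the non-split case; in the split case the form is alternating.
\<close>

lemma bt_sym:
  assumes ns: "non_split_type \<Gamma> \<epsilon>" and x: "x \<in> rep_space M mid" and y: "y \<in> rep_space M mid"
  shows "bt x y = bt y x"
proof (cases "odd (num_verts \<Gamma>)")
  case True
  then have "\<epsilon> = 1" using ns by (simp add: non_split_type_def)
  then show ?thesis using form_sym[OF mid_vert(1) mid_vert(1) x y] True mid_odd by (simp add: bt_def tr_def)
next
  case False
  then have ev: "even (num_verts \<Gamma>)" and e1: "\<epsilon> = - 1" using ns by (auto simp: non_split_type_def)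
  note E = mid_even[OF ev]
  have trx: "tr x \<in> rep_space M (\<sigma> mid)" using linear_mem[OF tr_linear x] .
  have "B (\<sigma> mid) mid (tr x) y = - B mid (\<sigma> mid) x (tr y)"
    using form_adjoint[OF E(1), of x y] E x y mid_vert(1) ev by (simp add: tr_def)
  moreover have "B (\<sigma> mid) mid (tr x) y = - B mid (\<sigma> mid) y (tr x)"
    using form_sym[OF mid_vert(2,1) trx y] e1 by simp
  ultimately show ?thesis by (simp add: bt_def)
qed

text \<open>
  By \<open>stringvec_pairing_nonzero\<close> the vanishing of the pairing at the middle propagates to all
  vertices that lie in the support of \<open>L\<close> together with their mirror images.
\<close>

lemma isotropic_embeddingI:
  assumes "thin_rep \<Gamma> L a z l" and f: "is_mono \<Gamma> L M f"
    and q: "mid \<in> {a..z} \<Longrightarrow> \<sigma> mid \<in> {a..z} \<Longrightarrow> bt (f mid (l mid)) (f mid (l mid)) = 0"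
  shows "isotropic_embedding \<Gamma> B L M f"
proof -
  interpret thin_rep \<Gamma> L a z l by fact
  have hom: "is_hom \<Gamma> L M f" using f by (simp add: is_mono_def)
  note sv = hom_stringvec[OF hom]
  have fl: "f i (l i) \<in> rep_space M i" if "i \<in> q_verts \<Gamma>" for i
    using hom_mem[OF hom that l_mem[OF that]] .
  have z0: "B i (\<sigma> i) (f i (l i)) (f (\<sigma> i) (l (\<sigma> i))) = 0" if i: "i \<in> q_verts \<Gamma>" for i
  proof (cases "i \<in> {a..z} \<and> \<sigma> i \<in> {a..z}")
    case True
    then have m: "mid \<in> {a..z}" "\<sigma> mid \<in> {a..z}" using mid_between[OF i] by blast+
    have "B mid (\<sigma> mid) (f mid (l mid)) (f (\<sigma> mid) (l (\<sigma> mid))) = 0"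
      using q[OF m] tr_stringvec[OF sv m(1)] m by (simp add: bt_def)
    then show ?thesis using stringvec_pairing_nonzero[OF sv sv i _ _ mid_vert(1) m] True by blast
  next
    case False
    have "f j (l j) = 0" if "j \<in> q_verts \<Gamma>" "j \<notin> {a..z}" for j
      using l_out[OF that(2)] hom_zero[OF hom that(1) L_sub[OF that(1)]] by simp
    then have "f i (l i) = 0 \<or> f (\<sigma> i) (l (\<sigma> i)) = 0" using False i by auto
    then show ?thesis
      using linear_zero[OF form_left[OF i \<sigma>_verts[OF i] fl[OF \<sigma>_verts[OF i]]] is_rep_space(2)[OF M_rep i]]
        linear_zero[OF form_right[OF i \<sigma>_verts[OF i] fl[OF i]] is_rep_space(2)[OF M_rep \<sigma>_verts[OF i]]]
      by auto
  qed
  have "B i j (f i x) (f j y) = 0"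
    if i: "i \<in> q_verts \<Gamma>" and j: "j \<in> q_verts \<Gamma>" and x: "x \<in> rep_space L i" and y: "y \<in> rep_space L j" for i j x y
  proof (cases "j = \<sigma> i")
    case False
    then show ?thesis
      using form_orth[OF i j] hom_mem[OF hom i x] hom_mem[OF hom j y]
      by blast
  next
    case True
    obtain s where s: "x = s *\<^sub>C l i" by (rule spaceE[OF i x])
    obtain t where t: "y = t *\<^sub>C l j" by (rule spaceE[OF j y])
    have fx: "f i x = s *\<^sub>C f i (l i)" and fy: "f j y = t *\<^sub>C f j (l j)"
      using hom_scale[OF hom i l_mem[OF i]]
        hom_scale[OF hom j l_mem[OF j]] s t by auto
    have fym: "f j y \<in> rep_space M j" using hom_mem[OF hom j y] .
    have "B i j (f i x) (f j y) = s * B i j (f i (l i)) (f j y)"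
      unfolding fx using linear_scale[OF form_left[OF i j fym] fl[OF i]] by (simp add: scaleC_complex_def)
    also have "B i j (f i (l i)) (f j y) = t * B i j (f i (l i)) (f j (l j))"
      unfolding fy using linear_scale[OF form_right[OF i j fl[OF i]] fl[OF j]] by (simp add: scaleC_complex_def)
    finally show ?thesis using z0[OF i] True by simp
  qed
  then show ?thesis using f by (simp add: isotropic_embedding_def)
qed

end

locale eps_strings = eps_rep \<Gamma> \<epsilon> V B M + string_rep \<Gamma> M I c d b
  for \<Gamma> :: quiver and \<epsilon> :: complex and V :: "nat \<Rightarrow> 'v::complex_vector set"
    and B :: "nat \<Rightarrow> nat \<Rightarrow> 'v \<Rightarrow> 'v \<Rightarrow> complex" and M :: "'v rep"
    and I c d b +
  assumes nonsplit: "non_split_type \<Gamma> \<epsilon>"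
begin

abbreviation K :: "nat set" where "K \<equiv> through I c d mid"

definition gram :: "nat \<Rightarrow> nat \<Rightarrow> complex" where
  "gram k l = bt (b k mid) (b l mid)"

definition reaches :: "nat \<Rightarrow> nat \<Rightarrow> bool" where
  "reaches k l \<longleftrightarrow> (\<exists>\<phi>. is_hom \<Gamma> M M \<phi> \<and> cf l mid (\<phi> mid (b k mid)) \<noteq> 0)"

lemma K_I: "k \<in> K \<Longrightarrow> k \<in> I" by (simp add: through_def)

lemma K_mid: "k \<in> K \<Longrightarrow> mid \<in> {c k..d k}" by (simp add: through_def)

lemma gram_sym: "k \<in> K \<Longrightarrow> l \<in> K \<Longrightarrow> gram k l = gram l k"
  unfolding gram_def by (rule bt_sym[OF nonsplit b_mem[OF K_I mid_vert(1)] b_mem[OF K_I mid_vert(1)]])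

lemma bt_expand_left:
  assumes x: "x \<in> rep_space M mid" and y: "y \<in> rep_space M mid"
  shows "bt x y = (\<Sum>k\<in>K. cf k mid x * bt (b k mid) y)"
proof -
  have "bt x y = bt (\<Sum>k\<in>K. cf k mid x *\<^sub>C b k mid) y" using expand[OF mid_vert(1) x] by simp
  also have "\<dots> = (\<Sum>k\<in>K. cf k mid x *\<^sub>C bt (b k mid) y)"
    by (rule linear_sum[OF bt_left[OF y] sub[OF mid_vert(1)]]) (rule b_mem[OF K_I mid_vert(1)])
  finally show ?thesis by (simp add: scaleC_complex_def)
qed

lemma bt_expand:
  assumes x: "x \<in> rep_space M mid" and y: "y \<in> rep_space M mid"
  shows "bt x y = (\<Sum>k\<in>K. \<Sum>l\<in>K. gram k l * cf k mid x * cf l mid y)"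
proof -
  have "bt (b k mid) y = (\<Sum>l\<in>K. cf l mid y * gram k l)" if k: "k \<in> K" for k
  proof -
    have "bt (b k mid) y = bt (b k mid) (\<Sum>l\<in>K. cf l mid y *\<^sub>C b l mid)" using expand[OF mid_vert(1) y] by simp
    also have "\<dots> = (\<Sum>l\<in>K. cf l mid y *\<^sub>C bt (b k mid) (b l mid))"
      by (rule linear_sum[OF bt_right[OF b_mem[OF K_I[OF k] mid_vert(1)]] sub[OF mid_vert(1)]])
        (rule b_mem[OF K_I mid_vert(1)])
    finally show ?thesis by (simp add: scaleC_complex_def gram_def)
  qed
  then show ?thesis unfolding bt_expand_left[OF x y]
    by (simp add: sum_distrib_left algebra_simps cong: sum.cong)
qed

lemma tr_b: "k \<in> K \<Longrightarrow> tr (b k mid) = b k (\<sigma> mid)"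
  using tr_stringvec[OF b_stringvec[OF K_I] K_mid, of k] b_outside[OF K_I, of k "\<sigma> mid"] by auto

lemma gram_nonzero:
  assumes k: "k \<in> K" and l: "l \<in> K" and nz: "gram k l \<noteq> 0"
  shows "\<sigma> mid \<in> {c l..d l}" "depth \<Gamma> (c k) \<le> depth \<Gamma> (\<sigma> (d l))"
proof -
  have eq: "gram k l = B mid (\<sigma> mid) (b k mid) (b l (\<sigma> mid))" using tr_b[OF l] by (simp add: gram_def bt_def)
  show sl: "\<sigma> mid \<in> {c l..d l}"
  proof (rule ccontr)
    assume "\<not> ?thesis"
    then have "b l (\<sigma> mid) = 0" using b_outside[OF K_I[OF l]] by blast
    then have "gram k l = 0" unfolding eq
      using linear_zero[OF form_right[OF mid_vert b_mem[OF K_I[OF k] mid_vert(1)]] sub[OF mid_vert(2)]] by simp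
    then show False using nz by simp
  qed
  show "depth \<Gamma> (c k) \<le> depth \<Gamma> (\<sigma> (d l))"
    by (rule stringvec_pairing_depth[OF b_stringvec[OF K_I[OF k]] b_stringvec[OF K_I[OF l]] _ _ _ mid_vert(1) K_mid[OF k] sl])
      (use nz eq string_basisD(2)[OF strings] K_I k l in auto)
qed

text \<open>
  The family given by \<open>dual_stringvec\<close> for the coordinate functionals of the string \<open>k\<close> yields an
  endomorphism, and it sends the vector of the string at the middle to one that pairs with this vector
  to \<open>\<plusminus>1\<close>.
\<close>

lemma dual_reaches:
  assumes k: "k \<in> K" and s: "\<sigma> mid \<in> {c k..d k}" and le: "depth \<Gamma> (c k) \<le> depth \<Gamma> (\<sigma> (d k))"
  shows "\<exists>j\<in>K. reaches k j \<and> gram j k \<noteq> 0"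
proof -
  note kI = K_I[OF k]
  have cd: "1 \<le> c k" "c k \<le> d k" "d k \<le> num_verts \<Gamma>" using string_basisD(2)[OF strings kI] by auto
  obtain w where w: "stringvec \<Gamma> M (c k) (d k) w"
    "\<And>i x. i \<in> {c k..d k} \<Longrightarrow> x \<in> rep_space M (\<sigma> i) \<Longrightarrow>
        B i (\<sigma> i) (w i) x = (- 1) ^ i * (if \<sigma> i \<in> {c k..d k} then cf k (\<sigma> i) x else 0)"
    using dual_stringvec[OF cd cf_covec[OF kI] le] by blast
  define \<phi> where "\<phi> = through_string (c k) (d k) (cf k) w"
  have hom: "is_hom \<Gamma> M M \<phi>" unfolding \<phi>_def by (rule through_string_is_hom[OF cf_covec[OF kI] w(1) rep rep])
  have wm: "w mid \<in> rep_space M mid" by (rule stringvecD(1)[OF w(1) mid_vert(1) K_mid[OF k]])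
  have bk: "b k mid \<in> rep_space M mid" by (rule b_mem[OF kI mid_vert(1)])
  have \<phi>b: "\<phi> mid (b k mid) = w mid"
    using cf_b[OF mid_vert(1) k, of k] K_mid[OF k] by (simp add: \<phi>_def through_string_def)
  have "k \<in> through I c d (\<sigma> mid)" using kI s by (simp add: through_def)
  then have "cf k (\<sigma> mid) (b k (\<sigma> mid)) = 1" using cf_b[OF mid_vert(2), of k k] by simp
  then have "bt (w mid) (b k mid) = (- 1) ^ mid"
    unfolding bt_def tr_b[OF k] using w(2)[OF K_mid[OF k] b_mem[OF kI mid_vert(2)]] s by simp
  then have "(\<Sum>j\<in>K. cf j mid (w mid) * bt (b j mid) (b k mid)) \<noteq> 0"
    using bt_expand_left[OF wm bk] by simp
  then obtain j where j: "j \<in> K" "cf j mid (w mid) * bt (b j mid) (b k mid) \<noteq> 0"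
    by (meson sum.not_neutral_contains_not_neutral)
  then have "reaches k j \<and> gram j k \<noteq> 0"
    using hom \<phi>b unfolding reaches_def gram_def by auto
  then show ?thesis using j(1) by blast
qed

text \<open>
  By \<open>gram_nonzero\<close> and symmetry, the left end of \<open>k\<close> is at most as deep as the mirror image of the
  right end of \<open>l\<close>, and conversely. As depths are totally ordered, one of the two strings satisfies
  the same inequality with itself.
\<close>

lemma gram_compare:
  assumes k: "k \<in> K" and l: "l \<in> K" and nz: "gram k l \<noteq> 0"
  shows "(\<exists>j\<in>K. reaches k j \<and> gram j k \<noteq> 0) \<or> (\<exists>j\<in>K. reaches l j \<and> gram j l \<noteq> 0)"
proof -
  have nz': "gram l k \<noteq> 0" using nz gram_sym[OF k l] by simp
  have "depth \<Gamma> (c k) \<le> depth \<Gamma> (\<sigma> (d k)) \<or> depth \<Gamma> (c l) \<le> depth \<Gamma> (\<sigma> (d l))"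
    using gram_nonzero(2)[OF k l nz] gram_nonzero(2)[OF l k nz'] by linarith
  then show ?thesis
    using dual_reaches[OF k gram_nonzero(1)[OF l k nz']] dual_reaches[OF l gram_nonzero(1)[OF k l nz]] by blast
qed

end

section \<open>Quotients in coordinates\<close>

lemma is_basis_span:
  assumes "is_basis J v S" "cvec.subspace S"
  shows "cvec.span (v ` J) = S"
proof (rule cvec.span_subspace[OF _ _ assms(2)])
  show "v ` J \<subseteq> S" using assms(1) by (simp add: is_basis_def)
  show "S \<subseteq> cvec.span (v ` J)"
  proof
    fix x assume "x \<in> S"
    then have "x = (\<Sum>j\<in>J. coord J v x j *\<^sub>C v j)" using coord_sum[OF assms(1)] by simp
    also have "\<dots> \<in> cvec.span (v ` J)"
      by (intro cvec.span_sum cvec.span_scale cvec.span_base) auto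
    finally show "x \<in> cvec.span (v ` J)" .
  qed
qed

lemma is_basis_fin_dim:
  assumes "is_basis J v S" "cvec.subspace S"
  shows "fin_dim_subspace S"
  unfolding fin_dim_subspace_def
  using is_basis_span[OF assms] is_basis_finite[OF assms(1)] by (intro exI[of _ "v ` J"]) simp

lemma is_basis_dim:
  assumes bas: "is_basis J v S" and S: "cvec.subspace S"
  shows "cvec.dim S = card J"
proof -
  have fin: "finite J" using bas by (rule is_basis_finite)
  have inj: "inj_on v J"
  proof (rule inj_onI, rule ccontr)
    fix i j assume ij: "i \<in> J" "j \<in> J" "v i = v j" "i \<noteq> j"
    have "coord J v (v i) i = 1" "coord J v (v j) i = 0"
      using coord_basis[OF bas ij(1), of i] coord_basis[OF bas ij(2), of i] ij by auto
    then show False using ij(3) by simp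
  qed
  have ind: "cvec.independent (v ` J)"
  proof
    assume "cvec.dependent (v ` J)"
    then obtain u w where u: "w \<in> v ` J" "u w \<noteq> 0" "(\<Sum>x\<in>v ` J. u x *\<^sub>C x) = 0"
      using cvec.dependent_finite[of "v ` J"] fin by auto
    then obtain k where k: "k \<in> J" "w = v k" by blast
    have "(\<Sum>j\<in>J. u (v j) *\<^sub>C v j) = 0" using u(3) inj by (simp add: sum.reindex)
    from is_basis_indep[OF bas this k(1)] show False using u(2) k(2) by simp
  qed
  have "S \<subseteq> cvec.span (v ` J)" using is_basis_span[OF bas S] by simp
  moreover have "v ` J \<subseteq> S" using bas by (simp add: is_basis_def)
  ultimately have "cvec.dim S = card (v ` J)" using cvec.dim_unique[OF _ _ ind refl] by blast
  then show ?thesis using inj by (simp add: card_image)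
qed

definition delta_seq :: "nat \<Rightarrow> nat \<Rightarrow> complex" where
  "delta_seq r = (\<lambda>k. if k = r then 1 else 0)"

definition seq_space :: "nat \<Rightarrow> (nat \<Rightarrow> complex) set" where
  "seq_space n = {x. \<forall>k\<ge>n. x k = 0}"

lemma seq_space_subspace: "cvec.subspace (seq_space n)"
  by (rule cvec.subspaceI) (auto simp: seq_space_def scaleC_fun_def scaleC_complex_def)

lemma sum_fun_apply: "(\<Sum>j\<in>J. f j) k = (\<Sum>j\<in>J. (f j k :: complex))"
  by (induction J rule: infinite_finite_induct) auto

lemma seq_expand: "x \<in> seq_space n \<Longrightarrow> x = (\<Sum>r<n. x r *\<^sub>C delta_seq r)"
proof
  fix k assume x: "x \<in> seq_space n"
  have "(\<Sum>r<n. x r *\<^sub>C delta_seq r) k = (\<Sum>r<n. if r = k then x r else 0)"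
    unfolding sum_fun_apply by (rule sum.cong) (auto simp: delta_seq_def scaleC_fun_def scaleC_complex_def)
  also have "\<dots> = x k" using x by (auto simp: seq_space_def)
  finally show "x k = (\<Sum>r<n. x r *\<^sub>C delta_seq r) k" by simp
qed

lemma delta_seq_mem: "r < n \<Longrightarrow> delta_seq r \<in> seq_space n"
  by (auto simp: delta_seq_def seq_space_def)

lemma seq_space_basis: "is_basis {..<n} delta_seq (seq_space n)"
  unfolding is_basis_def
proof (intro conjI)
  show "indep {..<n} delta_seq" unfolding indep_def
  proof (intro allI impI ballI)
    fix a k assume 0: "(\<Sum>j<n. a j *\<^sub>C delta_seq j) = 0" and k: "k \<in> {..<n}"
    have "(\<Sum>j<n. a j *\<^sub>C delta_seq j) k = (\<Sum>j<n. if j = k then a j else 0)"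
      unfolding sum_fun_apply by (rule sum.cong) (auto simp: delta_seq_def scaleC_fun_def scaleC_complex_def)
    then show "a k = 0" using 0 k by simp
  qed
  show "seq_space n \<subseteq> comb {..<n} delta_seq"
    using seq_expand by (auto intro: comb_eqI)
qed (auto intro: delta_seq_mem)

lemma rep_of_space: "rep_space (rep_of \<Gamma> dd A) i = seq_space (dd i)"
  by (simp add: rep_of_def seq_space_def)

lemma rep_of_map: "rep_map (rep_of \<Gamma> dd A) e x = (\<lambda>r. \<Sum>c<dd (arrow_tail \<Gamma> e). A (e, r, c) * x c)"
  by (simp add: rep_of_def)

lemma rep_of_is_rep:
  assumes A: "A \<in> rep_variety \<Gamma> dd"
  shows "is_rep \<Gamma> (rep_of \<Gamma> dd A)"
  unfolding is_rep_def rep_of_space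
proof (intro conjI ballI)
  show "fin_dim_subspace (seq_space (dd i))" for i
    by (rule is_basis_fin_dim[OF seq_space_basis seq_space_subspace])
  fix e assume e: "e \<in> q_arrows \<Gamma>"
  have "A (e, r, c) = 0" if "\<not> r < dd (arrow_head \<Gamma> e)" for r c
    using A that by (auto simp: rep_variety_def)
  then have mem: "rep_map (rep_of \<Gamma> dd A) e x \<in> seq_space (dd (arrow_head \<Gamma> e))" for x
    by (simp add: rep_of_map seq_space_def)
  show "linear_between (seq_space (dd (arrow_tail \<Gamma> e))) (seq_space (dd (arrow_head \<Gamma> e))) (rep_map (rep_of \<Gamma> dd A) e)"
    using mem unfolding linear_between_def rep_of_map
    by (auto simp: fun_eq_iff scaleC_fun_def scaleC_complex_def algebra_simps sum.distrib sum_distrib_left)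
qed

text \<open>
  The quotient of \<open>S\<close> by \<open>T\<close> is realised on sequences, as the representations \<open>rep_of\<close> require.
\<close>

lemma quotient_coordinates:
  fixes S :: "'v::complex_vector set" and T :: "'v set"
  assumes S: "fin_dim_subspace S" and T: "cvec.subspace T" "T \<subseteq> S"
  obtains \<pi> where "linear_between S (seq_space (cvec.dim S - cvec.dim T)) \<pi>"
    "\<pi> ` S = seq_space (cvec.dim S - cvec.dim T)" "{x \<in> S. \<pi> x = 0} = T"
proof -
  let ?n = "cvec.dim S - cvec.dim T"
  have S': "cvec.subspace S" using fin_dim_imp_subspace[OF S] .
  obtain J :: "nat set" and v where J: "is_basis J v T"
    using basis_exists_nat[OF fin_dim_subspace_subset[OF S T], of "{}"] by auto
  have finJ: "finite J" using is_basis_finite[OF J] .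
  have vS: "v ` J \<subseteq> S" and vi: "indep J v" using J T(2) by (auto simp: is_basis_def)
  obtain J' w where J': "finite J'" "J' \<inter> J = {}" "\<And>j. j \<in> J \<Longrightarrow> w j = v j" "is_basis (J \<union> J') w S"
    by (rule indep_extend[OF S finJ vS vi finJ subset_refl], rule that) auto
  have "cvec.dim S = card J + card J'"
    using is_basis_dim[OF J'(4) S'] finJ J'(1,2) by (simp add: card_Un_disjoint Int_commute)
  then have n: "card J' = ?n" using is_basis_dim[OF J T(1)] by simp
  obtain e where e: "bij_betw e {..<?n} J'"
    using ex_bij_betw_nat_finite[OF J'(1)] n by (auto simp: atLeast0LessThan)
  have eJ: "e r \<in> J'" if "r < ?n" for r using e that by (auto simp: bij_betw_def)
  define \<pi> where "\<pi> x = (\<lambda>r. if r < ?n then coord (J \<union> J') w x (e r) else 0)" for x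
  have lin: "linear_between S (seq_space ?n) \<pi>"
    unfolding linear_between_def
  proof (intro conjI ballI allI)
    show "\<pi> ` S \<subseteq> seq_space ?n" by (auto simp: \<pi>_def seq_space_def)
    show "\<pi> (x + y) = \<pi> x + \<pi> y" if "x \<in> S" "y \<in> S" for x y
      using coord_add[OF J'(4) S' that] by (auto simp: \<pi>_def)
    show "\<pi> (t *\<^sub>C x) = t *\<^sub>C \<pi> x" if "x \<in> S" for t x
      using coord_scale[OF J'(4) S' that] by (auto simp: \<pi>_def scaleC_fun_def scaleC_complex_def)
  qed
  have \<pi>w: "\<pi> (w (e r)) = delta_seq r" if r: "r < ?n" for r
  proof
    fix k
    have "coord (J \<union> J') w (w (e r)) (e k) = (if k = r then 1 else 0)" if "k < ?n"
      using coord_basis[OF J'(4), of "e r" "e k"] eJ[OF r] r that e by (auto simp: bij_betw_def inj_on_def)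
    then show "\<pi> (w (e r)) k = delta_seq r k" using r by (auto simp: \<pi>_def delta_seq_def)
  qed
  have wS: "w (e r) \<in> S" if "r < ?n" for r using is_basis_mem[OF J'(4)] eJ[OF that] by simp
  have onto: "seq_space ?n \<subseteq> \<pi> ` S"
  proof
    fix y assume y: "y \<in> seq_space ?n"
    let ?x = "\<Sum>r<?n. y r *\<^sub>C w (e r)"
    have "?x \<in> S" by (intro cvec.subspace_sum[OF S'] cvec.subspace_scale[OF S'] wS) simp
    moreover have "\<pi> ?x = y"
      using linear_sum[OF lin S', of "{..<?n}" "\<lambda>r. w (e r)" y] wS \<pi>w seq_expand[OF y] by simp
    ultimately show "y \<in> \<pi> ` S" by (intro image_eqI[of y \<pi> ?x]) (simp only:)+
  qed
  have ker: "{x \<in> S. \<pi> x = 0} = T"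
  proof (intro equalityI subsetI)
    fix x assume "x \<in> {x \<in> S. \<pi> x = 0}"
    then have x: "x \<in> S" "\<pi> x = 0" by auto
    have z: "coord (J \<union> J') w x j = 0" if j: "j \<in> J'" for j
    proof -
      have "j \<in> e ` {..<?n}" using j e by (simp add: bij_betw_def)
      then obtain r where r: "r < ?n" "j = e r" by blast
      then show ?thesis using fun_cong[OF x(2), of r] by (simp add: \<pi>_def)
    qed
    have "x = (\<Sum>j\<in>J \<union> J'. coord (J \<union> J') w x j *\<^sub>C w j)" using coord_sum[OF J'(4) x(1)] by simp
    also have "\<dots> = (\<Sum>j\<in>J. coord (J \<union> J') w x j *\<^sub>C w j)"
      by (rule sum.mono_neutral_right) (use finJ J'(1) z in auto)
    also have "\<dots> = (\<Sum>j\<in>J. coord (J \<union> J') w x j *\<^sub>C v j)" by (rule sum.cong) (auto simp: J'(3))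
    also have "\<dots> \<in> T"
      by (intro cvec.subspace_sum[OF T(1)] cvec.subspace_scale[OF T(1)] is_basis_mem[OF J])
    finally show "x \<in> T" .
  next
    fix x assume x: "x \<in> T"
    have w0: "\<pi> (w j) = 0" if j: "j \<in> J" for j
    proof
      fix r
      have "coord (J \<union> J') w (w j) (e r) = 0" if "r < ?n"
        using coord_basis[OF J'(4), of j "e r"] j eJ[OF that] J'(2) by auto
      then show "\<pi> (w j) r = 0 r" by (simp add: \<pi>_def)
    qed
    have "x = (\<Sum>j\<in>J. coord J v x j *\<^sub>C v j)" using coord_sum[OF J x] by simp
    also have "\<dots> = (\<Sum>j\<in>J. coord J v x j *\<^sub>C w j)" by (rule sum.cong) (auto simp: J'(3))
    finally have "\<pi> x = \<pi> (\<Sum>j\<in>J. coord J v x j *\<^sub>C w j)" by simp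
    also have "\<dots> = (\<Sum>j\<in>J. coord J v x j *\<^sub>C \<pi> (w j))"
      by (rule linear_sum[OF lin S']) (rule is_basis_mem[OF J'(4)], simp)
    also have "\<dots> = 0" using w0 by simp
    finally show "x \<in> {x \<in> S. \<pi> x = 0}" using x T(2) by auto
  qed
  have "\<pi> ` S = seq_space ?n" using onto lin by (auto simp: linear_between_def)
  then show ?thesis using that lin ker by blast
qed

lemma dim_injective_image:
  assumes S: "fin_dim_subspace S" and f: "linear_between S T f" and inj: "inj_on f S"
  shows "cvec.dim (f ` S) = cvec.dim S"
proof -
  have S': "cvec.subspace S" using fin_dim_imp_subspace[OF S] .
  obtain J :: "nat set" and v where J: "is_basis J v S" using basis_exists_nat[OF S, of "{}"] by auto
  have fsum: "f (\<Sum>j\<in>J. a j *\<^sub>C v j) = (\<Sum>j\<in>J. a j *\<^sub>C f (v j))" for a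
    by (rule linear_sum[OF f S' is_basis_mem[OF J]])
  have sumS: "(\<Sum>j\<in>J. a j *\<^sub>C v j) \<in> S" for a
    by (intro cvec.subspace_sum[OF S'] cvec.subspace_scale[OF S'] is_basis_mem[OF J])
  have "is_basis J (\<lambda>j. f (v j)) (f ` S)"
    unfolding is_basis_def
  proof (intro conjI)
    show "finite J" using is_basis_finite[OF J] .
    show "(\<lambda>j. f (v j)) ` J \<subseteq> f ` S" using is_basis_mem[OF J] by blast
    show "indep J (\<lambda>j. f (v j))" unfolding indep_def
    proof (intro allI impI ballI)
      fix a j assume "(\<Sum>j\<in>J. a j *\<^sub>C f (v j)) = 0" and j: "j \<in> J"
      then have "f (\<Sum>j\<in>J. a j *\<^sub>C v j) = f 0" using fsum linear_zero[OF f S'] by simp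
      then have "(\<Sum>j\<in>J. a j *\<^sub>C v j) = 0" using inj_onD[OF inj _ sumS cvec.subspace_0[OF S']] by blast
      then show "a j = 0" using is_basis_indep[OF J] j by blast
    qed
    show "f ` S \<subseteq> comb J (\<lambda>j. f (v j))"
    proof
      fix y assume "y \<in> f ` S"
      then obtain x where x: "x \<in> S" "y = f x" by blast
      have "y = f (\<Sum>j\<in>J. coord J v x j *\<^sub>C v j)" using coord_sum[OF J x(1)] x(2) by simp
      then show "y \<in> comb J (\<lambda>j. f (v j))" unfolding fsum by (rule comb_eqI)
    qed
  qed
  then show ?thesis using is_basis_dim[OF _ linear_image[OF f S']] is_basis_dim[OF J S'] by simp
qed

lemma mono_has_quotient:
  assumes L: "is_rep \<Gamma> L" and M: "is_rep \<Gamma> M" and mono: "is_mono \<Gamma> L M \<iota>"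
  obtains A \<pi> where "A \<in> rep_variety \<Gamma> (dim_diff M L)" "short_exact \<Gamma> L \<iota> M \<pi> (rep_of \<Gamma> (dim_diff M L) A)"
proof -
  let ?dd = "dim_diff M L"
  have hom: "is_hom \<Gamma> L M \<iota>" and inj: "\<And>i. i \<in> q_verts \<Gamma> \<Longrightarrow> inj_on (\<iota> i) (rep_space L i)"
    using mono by (auto simp: is_mono_def)
  have subM: "cvec.subspace (rep_space M i)" and subL: "cvec.subspace (rep_space L i)" if "i \<in> q_verts \<Gamma>" for i
    using is_rep_space(2)[OF M that] is_rep_space(2)[OF L that] .
  have "\<forall>i\<in>q_verts \<Gamma>. \<exists>p. linear_between (rep_space M i) (seq_space (?dd i)) p \<and>
      p ` rep_space M i = seq_space (?dd i) \<and> {x \<in> rep_space M i. p x = 0} = \<iota> i ` rep_space L i"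
  proof
    fix i assume i: "i \<in> q_verts \<Gamma>"
    note lin = is_hom_lin[OF hom i]
    have sub: "cvec.subspace (\<iota> i ` rep_space L i)" by (rule linear_image[OF lin subL[OF i]])
    have le: "\<iota> i ` rep_space L i \<subseteq> rep_space M i" using lin by (simp add: linear_between_def)
    have deq: "cvec.dim (rep_space M i) - cvec.dim (\<iota> i ` rep_space L i) = ?dd i"
      using dim_injective_image[OF is_rep_space(1)[OF L i] lin inj[OF i]] by (simp add: Defs.dim_vec_def)
    obtain p where "linear_between (rep_space M i) (seq_space (?dd i)) p"
      "p ` rep_space M i = seq_space (?dd i)" "{x \<in> rep_space M i. p x = 0} = \<iota> i ` rep_space L i"
      by (rule quotient_coordinates[OF is_rep_space(1)[OF M i] sub le, unfolded deq])
    then show "\<exists>p. linear_between (rep_space M i) (seq_space (?dd i)) p \<and>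
      p ` rep_space M i = seq_space (?dd i) \<and> {x \<in> rep_space M i. p x = 0} = \<iota> i ` rep_space L i"
      by blast
  qed
  from bchoice[OF this] obtain \<pi> where \<pi>: "\<forall>i\<in>q_verts \<Gamma>. linear_between (rep_space M i) (seq_space (?dd i)) (\<pi> i) \<and>
      \<pi> i ` rep_space M i = seq_space (?dd i) \<and> {x \<in> rep_space M i. \<pi> i x = 0} = \<iota> i ` rep_space L i" ..
  have lin: "linear_between (rep_space M i) (seq_space (?dd i)) (\<pi> i)"
    and onto: "\<pi> i ` rep_space M i = seq_space (?dd i)"
    and ker: "{x \<in> rep_space M i. \<pi> i x = 0} = \<iota> i ` rep_space L i" if "i \<in> q_verts \<Gamma>" for i
    using \<pi> that by blast+
  have "\<exists>s. s \<in> rep_space M i \<and> \<pi> i s = delta_seq r" if "i \<in> q_verts \<Gamma>" "r < ?dd i" for i r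
  proof -
    have "delta_seq r \<in> \<pi> i ` rep_space M i" using onto[OF that(1)] delta_seq_mem[OF that(2)] by simp
    then show ?thesis by auto
  qed
  then obtain s where s: "\<And>i r. i \<in> q_verts \<Gamma> \<Longrightarrow> r < ?dd i \<Longrightarrow> s i r \<in> rep_space M i \<and> \<pi> i (s i r) = delta_seq r"
    by metis
  define A :: rep_point where "A = (\<lambda>(e, r, c). if e \<in> q_arrows \<Gamma> \<and> r < ?dd (arrow_head \<Gamma> e) \<and> c < ?dd (arrow_tail \<Gamma> e)
      then \<pi> (arrow_head \<Gamma> e) (rep_map M e (s (arrow_tail \<Gamma> e) c)) r else 0)"
  have A: "A \<in> rep_variety \<Gamma> ?dd" by (auto simp: rep_variety_def A_def)
  let ?N = "rep_of \<Gamma> ?dd A"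
  have arr: "\<pi> (arrow_head \<Gamma> e) (rep_map M e x) = rep_map ?N e (\<pi> (arrow_tail \<Gamma> e) x)"
    if e: "e \<in> q_arrows \<Gamma>" and x: "x \<in> rep_space M (arrow_tail \<Gamma> e)" for e x
  proof -
    let ?t = "arrow_tail \<Gamma> e" and ?h = "arrow_head \<Gamma> e"
    note tv = arrow_in_verts[OF e]
    note me = is_rep_map[OF M e]
    have st: "s ?t c \<in> rep_space M ?t" if "c < ?dd ?t" for c using s[OF tv(1) that] by blast
    define y where "y = (\<Sum>c<?dd ?t. \<pi> ?t x c *\<^sub>C s ?t c)"
    have y: "y \<in> rep_space M ?t" unfolding y_def
      by (intro cvec.subspace_sum[OF subM[OF tv(1)]] cvec.subspace_scale[OF subM[OF tv(1)]] st) simp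
    have "\<pi> ?t y = (\<Sum>c<?dd ?t. \<pi> ?t x c *\<^sub>C \<pi> ?t (s ?t c))"
      unfolding y_def by (rule linear_sum[OF lin[OF tv(1)] subM[OF tv(1)] st]) simp
    also have "\<dots> = (\<Sum>c<?dd ?t. \<pi> ?t x c *\<^sub>C delta_seq c)" using s[OF tv(1)] by simp
    also have "\<dots> = \<pi> ?t x" using seq_expand[OF linear_mem[OF lin[OF tv(1)] x]] by simp
    finally have "x - y \<in> {x \<in> rep_space M ?t. \<pi> ?t x = 0}"
      using linear_diff[OF lin[OF tv(1)] subM[OF tv(1)] x y] cvec.subspace_diff[OF subM[OF tv(1)] x y] by simp
    then obtain w where w: "w \<in> rep_space L ?t" "x - y = \<iota> ?t w" unfolding ker[OF tv(1)] by blast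
    have "rep_map M e (x - y) = \<iota> ?h (rep_map L e w)" using is_hom_arrow[OF hom e w(1)] w(2) by simp
    then have "rep_map M e (x - y) \<in> {x \<in> rep_space M ?h. \<pi> ?h x = 0}"
      unfolding ker[OF tv(2)] using arrow_mem[OF L e w(1)] by simp
    moreover have "rep_map M e (x - y) = rep_map M e x - rep_map M e y"
      by (rule linear_diff[OF me subM[OF tv(1)] x y])
    ultimately have "\<pi> ?h (rep_map M e x) = \<pi> ?h (rep_map M e y)"
      using linear_diff[OF lin[OF tv(2)] subM[OF tv(2)] linear_mem[OF me x] linear_mem[OF me y]]
      by simp
    also have "rep_map M e y = (\<Sum>c<?dd ?t. \<pi> ?t x c *\<^sub>C rep_map M e (s ?t c))"
      unfolding y_def by (rule linear_sum[OF me subM[OF tv(1)] st]) simp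
    also have "\<pi> ?h \<dots> = (\<Sum>c<?dd ?t. \<pi> ?t x c *\<^sub>C \<pi> ?h (rep_map M e (s ?t c)))"
      by (rule linear_sum[OF lin[OF tv(2)] subM[OF tv(2)]]) (use linear_mem[OF me] st in auto)
    also have "\<dots> = rep_map ?N e (\<pi> ?t x)"
    proof
      fix r
      have mem: "\<pi> ?h (rep_map M e (s ?t c)) \<in> seq_space (?dd ?h)" if "c < ?dd ?t" for c
        using linear_mem[OF lin[OF tv(2)] linear_mem[OF me st[OF that]]] .
      have "\<pi> ?h (rep_map M e (s ?t c)) r = A (e, r, c)" if "c < ?dd ?t" for c
        using mem[OF that] e that by (auto simp: A_def seq_space_def)
      then show "(\<Sum>c<?dd ?t. \<pi> ?t x c *\<^sub>C \<pi> ?h (rep_map M e (s ?t c))) r = rep_map ?N e (\<pi> ?t x) r"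
        unfolding sum_fun_apply rep_of_map by (intro sum.cong) (auto simp: scaleC_fun_def scaleC_complex_def)
    qed
    finally show ?thesis .
  qed
  have "is_epi \<Gamma> M ?N \<pi>"
    unfolding is_epi_def is_hom_def rep_of_space using lin onto arr by blast
  moreover have "is_rep \<Gamma> ?N" by (rule rep_of_is_rep[OF A])
  ultimately have "short_exact \<Gamma> L \<iota> M \<pi> ?N"
    unfolding short_exact_def using L M mono ker by blast
  then show ?thesis using that A by blast
qed

section \<open>Generic embeddings\<close>

lemma covec_pullback:
  assumes "is_hom \<Gamma> M N \<pi>" "covec \<Gamma> N c d g"
  shows "covec \<Gamma> M c d (\<lambda>i x. g i (\<pi> i x))"
  unfolding covec_def
proof (intro conjI ballI impI)
  fix i assume i: "i \<in> q_verts \<Gamma>"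
  show "linear_between (rep_space M i) UNIV (\<lambda>x. g i (\<pi> i x))"
    by (rule linear_comp[OF is_hom_lin[OF assms(1) i] covecD(1)[OF assms(2) i]])
next
  fix e x assume e: "e \<in> q_arrows \<Gamma>" and x: "x \<in> rep_space M (arrow_tail \<Gamma> e)"
    and h: "arrow_head \<Gamma> e \<in> {c..d}"
  show "g (arrow_head \<Gamma> e) (\<pi> (arrow_head \<Gamma> e) (rep_map M e x))
      = (if arrow_tail \<Gamma> e \<in> {c..d} then g (arrow_tail \<Gamma> e) (\<pi> (arrow_tail \<Gamma> e) x) else 0)"
    using covecD(2)[OF assms(2) e hom_mem[OF assms(1) arrow_in_verts(1)[OF e] x] h]
      is_hom_arrow[OF assms(1) e x] by simp
qed

lemma covec_descends:
  assumes ex: "short_exact \<Gamma> L \<iota> M \<pi> N" and f: "covec \<Gamma> M c d f"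
    and van: "\<And>i x. i \<in> q_verts \<Gamma> \<Longrightarrow> i \<in> {c..d} \<Longrightarrow> x \<in> rep_space L i \<Longrightarrow> f i (\<iota> i x) = 0"
  obtains g where "covec \<Gamma> N c d g"
    "\<And>i x. i \<in> q_verts \<Gamma> \<Longrightarrow> i \<in> {c..d} \<Longrightarrow> x \<in> rep_space M i \<Longrightarrow> g i (\<pi> i x) = f i x"
proof -
  have M: "is_rep \<Gamma> M" and epi: "is_epi \<Gamma> M N \<pi>"
    and ker: "\<And>i. i \<in> q_verts \<Gamma> \<Longrightarrow> \<iota> i ` rep_space L i = {x \<in> rep_space M i. \<pi> i x = 0}"
    using ex by (auto simp: short_exact_def)
  have \<pi>: "is_hom \<Gamma> M N \<pi>" and onto: "\<And>i. i \<in> q_verts \<Gamma> \<Longrightarrow> \<pi> i ` rep_space M i = rep_space N i"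
    using epi by (auto simp: is_epi_def)
  have sub: "cvec.subspace (rep_space M i)" if "i \<in> q_verts \<Gamma>" for i by (rule is_rep_space(2)[OF M that])
  define g where "g i y = (if i \<in> {c..d} then f i (SOME x. x \<in> rep_space M i \<and> \<pi> i x = y) else 0)" for i y
  have g\<pi>: "g i (\<pi> i x) = f i x" if i: "i \<in> q_verts \<Gamma>" "i \<in> {c..d}" and x: "x \<in> rep_space M i" for i x
  proof -
    define x' where "x' = (SOME x'. x' \<in> rep_space M i \<and> \<pi> i x' = \<pi> i x)"
    have x': "x' \<in> rep_space M i \<and> \<pi> i x' = \<pi> i x" unfolding x'_def by (rule someI[of _ x]) (use x in simp)
    have "x' - x \<in> {x \<in> rep_space M i. \<pi> i x = 0}"
      using x x' cvec.subspace_diff[OF sub[OF i(1)]] hom_diff[OF \<pi> i(1) sub[OF i(1)], of x' x]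
      by simp
    then obtain y where "y \<in> rep_space L i" "x' - x = \<iota> i y" using ker[OF i(1)] by blast
    then have "f i (x' - x) = 0" using van[OF i] by simp
    then have "f i x' = f i x"
      using linear_diff[OF covecD(1)[OF f i(1)] sub[OF i(1)], of x' x] x x' by simp
    then show ?thesis using i by (simp add: g_def x'_def)
  qed
  have "covec \<Gamma> N c d g"
    unfolding covec_def
  proof (intro conjI ballI impI)
    fix i assume i: "i \<in> q_verts \<Gamma>"
    show "linear_between (rep_space N i) UNIV (g i)"
    proof (cases "i \<in> {c..d}")
      case False
      then have "g i = (\<lambda>x. 0)" by (auto simp: g_def)
      then show ?thesis by (simp add: linear_between_def)
    next
      case True
      note gp = g\<pi>[OF i True]
      note lin = is_hom_lin[OF \<pi> i] and fl = covecD(1)[OF f i]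
      have "g i (y + y') = g i y + g i y'" if y: "y \<in> rep_space N i" and y': "y' \<in> rep_space N i" for y y'
      proof -
        obtain x where x: "x \<in> rep_space M i" "y = \<pi> i x" using onto[OF i] y by blast
        obtain x' where x': "x' \<in> rep_space M i" "y' = \<pi> i x'" using onto[OF i] y' by blast
        have "y + y' = \<pi> i (x + x')" using linear_add[OF lin x(1) x'(1)] x x' by simp
        then show ?thesis
          using gp[OF cvec.subspace_add[OF sub[OF i] x(1) x'(1)]] gp[OF x(1)] gp[OF x'(1)] x x'
            linear_add[OF fl x(1) x'(1)] by simp
      qed
      moreover have "g i (t *\<^sub>C y) = t *\<^sub>C g i y" if y: "y \<in> rep_space N i" for t y
      proof -
        obtain x where x: "x \<in> rep_space M i" "y = \<pi> i x" using onto[OF i] y by blast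
        have "t *\<^sub>C y = \<pi> i (t *\<^sub>C x)" using linear_scale[OF lin x(1)] x by simp
        then show ?thesis
          using gp[OF cvec.subspace_scale[OF sub[OF i] x(1)]] gp[OF x(1)] x linear_scale[OF fl x(1)] by simp
      qed
      ultimately show ?thesis by (simp add: linear_between_def)
    qed
  next
    fix e y assume e: "e \<in> q_arrows \<Gamma>" and y: "y \<in> rep_space N (arrow_tail \<Gamma> e)"
      and h: "arrow_head \<Gamma> e \<in> {c..d}"
    note tv = arrow_in_verts[OF e]
    obtain x where x: "x \<in> rep_space M (arrow_tail \<Gamma> e)" "y = \<pi> (arrow_tail \<Gamma> e) x"
      using onto[OF tv(1)] y by blast
    have "g (arrow_head \<Gamma> e) (rep_map N e y) = g (arrow_head \<Gamma> e) (\<pi> (arrow_head \<Gamma> e) (rep_map M e x))"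
      using is_hom_arrow[OF \<pi> e x(1)] x(2) by simp
    also have "\<dots> = f (arrow_head \<Gamma> e) (rep_map M e x)"
      by (rule g\<pi>[OF tv(2) h arrow_mem[OF M e x(1)]])
    also have "\<dots> = (if arrow_tail \<Gamma> e \<in> {c..d} then f (arrow_tail \<Gamma> e) x else 0)"
      by (rule covecD(2)[OF f e x(1) h])
    also have "\<dots> = (if arrow_tail \<Gamma> e \<in> {c..d} then g (arrow_tail \<Gamma> e) y else 0)"
      using g\<pi>[OF tv(1) _ x(1)] x(2) by simp
    finally show "g (arrow_head \<Gamma> e) (rep_map N e y) = (if arrow_tail \<Gamma> e \<in> {c..d} then g (arrow_tail \<Gamma> e) y else 0)" .
  qed
  then show ?thesis using that g\<pi> by blast
qed

definition sol_idx :: "(nat \<Rightarrow> nat) \<Rightarrow> nat \<Rightarrow> nat \<Rightarrow> (nat \<times> nat) set" where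
  "sol_idx dd C D = (SIGMA i:{C..D}. {..<dd i})"

definition sol_row :: "quiver \<Rightarrow> (nat \<Rightarrow> nat) \<Rightarrow> nat \<Rightarrow> nat \<Rightarrow> (nat \<times> nat) set" where
  "sol_row \<Gamma> dd C D = (SIGMA e:{e \<in> q_arrows \<Gamma>. arrow_head \<Gamma> e \<in> {C..D}}. {..<dd (arrow_tail \<Gamma> e)})"

text \<open>
  For a representation given by the point \<open>A\<close>, the families of functionals on it satisfying \<open>covec\<close>
  are the solutions of a homogeneous linear system in their values on the standard basis vectors. Its
  equations are indexed by the arrows with head in the interval and the columns of their matrices, and
  its coefficients are regular functions of \<open>A\<close>.
\<close>

definition sol_mat :: "quiver \<Rightarrow> rep_point \<Rightarrow> nat \<times> nat \<Rightarrow> nat \<times> nat \<Rightarrow> complex" where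
  "sol_mat \<Gamma> A \<rho> \<delta> = (if fst \<delta> = arrow_head \<Gamma> (fst \<rho>) then A (fst \<rho>, snd \<delta>, snd \<rho>) else 0)
      + (if fst \<delta> = arrow_tail \<Gamma> (fst \<rho>) \<and> snd \<delta> = snd \<rho> then - 1 else 0)"

definition sol :: "quiver \<Rightarrow> (nat \<Rightarrow> nat) \<Rightarrow> nat \<Rightarrow> nat \<Rightarrow> rep_point \<Rightarrow> (nat \<times> nat \<Rightarrow> complex) set" where
  "sol \<Gamma> dd C D A = {x. \<forall>\<rho>\<in>sol_row \<Gamma> dd C D. (\<Sum>\<delta>\<in>sol_idx dd C D. sol_mat \<Gamma> A \<rho> \<delta> * x \<delta>) = 0}"

lemma finite_sol: "finite (sol_idx dd C D)" "finite (sol_row \<Gamma> dd C D)"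
  by (auto simp: sol_idx_def sol_row_def q_arrows_def)

lemma sol_mat_regular: "regular_function (\<lambda>A. sol_mat \<Gamma> A \<rho> \<delta>)"
  unfolding sol_mat_def
  by (intro regular_function.add)
    (cases "fst \<delta> = arrow_head \<Gamma> (fst \<rho>)", auto intro: regular_function.intros)

lemma sol_row_sum:
  assumes h: "arrow_head \<Gamma> e \<in> {C..D}" and q: "q < dd (arrow_tail \<Gamma> e)"
  shows "(\<Sum>\<delta>\<in>sol_idx dd C D. sol_mat \<Gamma> A (e, q) \<delta> * x \<delta>)
    = (\<Sum>r<dd (arrow_head \<Gamma> e). A (e, r, q) * x (arrow_head \<Gamma> e, r))
      - (if arrow_tail \<Gamma> e \<in> {C..D} then x (arrow_tail \<Gamma> e, q) else 0)"
proof -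
  let ?t = "arrow_tail \<Gamma> e" and ?h = "arrow_head \<Gamma> e"
  have "(\<Sum>\<delta>\<in>sol_idx dd C D. sol_mat \<Gamma> A (e, q) \<delta> * x \<delta>)
      = (\<Sum>i\<in>{C..D}. \<Sum>r<dd i. sol_mat \<Gamma> A (e, q) (i, r) * x (i, r))"
    unfolding sol_idx_def by (subst sum.Sigma) auto
  also have "\<dots> = (\<Sum>i\<in>{C..D}. (if i = ?h then \<Sum>r<dd i. A (e, r, q) * x (i, r) else 0)
        + (if i = ?t then - x (i, q) else 0))"
  proof (rule sum.cong[OF refl])
    fix i
    have "(\<Sum>r<dd i. sol_mat \<Gamma> A (e, q) (i, r) * x (i, r))
      = (\<Sum>r<dd i. (if i = ?h then A (e, r, q) * x (i, r) else 0) + (if r = q then if i = ?t then - x (i, q) else 0 else 0))"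
      by (rule sum.cong) (auto simp: sol_mat_def algebra_simps)
    also have "\<dots> = (\<Sum>r<dd i. (if i = ?h then A (e, r, q) * x (i, r) else 0))
        + (\<Sum>r<dd i. (if r = q then if i = ?t then - x (i, q) else 0 else 0))"
      by (rule sum.distrib)
    also have "(\<Sum>r<dd i. (if r = q then if i = ?t then - x (i, q) else 0 else 0)) = (if i = ?t then - x (i, q) else 0)"
      using q by auto
    finally show "(\<Sum>r<dd i. sol_mat \<Gamma> A (e, q) (i, r) * x (i, r))
      = (if i = ?h then \<Sum>r<dd i. A (e, r, q) * x (i, r) else 0) + (if i = ?t then - x (i, q) else 0)"
      by simp
  qed
  also have "\<dots> = (\<Sum>r<dd ?h. A (e, r, q) * x (?h, r)) - (if ?t \<in> {C..D} then x (?t, q) else 0)"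
    unfolding sum.distrib using h by (simp add: sum.delta)
  finally show ?thesis .
qed

lemma sol_iff:
  "x \<in> sol \<Gamma> dd C D A \<longleftrightarrow> (\<forall>e\<in>q_arrows \<Gamma>. arrow_head \<Gamma> e \<in> {C..D} \<longrightarrow> (\<forall>q<dd (arrow_tail \<Gamma> e).
      (\<Sum>r<dd (arrow_head \<Gamma> e). A (e, r, q) * x (arrow_head \<Gamma> e, r))
      = (if arrow_tail \<Gamma> e \<in> {C..D} then x (arrow_tail \<Gamma> e, q) else 0)))"
proof -
  have "x \<in> sol \<Gamma> dd C D A \<longleftrightarrow> (\<forall>e\<in>q_arrows \<Gamma>. arrow_head \<Gamma> e \<in> {C..D} \<longrightarrow> (\<forall>q<dd (arrow_tail \<Gamma> e).
      (\<Sum>\<delta>\<in>sol_idx dd C D. sol_mat \<Gamma> A (e, q) \<delta> * x \<delta>) = 0))"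
    unfolding sol_def sol_row_def by auto
  then show ?thesis by (simp only: sol_row_sum eq_iff_diff_eq_0[symmetric] cong: imp_cong)
qed

lemma covec_to_sol:
  assumes A: "A \<in> rep_variety \<Gamma> dd" and g: "covec \<Gamma> (rep_of \<Gamma> dd A) C D g"
  shows "(\<lambda>\<delta>. g (fst \<delta>) (delta_seq (snd \<delta>))) \<in> sol \<Gamma> dd C D A"
  unfolding sol_iff
proof (intro ballI allI impI)
  fix e q assume e: "e \<in> q_arrows \<Gamma>" and h: "arrow_head \<Gamma> e \<in> {C..D}" and q: "q < dd (arrow_tail \<Gamma> e)"
  let ?t = "arrow_tail \<Gamma> e" and ?h = "arrow_head \<Gamma> e" and ?N = "rep_of \<Gamma> dd A"
  note tv = arrow_in_verts[OF e]
  have uq: "delta_seq q \<in> rep_space ?N ?t" unfolding rep_of_space by (rule delta_seq_mem[OF q])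
  have map: "rep_map ?N e (delta_seq q) = (\<lambda>r. A (e, r, q))"
  proof
    fix r
    have "rep_map ?N e (delta_seq q) r = (\<Sum>c<dd ?t. if c = q then A (e, r, q) else 0)"
      unfolding rep_of_map by (rule sum.cong) (auto simp: delta_seq_def)
    then show "rep_map ?N e (delta_seq q) r = A (e, r, q)" using q by simp
  qed
  have mem: "(\<lambda>r. A (e, r, q)) \<in> seq_space (dd ?h)"
    using arrow_mem[OF rep_of_is_rep[OF A] e uq] unfolding map rep_of_space .
  have "(\<Sum>r<dd ?h. A (e, r, q) * g ?h (delta_seq r)) = g ?h (\<Sum>r<dd ?h. A (e, r, q) *\<^sub>C delta_seq r)"
    using linear_sum[OF covecD(1)[OF g tv(2), unfolded rep_of_space] seq_space_subspace, of "{..<dd ?h}" delta_seq "\<lambda>r. A (e, r, q)"]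
    by (simp add: delta_seq_mem scaleC_complex_def)
  also have "\<dots> = g ?h (rep_map ?N e (delta_seq q))" unfolding map using seq_expand[OF mem] by simp
  also have "\<dots> = (if ?t \<in> {C..D} then g ?t (delta_seq q) else 0)" by (rule covecD(2)[OF g e uq h])
  finally show "(\<Sum>r<dd ?h. A (e, r, q) * g (fst (?h, r)) (delta_seq (snd (?h, r))))
      = (if ?t \<in> {C..D} then g (fst (?t, q)) (delta_seq (snd (?t, q))) else 0)" by simp
qed

lemma sol_to_covec:
  assumes x: "x \<in> sol \<Gamma> dd C D A"
  shows "covec \<Gamma> (rep_of \<Gamma> dd A) C D (\<lambda>i v. \<Sum>r<dd i. x (i, r) * v r)"
  unfolding covec_def
proof (intro conjI ballI impI)
  show "linear_between (rep_space (rep_of \<Gamma> dd A) i) UNIV (\<lambda>v. \<Sum>r<dd i. x (i, r) * v r)" for i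
    by (simp add: linear_between_def scaleC_fun_def scaleC_complex_def algebra_simps sum.distrib sum_distrib_left)
  fix e v assume e: "e \<in> q_arrows \<Gamma>" and v: "v \<in> rep_space (rep_of \<Gamma> dd A) (arrow_tail \<Gamma> e)"
    and h: "arrow_head \<Gamma> e \<in> {C..D}"
  let ?t = "arrow_tail \<Gamma> e" and ?h = "arrow_head \<Gamma> e"
  have "(\<Sum>r<dd ?h. x (?h, r) * rep_map (rep_of \<Gamma> dd A) e v r)
      = (\<Sum>r<dd ?h. \<Sum>q<dd ?t. A (e, r, q) * x (?h, r) * v q)"
    by (simp add: rep_of_map sum_distrib_left algebra_simps)
  also have "\<dots> = (\<Sum>q<dd ?t. \<Sum>r<dd ?h. A (e, r, q) * x (?h, r) * v q)" by (rule sum.swap)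
  also have "\<dots> = (\<Sum>q<dd ?t. (\<Sum>r<dd ?h. A (e, r, q) * x (?h, r)) * v q)" by (simp add: sum_distrib_right)
  also have "\<dots> = (\<Sum>q<dd ?t. (if ?t \<in> {C..D} then x (?t, q) else 0) * v q)"
    using x e h unfolding sol_iff by (intro sum.cong refl) auto
  also have "\<dots> = (if ?t \<in> {C..D} then \<Sum>q<dd ?t. x (?t, q) * v q else 0)"
    by (cases "?t \<in> {C..D}") (simp_all only: if_True if_False mult_zero_left sum.neutral_const)
  finally show "(\<Sum>r<dd ?h. x (?h, r) * rep_map (rep_of \<Gamma> dd A) e v r)
      = (if ?t \<in> {C..D} then \<Sum>q<dd ?t. x (?t, q) * v q else 0)" .
qed

definition indep_covecs :: "quiver \<Rightarrow> 'v::complex_vector rep \<Rightarrow> nat \<Rightarrow> nat \<Rightarrow> nat \<Rightarrow> (nat \<Rightarrow> nat \<Rightarrow> 'v \<Rightarrow> complex) \<Rightarrow> bool" where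
  "indep_covecs \<Gamma> M C D n f \<longleftrightarrow> (\<forall>j<n. covec \<Gamma> M C D (f j)) \<and>
     (\<forall>a. (\<forall>i\<in>q_verts \<Gamma>. i \<in> {C..D} \<longrightarrow> (\<forall>x\<in>rep_space M i. (\<Sum>j<n. a j * f j i x) = 0)) \<longrightarrow> (\<forall>j<n. a j = 0))"

lemma indep_covecs_quotient:
  assumes ex: "short_exact \<Gamma> L \<iota> M \<pi> (rep_of \<Gamma> dd A)" and A: "A \<in> rep_variety \<Gamma> dd"
    and CD: "{C..D} \<subseteq> q_verts \<Gamma>" and f: "indep_covecs \<Gamma> M C D n f"
    and van: "\<And>j i x. j < n \<Longrightarrow> i \<in> q_verts \<Gamma> \<Longrightarrow> i \<in> {C..D} \<Longrightarrow> x \<in> rep_space L i \<Longrightarrow> f j i (\<iota> i x) = 0"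
  shows "admits_indep n (sol_idx dd C D) (sol \<Gamma> dd C D A)"
proof -
  let ?N = "rep_of \<Gamma> dd A"
  have \<pi>: "is_hom \<Gamma> M ?N \<pi>" using ex by (auto simp: short_exact_def is_epi_def)
  have "\<forall>j\<in>{..<n}. \<exists>g. covec \<Gamma> ?N C D g \<and>
      (\<forall>i\<in>q_verts \<Gamma>. i \<in> {C..D} \<longrightarrow> (\<forall>x\<in>rep_space M i. g i (\<pi> i x) = f j i x))"
  proof
    fix j assume "j \<in> {..<n}"
    then have j: "j < n" by simp
    then have fj: "covec \<Gamma> M C D (f j)" using f by (simp add: indep_covecs_def)
    obtain g where "covec \<Gamma> ?N C D g"
      "\<And>i x. i \<in> q_verts \<Gamma> \<Longrightarrow> i \<in> {C..D} \<Longrightarrow> x \<in> rep_space M i \<Longrightarrow> g i (\<pi> i x) = f j i x"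
      using covec_descends[OF ex fj van[OF j]] by blast
    then show "\<exists>g. covec \<Gamma> ?N C D g \<and>
      (\<forall>i\<in>q_verts \<Gamma>. i \<in> {C..D} \<longrightarrow> (\<forall>x\<in>rep_space M i. g i (\<pi> i x) = f j i x))" by blast
  qed
  from bchoice[OF this] obtain g where g: "\<forall>j\<in>{..<n}. covec \<Gamma> ?N C D (g j) \<and>
      (\<forall>i\<in>q_verts \<Gamma>. i \<in> {C..D} \<longrightarrow> (\<forall>x\<in>rep_space M i. g j i (\<pi> i x) = f j i x))" ..
  show ?thesis
    unfolding admits_indep_def
  proof (intro exI[of _ "\<lambda>j \<delta>. g j (fst \<delta>) (delta_seq (snd \<delta>))"] conjI allI impI)
    fix j assume "j < n"
    then show "(\<lambda>\<delta>. g j (fst \<delta>) (delta_seq (snd \<delta>))) \<in> sol \<Gamma> dd C D A"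
      using covec_to_sol[OF A] g by simp
  next
    fix a j assume 0: "\<forall>\<delta>\<in>sol_idx dd C D. (\<Sum>j<n. a j * g j (fst \<delta>) (delta_seq (snd \<delta>))) = 0" and j: "j < n"
    have "(\<Sum>j<n. a j * f j i x) = 0" if i: "i \<in> q_verts \<Gamma>" "i \<in> {C..D}" and x: "x \<in> rep_space M i" for i x
    proof -
      define y where "y = \<pi> i x"
      have y: "y \<in> seq_space (dd i)"
        using hom_mem[OF \<pi> i(1) x] by (simp add: rep_of_space y_def)
      have gy: "g j i y = (\<Sum>r<dd i. y r * g j i (delta_seq r))" if "j < n" for j
      proof -
        have "covec \<Gamma> ?N C D (g j)" using g that by simp
        note lin = covecD(1)[OF this i(1), unfolded rep_of_space]
        have "g j i y = g j i (\<Sum>r<dd i. y r *\<^sub>C delta_seq r)" using seq_expand[OF y] by simp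
        also have "\<dots> = (\<Sum>r<dd i. y r *\<^sub>C g j i (delta_seq r))"
          by (rule linear_sum[OF lin seq_space_subspace]) (simp add: delta_seq_mem)
        finally show ?thesis by (simp add: scaleC_complex_def)
      qed
      have "(\<Sum>j<n. a j * f j i x) = (\<Sum>j<n. a j * g j i y)"
        using g i x unfolding y_def by (intro sum.cong refl) auto
      also have "\<dots> = (\<Sum>j<n. \<Sum>r<dd i. y r * (a j * g j i (delta_seq r)))"
        using gy by (intro sum.cong refl) (simp add: sum_distrib_left algebra_simps)
      also have "\<dots> = (\<Sum>r<dd i. \<Sum>j<n. y r * (a j * g j i (delta_seq r)))" by (rule sum.swap)
      also have "\<dots> = (\<Sum>r<dd i. y r * (\<Sum>j<n. a j * g j i (delta_seq r)))" by (simp add: sum_distrib_left)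
      also have "\<dots> = 0"
      proof (intro sum.neutral ballI)
        fix r assume "r \<in> {..<dd i}"
        then have "(i, r) \<in> sol_idx dd C D" using i by (simp add: sol_idx_def)
        from bspec[OF 0 this] show "y r * (\<Sum>j<n. a j * g j i (delta_seq r)) = 0" by simp
      qed
      finally show ?thesis .
    qed
    then show "a j = 0" using f j unfolding indep_covecs_def by blast
  qed
qed

lemma is_iso_short_exact:
  assumes ex: "short_exact \<Gamma> L \<iota> M \<pi> N" and iso: "is_iso \<Gamma> N N' h" and N': "is_rep \<Gamma> N'"
  shows "short_exact \<Gamma> L \<iota> M (\<lambda>i x. h i (\<pi> i x)) N'"
proof -
  have N: "is_rep \<Gamma> N" and M: "is_rep \<Gamma> M" and \<pi>: "is_hom \<Gamma> M N \<pi>"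
    and onto: "\<And>i. i \<in> q_verts \<Gamma> \<Longrightarrow> \<pi> i ` rep_space M i = rep_space N i"
    and ker: "\<And>i. i \<in> q_verts \<Gamma> \<Longrightarrow> \<iota> i ` rep_space L i = {x \<in> rep_space M i. \<pi> i x = 0}"
    and L: "is_rep \<Gamma> L" "is_mono \<Gamma> L M \<iota>"
    using ex by (auto simp: short_exact_def is_epi_def)
  have h: "is_hom \<Gamma> N N' h" and bij: "\<And>i. i \<in> q_verts \<Gamma> \<Longrightarrow> bij_betw (h i) (rep_space N i) (rep_space N' i)"
    using iso by (auto simp: is_iso_def)
  have "(\<lambda>x. h i (\<pi> i x)) ` rep_space M i = rep_space N' i" if i: "i \<in> q_verts \<Gamma>" for i
    using bij[OF i] onto[OF i] by (simp add: bij_betw_def image_image[symmetric])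
  then have "is_epi \<Gamma> M N' (\<lambda>i x. h i (\<pi> i x))"
    using is_hom_comp[OF \<pi> h] by (simp add: is_epi_def)
  moreover have "\<iota> i ` rep_space L i = {x \<in> rep_space M i. h i (\<pi> i x) = 0}" if i: "i \<in> q_verts \<Gamma>" for i
  proof -
    have "h i y = 0 \<longleftrightarrow> y = 0" if y: "y \<in> rep_space N i" for y
    proof -
      have h0: "h i 0 = 0" by (rule hom_zero[OF h i is_rep_space(2)[OF N i]])
      have "inj_on (h i) (rep_space N i)" using bij[OF i] by (simp add: bij_betw_def)
      from inj_onD[OF this _ y cvec.subspace_0[OF is_rep_space(2)[OF N i]]] h0 show ?thesis by auto
    qed
    then have "{x \<in> rep_space M i. h i (\<pi> i x) = 0} = {x \<in> rep_space M i. \<pi> i x = 0}"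
      using hom_mem[OF \<pi> i] by blast
    then show ?thesis using ker[OF i] by simp
  qed
  ultimately show ?thesis using L M N' unfolding short_exact_def by blast
qed

text \<open>
  Suppose that all such families on \<open>M\<close> vanish on \<open>\<iota>\<close>. Then they descend to all points in the orbit
  of the generic quotient. By semicontinuity \<open>n\<close> independent ones give \<open>n\<close> independent ones on
  the quotient by \<open>\<iota>'\<close>. Pulled back to \<open>M\<close> these vanish on \<open>\<iota>'\<close>, so together with \<open>f0\<close> there are
  \<open>n + 1\<close> independent ones on \<open>M\<close>. So there are arbitrarily many, but the linear system for
  the generic quotient has only finitely many unknowns.
\<close>

lemma generic_detects:
  fixes M :: "'v::complex_vector rep" and L :: "'u::complex_vector rep"
  assumes gen: "generic_embedding \<Gamma> L M \<iota>" and M: "is_rep \<Gamma> M" and L: "is_rep \<Gamma> L"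
    and CD: "{C..D} \<subseteq> q_verts \<Gamma>"
    and mono: "is_mono \<Gamma> L M \<iota>'" and f0: "covec \<Gamma> M C D f0"
    and m: "m \<in> {C..D}" "y0 \<in> rep_space L m" "f0 m (\<iota>' m y0) \<noteq> 0"
  obtains f i x where "covec \<Gamma> M C D f" "i \<in> {C..D}" "x \<in> rep_space L i" "f i (\<iota> i x) \<noteq> 0"
proof -
  let ?dd = "dim_diff M L"
  obtain A \<pi> where A: "generic_quotient \<Gamma> L M A" and ex: "short_exact \<Gamma> L \<iota> M \<pi> (rep_of \<Gamma> ?dd A)"
    using gen by (auto simp: generic_embedding_def)
  obtain A' \<pi>' where A': "A' \<in> rep_variety \<Gamma> ?dd" and ex': "short_exact \<Gamma> L \<iota>' M \<pi>' (rep_of \<Gamma> ?dd A')"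
    by (rule mono_has_quotient[OF L M mono])
  have "A' \<in> quot_set \<Gamma> L M" using A' ex' by (auto simp: quot_set_def)
  then have cl: "A' \<in> zariski_closure (base_change_orbit \<Gamma> ?dd A)"
    using A by (auto simp: generic_quotient_def zariski_dense_in_def)
  have \<pi>': "is_hom \<Gamma> M (rep_of \<Gamma> ?dd A') \<pi>'"
    and onto': "\<And>i. i \<in> q_verts \<Gamma> \<Longrightarrow> \<pi>' i ` rep_space M i = seq_space (?dd i)"
    and ker': "\<And>i. i \<in> q_verts \<Gamma> \<Longrightarrow> \<iota>' i ` rep_space L i = {x \<in> rep_space M i. \<pi>' i x = 0}"
    using ex' by (auto simp: short_exact_def is_epi_def rep_of_space)
  have mv: "m \<in> q_verts \<Gamma>" using m(1) CD by blast
  have "\<exists>f i x. covec \<Gamma> M C D f \<and> i \<in> {C..D} \<and> x \<in> rep_space L i \<and> f i (\<iota> i x) \<noteq> 0"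
  proof (rule ccontr)
    assume contra: "\<not> ?thesis"
    then have van: "f i (\<iota> i x) = 0" if "covec \<Gamma> M C D f" "i \<in> {C..D}" "x \<in> rep_space L i" for f i x
      using that by blast
    have sol_orbit: "admits_indep n (sol_idx ?dd C D) (sol \<Gamma> ?dd C D A'')"
      if f: "indep_covecs \<Gamma> M C D n f" and A'': "A'' \<in> base_change_orbit \<Gamma> ?dd A" for n f A''
    proof -
      obtain h where h: "is_iso \<Gamma> (rep_of \<Gamma> ?dd A) (rep_of \<Gamma> ?dd A'') h" and v: "A'' \<in> rep_variety \<Gamma> ?dd"
        using A'' by (auto simp: base_change_orbit_def)
      show ?thesis
        by (rule indep_covecs_quotient[OF is_iso_short_exact[OF ex h rep_of_is_rep[OF v]] v CD f])
          (use van f in \<open>auto simp: indep_covecs_def\<close>)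
    qed
    \<comment> \<open>In the step, \<open>n\<close> members come from the quotient by \<open>\<iota>'\<close>, and \<open>f0\<close> is the last one.\<close>
    have "\<exists>f. indep_covecs \<Gamma> M C D n f" for n
    proof (induction n)
      case 0
      show ?case by (simp add: indep_covecs_def)
    next
      case (Suc n)
      then obtain f where f: "indep_covecs \<Gamma> M C D n f" by blast
      have "admits_indep n (sol_idx ?dd C D) (sol \<Gamma> ?dd C D A')"
        unfolding sol_def
        by (rule kernel_dim_semicontinuous[OF finite_sol sol_mat_regular _ cl])
          (rule sol_orbit[OF f, unfolded sol_def])
      then obtain x where x: "\<And>j. j < n \<Longrightarrow> x j \<in> sol \<Gamma> ?dd C D A'"
        "\<And>a. (\<forall>\<delta>\<in>sol_idx ?dd C D. (\<Sum>j<n. a j * x j \<delta>) = 0) \<Longrightarrow> (\<forall>j<n. a j = 0)"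
        unfolding admits_indep_def by blast
      define g where "g j i v = (\<Sum>r<?dd i. x j (i, r) * v r)" for j i and v :: "nat \<Rightarrow> complex"
      define F where "F j = (if j < n then (\<lambda>i y. g j i (\<pi>' i y)) else f0)" for j
      have "covec \<Gamma> M C D (F j)" if "j < Suc n" for j
        using covec_pullback[OF \<pi>' sol_to_covec[OF x(1)], of j] f0 unfolding F_def g_def by auto
      moreover have "\<forall>j<Suc n. a j = 0"
        if 0: "\<forall>i\<in>q_verts \<Gamma>. i \<in> {C..D} \<longrightarrow> (\<forall>y\<in>rep_space M i. (\<Sum>j<Suc n. a j * F j i y) = 0)" for a
      proof -
        have split: "(\<Sum>j<Suc n. a j * F j i y) = (\<Sum>j<n. a j * g j i (\<pi>' i y)) + a n * f0 i y" for i y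
          by (simp add: F_def)
        have \<iota>y: "\<iota>' m y0 \<in> {x \<in> rep_space M m. \<pi>' m x = 0}" using ker'[OF mv] m(2) by blast
        then have "(\<Sum>j<n. a j * g j m (\<pi>' m (\<iota>' m y0))) = 0" by (simp add: g_def)
        then have "a n * f0 m (\<iota>' m y0) = 0"
          using 0 mv m(1) \<iota>y split[of m "\<iota>' m y0"] by auto
        then have an: "a n = 0" using m(3) by simp
        have "(\<Sum>j<n. a j * x j \<delta>) = 0" if \<delta>: "\<delta> \<in> sol_idx ?dd C D" for \<delta>
        proof -
          obtain i r where ir: "\<delta> = (i, r)" "i \<in> {C..D}" "r < ?dd i" using \<delta> by (auto simp: sol_idx_def)
          have iv: "i \<in> q_verts \<Gamma>" using ir CD by blast
          have "delta_seq r \<in> \<pi>' i ` rep_space M i" using onto'[OF iv] delta_seq_mem[OF ir(3)] by simp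
          then obtain y where y: "y \<in> rep_space M i" "\<pi>' i y = delta_seq r" by auto
          have gu: "g j i (delta_seq r) = x j (i, r)" for j
          proof -
            have "g j i (delta_seq r) = (\<Sum>s<?dd i. if s = r then x j (i, r) else 0)"
              unfolding g_def by (rule sum.cong) (auto simp: delta_seq_def)
            then show ?thesis using ir(3) by simp
          qed
          have "(\<Sum>j<n. a j * g j i (\<pi>' i y)) = 0"
            using 0 iv ir(2) y(1) split[of i y] an by auto
          then show ?thesis using y(2) gu ir(1) by simp
        qed
        then have "\<forall>j<n. a j = 0" using x(2) by blast
        then show ?thesis using an by (simp add: less_Suc_eq)
      qed
      ultimately show ?case unfolding indep_covecs_def by blast
    qed
    then obtain f where f: "indep_covecs \<Gamma> M C D (Suc (card (sol_idx ?dd C D))) f" by blast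
    have "A \<in> base_change_orbit \<Gamma> ?dd A"
      using A is_iso_id by (auto simp: generic_quotient_def quot_set_def base_change_orbit_def)
    from admits_indep_le_card[OF finite_sol(1) sol_orbit[OF f this]] show False by simp
  qed
  then show ?thesis using that by blast
qed

context string_rep
begin

text \<open>
  Otherwise all homomorphisms from \<open>M\<close> to the string \<open>k\<close> vanish on \<open>\<iota>\<close>. Adding to \<open>\<iota>\<close> the component
  of \<open>u\<close> in that string gives an embedding on which the coordinate functionals of the string do not
  vanish, contrary to \<open>generic_detects\<close>.
\<close>

lemma generic_reaches:
  assumes thin: "thin_rep \<Gamma> L a z l" and gen: "generic_embedding \<Gamma> L M \<iota>"
    and m: "m \<in> {a..z}" and k: "k \<in> through I c d m"
    and u: "is_hom \<Gamma> L M u" and nz: "cf k m (u m (l m)) \<noteq> 0"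
  obtains \<phi> where "is_hom \<Gamma> M M \<phi>" "cf k m (\<phi> m (\<iota> m (l m))) \<noteq> 0"
proof -
  interpret thin_rep \<Gamma> L a z l by fact
  have \<iota>: "is_hom \<Gamma> L M \<iota>" and inj: "\<And>i. i \<in> q_verts \<Gamma> \<Longrightarrow> inj_on (\<iota> i) (rep_space L i)"
    using gen by (auto simp: generic_embedding_def is_mono_def)
  have kI: "k \<in> I" and mk: "m \<in> {c k..d k}" using k by (auto simp: through_def)
  have mv: "m \<in> q_verts \<Gamma>" using az_vert[OF m] .
  have CD: "{c k..d k} \<subseteq> q_verts \<Gamma>" using string_basisD(2)[OF strings kI] by (auto simp: q_verts_def)
  have \<iota>m: "\<iota> m (l m) \<in> rep_space M m" using hom_mem[OF \<iota> mv l_mem[OF mv]] .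
  have "\<exists>\<phi>. is_hom \<Gamma> M M \<phi> \<and> cf k m (\<phi> m (\<iota> m (l m))) \<noteq> 0"
  proof (rule ccontr)
    assume contra: "\<not> ?thesis"
    have van: "f i (\<iota> i x) = 0"
      if f: "covec \<Gamma> M (c k) (d k) f" and i: "i \<in> {c k..d k}" and x: "x \<in> rep_space L i" for f i x
    proof -
      have iv: "i \<in> q_verts \<Gamma>" using i CD by blast
      have hom: "is_hom \<Gamma> M M (through_string (c k) (d k) f (b k))"
        by (rule through_string_is_hom[OF f b_stringvec[OF kI] rep rep])
      have "cf k m (through_string (c k) (d k) f (b k) m (\<iota> m (l m))) = f m (\<iota> m (l m))"
        using mk cf_scale[OF mv b_mem[OF kI mv]] cf_b[OF mv k, of k] by (simp add: through_string_def)
      then have fm: "f m (\<iota> m (l m)) = 0" using contra hom by auto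
      have fl: "f i (\<iota> i (l i)) = 0"
      proof (cases "i \<in> {a..z}")
        case True
        have "f i (\<iota> i (l i)) = f m (\<iota> m (l m))"
          by (rule covec_stringvec_const[OF f hom_stringvec[OF \<iota>]]) (use True i iv m mk mv in auto)
        then show ?thesis using fm by simp
      next
        case False
        then have "\<iota> i (l i) = 0"
          using l_out[OF False] hom_zero[OF \<iota> iv L_sub[OF iv]] by simp
        then show ?thesis using linear_zero[OF covecD(1)[OF f iv] sub[OF iv]] by simp
      qed
      obtain t where t: "x = t *\<^sub>C l i" by (rule spaceE[OF iv x])
      have "\<iota> i x = t *\<^sub>C \<iota> i (l i)"
        unfolding t by (rule hom_scale[OF \<iota> iv l_mem[OF iv]])
      then show ?thesis
        using fl linear_scale[OF covecD(1)[OF f iv], of "\<iota> i (l i)" t]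
          hom_mem[OF \<iota> iv l_mem[OF iv]] by (simp add: scaleC_complex_def)
    qed
    define \<iota>' where "\<iota>' i x = \<iota> i x + 1 *\<^sub>C proj k i (u i x)" for i x
    have hom': "is_hom \<Gamma> L M \<iota>'"
      unfolding \<iota>'_def by (rule is_hom_lincomb[OF \<iota> is_hom_comp[OF u proj_hom[OF kI]] rep])
    have cf': "cf k i (\<iota>' i x) = cf k i (u i x)"
      if iv: "i \<in> q_verts \<Gamma>" and x: "x \<in> rep_space L i" for i x
    proof (cases "i \<in> {c k..d k}")
      case False
      then show ?thesis using cf_outside by simp
    next
      case True
      have kt: "k \<in> through I c d i" using True kI by (simp add: through_def)
      have "cf k i (\<iota>' i x) = cf k i (\<iota> i x) + cf k i (proj k i (u i x))"
        unfolding \<iota>'_def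
        using cf_add[OF iv hom_mem[OF \<iota> iv x]
            hom_mem[OF proj_hom[OF kI] iv hom_mem[OF u iv x]]]
        by simp
      also have "cf k i (\<iota> i x) = 0" by (rule van[OF cf_covec[OF kI] True x])
      also have "cf k i (proj k i (u i x)) = cf k i (u i x)"
        unfolding proj_eq using cf_scale[OF iv b_mem[OF kI iv]] cf_b[OF iv kt, of k] by simp
      finally show ?thesis by simp
    qed
    have "inj_on (\<iota>' i) (rep_space L i)" if iv: "i \<in> q_verts \<Gamma>" for i
    proof (rule inj_onI)
      fix x y assume x: "x \<in> rep_space L i" and y: "y \<in> rep_space L i" and eq: "\<iota>' i x = \<iota>' i y"
      note S = L_sub[OF iv]
      have w: "x - y \<in> rep_space L i" using cvec.subspace_diff[OF S x y] .
      have 0: "\<iota>' i (x - y) = 0" using hom_diff[OF hom' iv S x y] eq by simp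
      then have "cf k i (u i (x - y)) = 0" using cf'[OF iv w] cf_zero[OF iv] by simp
      then have "\<iota> i (x - y) = 0" using 0 unfolding \<iota>'_def proj_eq by simp
      then have "\<iota> i (x - y) = \<iota> i 0" using hom_zero[OF \<iota> iv S] by simp
      then have "x - y = 0" using inj_onD[OF inj[OF iv] _ w cvec.subspace_0[OF S]] by blast
      then show "x = y" by simp
    qed
    then have mono: "is_mono \<Gamma> L M \<iota>'" using hom' by (simp add: is_mono_def)
    have nz': "cf k m (\<iota>' m (l m)) \<noteq> 0" using cf'[OF mv l_mem[OF mv]] nz by simp
    obtain f i x where "covec \<Gamma> M (c k) (d k) f" "i \<in> {c k..d k}" "x \<in> rep_space L i" "f i (\<iota> i x) \<noteq> 0"
      by (rule generic_detects[OF gen rep L_rep CD mono cf_covec[OF kI] mk l_mem[OF mv] nz'])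
    then show False using van by blast
  qed
  then show ?thesis using that by blast
qed

end

section \<open>Extensions and lifts\<close>

lemma is_iso_inverse:
  assumes iso: "is_iso \<Gamma> M N g" and M: "is_rep \<Gamma> M"
  shows "is_iso \<Gamma> N M (\<lambda>i. inv_into (rep_space M i) (g i))"
proof -
  let ?k = "\<lambda>i. inv_into (rep_space M i) (g i)"
  have gh: "is_hom \<Gamma> M N g" and bij: "\<And>i. i \<in> q_verts \<Gamma> \<Longrightarrow> bij_betw (g i) (rep_space M i) (rep_space N i)"
    using iso by (auto simp: is_iso_def)
  have kb: "bij_betw (?k i) (rep_space N i) (rep_space M i)" if "i \<in> q_verts \<Gamma>" for i
    by (rule bij_betw_inv_into[OF bij[OF that]])
  have km: "?k i x \<in> rep_space M i" and gk: "g i (?k i x) = x" if "i \<in> q_verts \<Gamma>" "x \<in> rep_space N i" for i x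
    using bij_betw_apply[OF kb that(2)] bij_betw_inv_into_right[OF bij that(2)] that(1) by auto
  have kg: "?k i (g i x) = x" if "i \<in> q_verts \<Gamma>" "x \<in> rep_space M i" for i x
    by (rule bij_betw_inv_into_left[OF bij[OF that(1)] that(2)])
  have sub: "cvec.subspace (rep_space M i)" if "i \<in> q_verts \<Gamma>" for i by (rule is_rep_space(2)[OF M that])
  have "is_hom \<Gamma> N M ?k"
    unfolding is_hom_def
  proof (intro conjI ballI)
    fix i assume i: "i \<in> q_verts \<Gamma>"
    have "?k i (x + y) = ?k i x + ?k i y" if x: "x \<in> rep_space N i" and y: "y \<in> rep_space N i" for x y
      using kg[OF i cvec.subspace_add[OF sub[OF i] km[OF i x] km[OF i y]]]
        hom_add[OF gh i km[OF i x] km[OF i y]] gk[OF i x] gk[OF i y] by simp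
    moreover have "?k i (t *\<^sub>C x) = t *\<^sub>C ?k i x" if x: "x \<in> rep_space N i" for t x
      using kg[OF i cvec.subspace_scale[OF sub[OF i] km[OF i x]], of t]
        hom_scale[OF gh i km[OF i x]] gk[OF i x] by simp
    ultimately show "linear_between (rep_space N i) (rep_space M i) (?k i)"
      unfolding linear_between_def using km[OF i] by blast
  next
    fix e x assume e: "e \<in> q_arrows \<Gamma>" and x: "x \<in> rep_space N (arrow_tail \<Gamma> e)"
    note tv = arrow_in_verts[OF e]
    note kx = km[OF tv(1) x]
    have "g (arrow_head \<Gamma> e) (rep_map M e (?k (arrow_tail \<Gamma> e) x)) = rep_map N e x"
      using is_hom_arrow[OF gh e kx] gk[OF tv(1) x] by simp
    then show "?k (arrow_head \<Gamma> e) (rep_map N e x) = rep_map M e (?k (arrow_tail \<Gamma> e) x)"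
      using kg[OF tv(2) arrow_mem[OF M e kx]] by simp
  qed
  then show ?thesis using kb by (simp add: is_iso_def)
qed

text \<open>
  Automorphisms of \<open>M\<close> do not change the quotient by an embedded \<open>L\<close>; more generally the middle term
  of an extension may be replaced by an isomorphic copy.
\<close>

lemma short_exact_transport:
  assumes ex: "short_exact \<Gamma> L \<iota> M \<pi> N" and iso: "is_iso \<Gamma> M M' g" and M': "is_rep \<Gamma> M'"
  shows "short_exact \<Gamma> L (\<lambda>i. g i \<circ> \<iota> i) M' (\<lambda>i x. \<pi> i (inv_into (rep_space M i) (g i) x)) N"
proof -
  let ?k = "\<lambda>i. inv_into (rep_space M i) (g i)"
  have L: "is_rep \<Gamma> L" and M: "is_rep \<Gamma> M" and N: "is_rep \<Gamma> N"
    and \<iota>: "is_hom \<Gamma> L M \<iota>" and inj: "\<And>i. i \<in> q_verts \<Gamma> \<Longrightarrow> inj_on (\<iota> i) (rep_space L i)"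
    and \<pi>: "is_hom \<Gamma> M N \<pi>" and onto: "\<And>i. i \<in> q_verts \<Gamma> \<Longrightarrow> \<pi> i ` rep_space M i = rep_space N i"
    and ker: "\<And>i. i \<in> q_verts \<Gamma> \<Longrightarrow> \<iota> i ` rep_space L i = {x \<in> rep_space M i. \<pi> i x = 0}"
    using ex by (auto simp: short_exact_def is_mono_def is_epi_def)
  have gh: "is_hom \<Gamma> M M' g" and bij: "\<And>i. i \<in> q_verts \<Gamma> \<Longrightarrow> bij_betw (g i) (rep_space M i) (rep_space M' i)"
    using iso by (auto simp: is_iso_def)
  have kh: "is_hom \<Gamma> M' M ?k" and kb: "\<And>i. i \<in> q_verts \<Gamma> \<Longrightarrow> bij_betw (?k i) (rep_space M' i) (rep_space M i)"
    using is_iso_inverse[OF iso M] by (auto simp: is_iso_def)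
  have "is_mono \<Gamma> L M' (\<lambda>i. g i \<circ> \<iota> i)"
    unfolding is_mono_def
  proof (intro conjI ballI)
    show "is_hom \<Gamma> L M' (\<lambda>i. g i \<circ> \<iota> i)" using is_hom_comp[OF \<iota> gh] by (simp add: comp_def)
    fix i assume i: "i \<in> q_verts \<Gamma>"
    have "inj_on (g i) (\<iota> i ` rep_space L i)"
      using bij[OF i] is_hom_lin[OF \<iota> i] by (auto simp: bij_betw_def linear_between_def intro: inj_on_subset)
    then show "inj_on (g i \<circ> \<iota> i) (rep_space L i)" by (rule comp_inj_on[OF inj[OF i]])
  qed
  moreover have "(\<lambda>x. \<pi> i (?k i x)) ` rep_space M' i = rep_space N i" if i: "i \<in> q_verts \<Gamma>" for i
    using kb[OF i] onto[OF i] by (simp add: bij_betw_def image_image[symmetric])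
  then have "is_epi \<Gamma> M' N (\<lambda>i x. \<pi> i (?k i x))"
    using is_hom_comp[OF kh \<pi>] by (simp add: is_epi_def)
  moreover have "(g i \<circ> \<iota> i) ` rep_space L i = {x \<in> rep_space M' i. \<pi> i (?k i x) = 0}" if i: "i \<in> q_verts \<Gamma>" for i
  proof -
    have "(g i \<circ> \<iota> i) ` rep_space L i = g i ` {x \<in> rep_space M i. \<pi> i x = 0}"
      unfolding image_comp[symmetric] ker[OF i] ..
    also have "\<dots> = {x \<in> rep_space M' i. \<pi> i (?k i x) = 0}"
    proof (intro equalityI subsetI)
      fix y assume "y \<in> g i ` {x \<in> rep_space M i. \<pi> i x = 0}"
      then show "y \<in> {x \<in> rep_space M' i. \<pi> i (?k i x) = 0}"
        using bij_betw_inv_into_left[OF bij[OF i]] bij_betw_apply[OF bij[OF i]] by auto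
    next
      fix y assume y: "y \<in> {x \<in> rep_space M' i. \<pi> i (?k i x) = 0}"
      then have "y = g i (?k i y)" "?k i y \<in> {x \<in> rep_space M i. \<pi> i x = 0}"
        using bij_betw_inv_into_right[OF bij[OF i]] bij_betw_apply[OF kb[OF i]] by auto
      then show "y \<in> g i ` {x \<in> rep_space M i. \<pi> i x = 0}" by (rule image_eqI)
    qed
    finally show ?thesis .
  qed
  ultimately show ?thesis unfolding short_exact_def using L M' N by blast
qed

lemma fin_dim_image:
  assumes S: "fin_dim_subspace S" and f: "linear_between S T f"
  shows "fin_dim_subspace (f ` S)"
proof -
  have S': "cvec.subspace S" using fin_dim_imp_subspace[OF S] .
  obtain J :: "nat set" and v where J: "is_basis J v S" using basis_exists_nat[OF S, of "{}"] by auto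
  have "f ` S \<subseteq> cvec.span ((\<lambda>j. f (v j)) ` J)"
  proof
    fix y assume "y \<in> f ` S"
    then obtain x where x: "x \<in> S" "y = f x" by blast
    have "y = f (\<Sum>j\<in>J. coord J v x j *\<^sub>C v j)" using coord_sum[OF J x(1)] x(2) by simp
    also have "\<dots> = (\<Sum>j\<in>J. coord J v x j *\<^sub>C f (v j))"
      by (rule linear_sum[OF f S' is_basis_mem[OF J]])
    also have "\<dots> \<in> cvec.span ((\<lambda>j. f (v j)) ` J)"
      by (intro cvec.span_sum cvec.span_scale cvec.span_base) auto
    finally show "y \<in> cvec.span ((\<lambda>j. f (v j)) ` J)" .
  qed
  moreover have "fin_dim_subspace (cvec.span ((\<lambda>j. f (v j)) ` J))"
    unfolding fin_dim_subspace_def using is_basis_finite[OF J] by blast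
  ultimately show ?thesis using fin_dim_subspace_subset linear_image[OF f S'] by blast
qed

lemma ambient_embedding:
  fixes S :: "'v::complex_vector set"
  assumes S: "fin_dim_subspace S"
  obtains f :: "'v \<Rightarrow> nat \<Rightarrow> complex" where "linear_between S UNIV f" "inj_on f S"
proof -
  have S': "cvec.subspace S" using fin_dim_imp_subspace[OF S] .
  obtain J :: "nat set" and v where J: "is_basis J v S" using basis_exists_nat[OF S, of "{}"] by auto
  have "linear_between S UNIV (coord J v)"
    unfolding linear_between_def
    using coord_add[OF J S'] coord_scale[OF J S']
    by (auto simp: fun_eq_iff scaleC_fun_def scaleC_complex_def)
  moreover have "inj_on (coord J v) S"
    by (rule inj_onI) (metis coord_sum[OF J])
  ultimately show ?thesis by (rule that)
qed

text \<open>
  The definition of \<open>ext1_vanishes\<close> refers to extensions inside one ambient space; this lemma makes it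
  applicable to all extensions.
\<close>

lemma ambient_copy:
  fixes E :: "'e::complex_vector rep"
  assumes E: "is_rep \<Gamma> E"
  obtains E' :: "(nat \<Rightarrow> complex) rep" and c where "is_rep \<Gamma> E'" "is_iso \<Gamma> E E' c"
proof -
  have "\<forall>i\<in>q_verts \<Gamma>. \<exists>f :: 'e \<Rightarrow> nat \<Rightarrow> complex. linear_between (rep_space E i) UNIV f \<and> inj_on f (rep_space E i)"
    using ambient_embedding[OF is_rep_space(1)[OF E]] by metis
  from bchoice[OF this] obtain c :: "nat \<Rightarrow> 'e \<Rightarrow> nat \<Rightarrow> complex" where
    c: "\<forall>i\<in>q_verts \<Gamma>. linear_between (rep_space E i) UNIV (c i) \<and> inj_on (c i) (rep_space E i)" ..
  define E' :: "(nat \<Rightarrow> complex) rep" where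
    "E' = \<lparr>rep_space = (\<lambda>i. c i ` rep_space E i), rep_map = (\<lambda>e y.
        c (arrow_head \<Gamma> e) (rep_map E e (inv_into (rep_space E (arrow_tail \<Gamma> e)) (c (arrow_tail \<Gamma> e)) y)))\<rparr>"
  have lin: "linear_between (rep_space E i) (rep_space E' i) (c i)" if "i \<in> q_verts \<Gamma>" for i
    using c that by (auto simp: linear_between_def E'_def)
  have map: "rep_map E' e (c (arrow_tail \<Gamma> e) x) = c (arrow_head \<Gamma> e) (rep_map E e x)"
    if "e \<in> q_arrows \<Gamma>" "x \<in> rep_space E (arrow_tail \<Gamma> e)" for e x
    using c arrow_in_verts(1)[OF that(1)] that(2) by (simp add: E'_def)
  have E'S: "rep_space E' i = c i ` rep_space E i" for i by (simp add: E'_def)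
  have "is_rep \<Gamma> E'"
    unfolding is_rep_def
  proof (intro conjI ballI)
    fix i assume i: "i \<in> q_verts \<Gamma>"
    show "fin_dim_subspace (rep_space E' i)" unfolding E'S by (rule fin_dim_image[OF is_rep_space(1)[OF E i] lin[OF i]])
  next
    fix e assume e: "e \<in> q_arrows \<Gamma>"
    note tv = arrow_in_verts[OF e]
    let ?t = "arrow_tail \<Gamma> e"
    have S: "cvec.subspace (rep_space E ?t)" by (rule is_rep_space(2)[OF E tv(1)])
    note ce = linear_comp[OF is_rep_map[OF E e] lin[OF tv(2)]]
    have "rep_map E' e (c ?t x + c ?t y) = rep_map E' e (c ?t x) + rep_map E' e (c ?t y)"
      if x: "x \<in> rep_space E ?t" and y: "y \<in> rep_space E ?t" for x y
      using map[OF e cvec.subspace_add[OF S x y]] map[OF e x] map[OF e y]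
        linear_add[OF lin[OF tv(1)] x y] linear_add[OF ce x y] by simp
    moreover have "rep_map E' e (t *\<^sub>C c ?t x) = t *\<^sub>C rep_map E' e (c ?t x)" if x: "x \<in> rep_space E ?t" for t x
      using map[OF e cvec.subspace_scale[OF S x], of t] map[OF e x]
        linear_scale[OF lin[OF tv(1)] x] linear_scale[OF ce x] by simp
    moreover have "rep_map E' e (c ?t x) \<in> rep_space E' (arrow_head \<Gamma> e)" if x: "x \<in> rep_space E ?t" for x
      using map[OF e x] linear_mem[OF ce x] by simp
    ultimately show "linear_between (rep_space E' ?t) (rep_space E' (arrow_head \<Gamma> e)) (rep_map E' e)"
      unfolding linear_between_def E'S[of ?t] by auto
  qed
  moreover have "is_iso \<Gamma> E E' c"
    unfolding is_iso_def is_hom_def using lin map c by (auto simp: bij_betw_def E'S)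
  ultimately show ?thesis by (rule that)
qed

lemma ext1_vanishes_splits:
  assumes ext: "ext1_vanishes \<Gamma> L N" and ex: "short_exact \<Gamma> N f E g L"
  obtains s where "is_hom \<Gamma> L E s" "\<And>i x. i \<in> q_verts \<Gamma> \<Longrightarrow> x \<in> rep_space L i \<Longrightarrow> g i (s i x) = x"
proof -
  have E: "is_rep \<Gamma> E" using ex by (simp add: short_exact_def)
  obtain E' :: "(nat \<Rightarrow> complex) rep" and c where E': "is_rep \<Gamma> E'" "is_iso \<Gamma> E E' c"
    by (rule ambient_copy[OF E])
  let ?k = "\<lambda>i. inv_into (rep_space E i) (c i)"
  obtain s where s: "is_hom \<Gamma> L E' s" "\<forall>i\<in>q_verts \<Gamma>. \<forall>x\<in>rep_space L i. g i (?k i (s i x)) = x"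
    using ext short_exact_transport[OF ex E'(2,1)] unfolding ext1_vanishes_def by blast
  have "is_hom \<Gamma> E' E ?k" using is_iso_inverse[OF E'(2) E] by (simp add: is_iso_def)
  from is_hom_comp[OF s(1) this] show ?thesis by (rule that) (use s(2) in simp)
qed

instantiation prod :: (complex_vector, complex_vector) complex_vector
begin

definition scaleC_prod_def: "a *\<^sub>C x = (a *\<^sub>C fst x, a *\<^sub>C snd x)"

instance
  by standard (simp_all add: scaleC_prod_def prod_eq_iff scaleC_add_right scaleC_add_left)

end

lemma fst_scaleC [simp]: "fst (a *\<^sub>C x) = a *\<^sub>C fst x" and snd_scaleC [simp]: "snd (a *\<^sub>C x) = a *\<^sub>C snd x"
  by (simp_all add: scaleC_prod_def)

lemma fin_dim_times:
  assumes "fin_dim_subspace S" "fin_dim_subspace T"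
  shows "fin_dim_subspace (S \<times> T)"
proof -
  have z: "0 \<in> S" "0 \<in> T" using assms[THEN fin_dim_imp_subspace] cvec.subspace_0 by blast+
  have "linear_between S UNIV (\<lambda>x. (x, 0 :: 'b))" "linear_between T UNIV (\<lambda>y. (0 :: 'a, y))"
    by (auto simp: linear_between_def scaleC_prod_def)
  then have "fin_dim_subspace ((\<lambda>x. (x, 0 :: 'b)) ` S)" "fin_dim_subspace ((\<lambda>y. (0 :: 'a, y)) ` T)"
    using fin_dim_image assms by blast+
  then obtain A A' where A: "finite A" "(\<lambda>x. (x, 0 :: 'b)) ` S = cvec.span A"
    "finite A'" "(\<lambda>y. (0 :: 'a, y)) ` T = cvec.span A'"
    unfolding fin_dim_subspace_def by blast
  have "S \<times> T = {x + y |x y. x \<in> (\<lambda>x. (x, 0)) ` S \<and> y \<in> (\<lambda>y. (0, y)) ` T}" by force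
  also have "\<dots> = cvec.span (A \<union> A')" unfolding A cvec.span_Un by blast
  finally show ?thesis unfolding fin_dim_subspace_def using A by blast
qed

text \<open>
  The pullback of \<open>\<kappa>\<close> and \<open>p\<close> along \<open>\<theta>\<close> is an extension of \<open>L\<close> by \<open>N\<close>, and the first component of a
  splitting is the lift.
\<close>

lemma hom_lifts_if_ext1_vanishes:
  assumes ex: "short_exact \<Gamma> N \<kappa> Q p Z" and L: "is_rep \<Gamma> L" and ext: "ext1_vanishes \<Gamma> L N"
    and \<theta>: "is_hom \<Gamma> L Z \<theta>"
  obtains h where "is_hom \<Gamma> L Q h" "\<And>i x. i \<in> q_verts \<Gamma> \<Longrightarrow> x \<in> rep_space L i \<Longrightarrow> p i (h i x) = \<theta> i x"
proof -
  have N: "is_rep \<Gamma> N" and Q: "is_rep \<Gamma> Q" and p: "is_hom \<Gamma> Q Z p"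
    and onto: "\<And>i. i \<in> q_verts \<Gamma> \<Longrightarrow> p i ` rep_space Q i = rep_space Z i"
    and \<kappa>: "is_hom \<Gamma> N Q \<kappa>" and inj: "\<And>i. i \<in> q_verts \<Gamma> \<Longrightarrow> inj_on (\<kappa> i) (rep_space N i)"
    and ker: "\<And>i. i \<in> q_verts \<Gamma> \<Longrightarrow> \<kappa> i ` rep_space N i = {x \<in> rep_space Q i. p i x = 0}"
    using ex by (auto simp: short_exact_def is_epi_def is_mono_def)
  have subQ: "cvec.subspace (rep_space Q i)" and subL: "cvec.subspace (rep_space L i)" if "i \<in> q_verts \<Gamma>" for i
    using is_rep_space(2)[OF Q that] is_rep_space(2)[OF L that] .
  define S where "S i = {w \<in> rep_space Q i \<times> rep_space L i. p i (fst w) = \<theta> i (snd w)}" for i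
  define E where "E = \<lparr>rep_space = S, rep_map = (\<lambda>e w. (rep_map Q e (fst w), rep_map L e (snd w)))\<rparr>"
  have subS: "cvec.subspace (S i)" if i: "i \<in> q_verts \<Gamma>" for i
    by (rule cvec.subspaceI)
      (auto simp: S_def hom_zero[OF p i subQ[OF i]] hom_zero[OF \<theta> i subL[OF i]]
        hom_add[OF p i] hom_add[OF \<theta> i]
        hom_scale[OF p i] hom_scale[OF \<theta> i]
        cvec.subspace_0[OF subQ[OF i]] cvec.subspace_0[OF subL[OF i]] mem_Times_iff
        intro: cvec.subspace_add[OF subQ[OF i]] cvec.subspace_add[OF subL[OF i]]
          cvec.subspace_scale[OF subQ[OF i]] cvec.subspace_scale[OF subL[OF i]])
  have E: "is_rep \<Gamma> E"
    unfolding is_rep_def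
  proof (intro conjI ballI)
    fix i assume i: "i \<in> q_verts \<Gamma>"
    show "fin_dim_subspace (rep_space E i)"
      by (rule fin_dim_subspace_subset[OF fin_dim_times[OF is_rep_space(1)[OF Q i] is_rep_space(1)[OF L i]]])
        (use subS[OF i] in \<open>auto simp: E_def S_def\<close>)
  next
    fix e assume e: "e \<in> q_arrows \<Gamma>"
    note mQ = is_rep_map[OF Q e] and mL = is_rep_map[OF L e]
    show "linear_between (rep_space E (arrow_tail \<Gamma> e)) (rep_space E (arrow_head \<Gamma> e)) (rep_map E e)"
      unfolding linear_between_def
      by (auto simp: E_def S_def mem_Times_iff scaleC_prod_def linear_mem[OF mQ] linear_mem[OF mL]
          linear_add[OF mQ] linear_add[OF mL] linear_scale[OF mQ] linear_scale[OF mL]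
          is_hom_arrow[OF p e] is_hom_arrow[OF \<theta> e])
  qed
  have homQ: "is_hom \<Gamma> E Q (\<lambda>i. fst)" and homL: "is_hom \<Gamma> E L (\<lambda>i. snd)"
    by (auto simp: is_hom_def linear_between_def E_def S_def)
  have \<kappa>Q: "\<kappa> i k \<in> rep_space Q i \<and> p i (\<kappa> i k) = 0" if "i \<in> q_verts \<Gamma>" "k \<in> rep_space N i" for i k
    using ker[OF that(1)] that(2) by blast
  have \<theta>0: "\<theta> i 0 = 0" and L0: "0 \<in> rep_space L i" if i: "i \<in> q_verts \<Gamma>" for i
    using hom_zero[OF \<theta> i subL[OF i]] cvec.subspace_0[OF subL[OF i]] .
  have "is_hom \<Gamma> N E (\<lambda>i k. (\<kappa> i k, 0))"
    unfolding is_hom_def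
  proof (intro conjI ballI)
    fix i assume i: "i \<in> q_verts \<Gamma>"
    show "linear_between (rep_space N i) (rep_space E i) (\<lambda>k. (\<kappa> i k, 0))"
      unfolding linear_between_def
      by (auto simp: E_def S_def scaleC_prod_def \<kappa>Q[OF i] \<theta>0[OF i] L0[OF i]
          hom_add[OF \<kappa> i] hom_scale[OF \<kappa> i])
  next
    fix e k assume e: "e \<in> q_arrows \<Gamma>" and k: "k \<in> rep_space N (arrow_tail \<Gamma> e)"
    show "(\<kappa> (arrow_head \<Gamma> e) (rep_map N e k), 0) = rep_map E e (\<kappa> (arrow_tail \<Gamma> e) k, 0)"
      using is_hom_arrow[OF \<kappa> e k] arrow_zero[OF L e subL[OF arrow_in_verts(1)[OF e]]]
      by (simp add: E_def)
  qed
  moreover have "(\<lambda>k. (\<kappa> i k, 0)) ` rep_space N i = {w \<in> rep_space E i. snd w = 0}" if i: "i \<in> q_verts \<Gamma>" for i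
  proof -
    have "(\<lambda>k. (\<kappa> i k, 0)) ` rep_space N i = (\<lambda>x. (x, 0)) ` {x \<in> rep_space Q i. p i x = 0}"
      unfolding ker[OF i, symmetric] by (simp add: image_image)
    also have "\<dots> = {w \<in> rep_space E i. snd w = 0}"
      using \<theta>0[OF i] L0[OF i] by (force simp: E_def S_def)
    finally show ?thesis .
  qed
  moreover have "snd ` rep_space E i = rep_space L i" if i: "i \<in> q_verts \<Gamma>" for i
  proof -
    have "y \<in> snd ` S i" if y: "y \<in> rep_space L i" for y
    proof -
      have "\<theta> i y \<in> p i ` rep_space Q i" using onto[OF i] hom_mem[OF \<theta> i y] by simp
      then obtain x where x: "x \<in> rep_space Q i" "p i x = \<theta> i y" by auto
      then have "(x, y) \<in> S i" using y by (simp add: S_def)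
      then show ?thesis by (rule image_eqI[rotated]) simp
    qed
    then show ?thesis by (auto simp: E_def S_def)
  qed
  ultimately have "short_exact \<Gamma> N (\<lambda>i k. (\<kappa> i k, 0)) E (\<lambda>i. snd) L"
    unfolding short_exact_def is_mono_def is_epi_def using N E L homL inj by (auto simp: inj_on_def)
  then obtain s where s: "is_hom \<Gamma> L E s" "\<And>i x. i \<in> q_verts \<Gamma> \<Longrightarrow> x \<in> rep_space L i \<Longrightarrow> snd (s i x) = x"
    using ext1_vanishes_splits[OF ext] by blast
  show ?thesis
  proof (rule that)
    show "is_hom \<Gamma> L Q (\<lambda>i x. fst (s i x))" by (rule is_hom_comp[OF s(1) homQ])
    fix i x assume i: "i \<in> q_verts \<Gamma>" and x: "x \<in> rep_space L i"
    have "s i x \<in> S i" using hom_mem[OF s(1) i x] by (simp add: E_def)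
    then show "p i (fst (s i x)) = \<theta> i x" using s(2)[OF i x] by (simp add: S_def)
  qed
qed

text \<open>
  This is \<open>Ext\<^sup>1(L, L) = 0\<close> for an interval \<open>L\<close>. Arbitrary lifts of the values \<open>h i (l i)\<close> are corrected
  one vertex after the other from left to right.
\<close>

lemma thin_hom_lifts:
  assumes thin: "thin_rep \<Gamma> L a z l" and ex: "short_exact \<Gamma> L \<iota> M \<pi> Q" and h: "is_hom \<Gamma> L Q h"
  obtains u where "is_hom \<Gamma> L M u" "\<And>i. i \<in> {a..z} \<Longrightarrow> \<pi> i (u i (l i)) = h i (l i)"
proof -
  interpret thin_rep \<Gamma> L a z l by fact
  have M: "is_rep \<Gamma> M" and Q: "is_rep \<Gamma> Q" and \<pi>: "is_hom \<Gamma> M Q \<pi>"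
    and onto: "\<And>i. i \<in> q_verts \<Gamma> \<Longrightarrow> \<pi> i ` rep_space M i = rep_space Q i"
    and \<iota>: "is_hom \<Gamma> L M \<iota>"
    and ker: "\<And>i. i \<in> q_verts \<Gamma> \<Longrightarrow> \<iota> i ` rep_space L i = {x \<in> rep_space M i. \<pi> i x = 0}"
    using ex by (auto simp: short_exact_def is_epi_def is_mono_def)
  have sub: "cvec.subspace (rep_space M i)" if "i \<in> q_verts \<Gamma>" for i using is_rep_space(2)[OF M that] .
  have lift: "\<exists>x. x \<in> rep_space M i \<and> \<pi> i x = h i (l i)" if i: "i \<in> q_verts \<Gamma>" for i
  proof -
    have "h i (l i) \<in> \<pi> i ` rep_space M i" using onto[OF i] hom_mem[OF h i l_mem[OF i]] by simp
    then show ?thesis by auto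
  qed
  have harr: "rep_map Q e (h (arrow_tail \<Gamma> e) (l (arrow_tail \<Gamma> e))) = h (arrow_head \<Gamma> e) (l (arrow_head \<Gamma> e))"
    if e: "e \<in> q_arrows \<Gamma>" and t: "arrow_tail \<Gamma> e \<in> {a..z}" for e
    using is_hom_arrow[OF h e l_mem[OF arrow_in_verts(1)[OF e]]] l_arrow[OF e t] by simp
  have partial: "j \<le> z \<Longrightarrow> \<exists>x. (\<forall>i\<in>{a..j}. x i \<in> rep_space M i \<and> \<pi> i (x i) = h i (l i)) \<and>
      (\<forall>e\<in>{a..<j}. rep_map M e (x (arrow_tail \<Gamma> e)) = x (arrow_head \<Gamma> e))" if "a \<le> j" for j
    using that
  proof (induction j rule: dec_induct)
    case base
    obtain x where "x \<in> rep_space M a \<and> \<pi> a x = h a (l a)" using lift[of a] az_vert[of a] az by auto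
    then show ?case by (intro exI[of _ "\<lambda>_. x"]) auto
  next
    case (step j)
    then obtain x where x: "\<forall>i\<in>{a..j}. x i \<in> rep_space M i \<and> \<pi> i (x i) = h i (l i)"
      "\<forall>e\<in>{a..<j}. rep_map M e (x (arrow_tail \<Gamma> e)) = x (arrow_head \<Gamma> e)" by auto
    have ja: "j \<in> {a..z}" "Suc j \<in> {a..z}" using step by auto
    note jv = az_vert[OF ja(1)] az_vert[OF ja(2)]
    have e: "j \<in> q_arrows \<Gamma>" using jv by (auto simp: q_arrows_def q_verts_def)
    have xj: "x j \<in> rep_space M j" "\<pi> j (x j) = h j (l j)" using x(1) step by auto
    have "\<exists>y. y \<in> rep_space M (Suc j) \<and> \<pi> (Suc j) y = h (Suc j) (l (Suc j)) \<and>
       (if rightward \<Gamma> j then rep_map M j (x j) = y else rep_map M j y = x j)"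
    proof (cases "rightward \<Gamma> j")
      case True
      then have th: "arrow_tail \<Gamma> j = j" "arrow_head \<Gamma> j = Suc j" by (auto simp: arrow_tail_def arrow_head_def)
      have "rep_map M j (x j) \<in> rep_space M (Suc j)"
        using arrow_mem[OF M e] xj(1) th by simp
      moreover have "\<pi> (Suc j) (rep_map M j (x j)) = h (Suc j) (l (Suc j))"
        using is_hom_arrow[OF \<pi> e, of "x j"] xj th harr[OF e] ja by simp
      ultimately show ?thesis using True by auto
    next
      case False
      then have th: "arrow_tail \<Gamma> j = Suc j" "arrow_head \<Gamma> j = j" by (auto simp: arrow_tail_def arrow_head_def)
      \<comment> \<open>The arrow maps an arbitrary lift at \<open>Suc j\<close> to the chosen lift at \<open>j\<close> up to a multiple of
        \<open>\<iota> j (l j)\<close>, and this is the image of a multiple of \<open>\<iota> (Suc j) (l (Suc j))\<close>.\<close>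
      obtain y where y: "y \<in> rep_space M (Suc j)" "\<pi> (Suc j) y = h (Suc j) (l (Suc j))" using lift[OF jv(2)] by blast
      have my: "rep_map M j y \<in> rep_space M j" using arrow_mem[OF M e] y(1) th by simp
      have "\<pi> j (rep_map M j y) = h j (l j)"
        using is_hom_arrow[OF \<pi> e, of y] y th harr[OF e] ja by simp
      then have "rep_map M j y - x j \<in> {x \<in> rep_space M j. \<pi> j x = 0}"
        using hom_diff[OF \<pi> jv(1) sub[OF jv(1)] my xj(1)] xj(2)
          cvec.subspace_diff[OF sub[OF jv(1)] my xj(1)] by simp
      then obtain w where w: "w \<in> rep_space L j" "rep_map M j y - x j = \<iota> j w" using ker[OF jv(1)] by blast
      obtain t where t: "w = t *\<^sub>C l j" by (rule spaceE[OF jv(1) w(1)])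
      let ?w = "t *\<^sub>C l (Suc j)"
      have w': "?w \<in> rep_space L (Suc j)" using cvec.subspace_scale[OF L_sub[OF jv(2)] l_mem[OF jv(2)]] .
      have "rep_map L j ?w = w"
        using arrow_scale[OF L_rep e, of "l (Suc j)" t] l_mem[OF jv(2)] l_arrow[OF e] th ja t by simp
      then have m\<iota>: "rep_map M j (\<iota> (Suc j) ?w) = \<iota> j w" using is_hom_arrow[OF \<iota> e, of ?w] w' th by simp
      have \<iota>w: "\<iota> (Suc j) ?w \<in> {x \<in> rep_space M (Suc j). \<pi> (Suc j) x = 0}" using ker[OF jv(2)] w' by blast
      have "y - \<iota> (Suc j) ?w \<in> rep_space M (Suc j)" using cvec.subspace_diff[OF sub[OF jv(2)] y(1)] \<iota>w by blast
      moreover have "\<pi> (Suc j) (y - \<iota> (Suc j) ?w) = h (Suc j) (l (Suc j))"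
        using hom_diff[OF \<pi> jv(2) sub[OF jv(2)] y(1), of "\<iota> (Suc j) ?w"] \<iota>w y(2) by simp
      moreover have "rep_map M j (y - \<iota> (Suc j) ?w) = x j"
        using arrow_diff[OF M e sub[OF arrow_in_verts(1)[OF e]], of y "\<iota> (Suc j) ?w"]
          y(1) \<iota>w m\<iota> w(2) th by (simp add: algebra_simps)
      ultimately show ?thesis using False by auto
    qed
    then obtain y where y: "y \<in> rep_space M (Suc j)" "\<pi> (Suc j) y = h (Suc j) (l (Suc j))"
      "if rightward \<Gamma> j then rep_map M j (x j) = y else rep_map M j y = x j" by blast
    let ?x = "x(Suc j := y)"
    have "\<forall>i\<in>{a..Suc j}. ?x i \<in> rep_space M i \<and> \<pi> i (?x i) = h i (l i)"
      using x(1) y(1,2) by (auto simp: le_Suc_eq)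
    moreover have "rep_map M e (?x (arrow_tail \<Gamma> e)) = ?x (arrow_head \<Gamma> e)" if "e \<in> {a..<Suc j}" for e
    proof (cases "e = j")
      case True
      then show ?thesis using y(3) by (auto simp: arrow_tail_def arrow_head_def split: if_splits)
    next
      case False
      then have "e \<in> {a..<j}" using that by auto
      moreover from this have "arrow_tail \<Gamma> e \<noteq> Suc j" "arrow_head \<Gamma> e \<noteq> Suc j"
        by (auto simp: arrow_tail_def arrow_head_def)
      ultimately show ?thesis using x(2) by simp
    qed
    ultimately show ?case by blast
  qed
  obtain x where x: "\<forall>i\<in>{a..z}. x i \<in> rep_space M i \<and> \<pi> i (x i) = h i (l i)"
    "\<forall>e\<in>{a..<z}. rep_map M e (x (arrow_tail \<Gamma> e)) = x (arrow_head \<Gamma> e)"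
    using partial[OF az(2) order_refl] by blast
  have sv: "stringvec \<Gamma> M a z x"
    unfolding stringvec_def
  proof (intro conjI ballI impI)
    show "x i \<in> rep_space M i" if "i \<in> {a..z}" for i using x(1) that by blast
    fix e assume e: "e \<in> q_arrows \<Gamma>" and t: "arrow_tail \<Gamma> e \<in> {a..z}"
    note tv = arrow_in_verts[OF e]
    have xt: "x (arrow_tail \<Gamma> e) \<in> rep_space M (arrow_tail \<Gamma> e)" "\<pi> (arrow_tail \<Gamma> e) (x (arrow_tail \<Gamma> e)) = h (arrow_tail \<Gamma> e) (l (arrow_tail \<Gamma> e))"
      using x(1) t by auto
    show "rep_map M e (x (arrow_tail \<Gamma> e)) = (if arrow_head \<Gamma> e \<in> {a..z} then x (arrow_head \<Gamma> e) else 0)"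
    proof (cases "arrow_head \<Gamma> e \<in> {a..z}")
      case True
      then have "e \<in> {a..<z}" using t by (auto simp: arrow_tail_def arrow_head_def split: if_splits)
      then have "rep_map M e (x (arrow_tail \<Gamma> e)) = x (arrow_head \<Gamma> e)" using x(2) by blast
      then show ?thesis unfolding if_P[OF True] .
    next
      case False
      have "h (arrow_head \<Gamma> e) (l (arrow_head \<Gamma> e)) = 0"
        using l_out[OF False] hom_zero[OF h tv(2) L_sub[OF tv(2)]] by simp
      then have "\<pi> (arrow_head \<Gamma> e) (rep_map M e (x (arrow_tail \<Gamma> e))) = 0"
        using is_hom_arrow[OF \<pi> e xt(1)] xt(2) harr[OF e t] by simp
      then have "rep_map M e (x (arrow_tail \<Gamma> e)) \<in> \<iota> (arrow_head \<Gamma> e) ` rep_space L (arrow_head \<Gamma> e)"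
        unfolding ker[OF tv(2)] using arrow_mem[OF M e xt(1)] by simp
      moreover have "rep_space L (arrow_head \<Gamma> e) = {0}" unfolding space[OF tv(2)] if_not_P[OF False] ..
      ultimately have "rep_map M e (x (arrow_tail \<Gamma> e)) = 0"
        using hom_zero[OF \<iota> tv(2) L_sub[OF tv(2)]] by simp
      then show ?thesis unfolding if_not_P[OF False] .
    qed
  qed
  show ?thesis
    by (rule that[OF hom_from_stringvec(1)[OF sv M]]) (use hom_from_stringvec(2)[OF sv M] x(1) in simp)
qed

section \<open>Indecomposable representations are intervals\<close>

text \<open>
  The kernels of \<open>p\<close> and of \<open>1 - p\<close> are complementary subrepresentations.
\<close>

lemma indecomposable_idempotent:
  assumes ind: "indecomposable \<Gamma> L" and p: "is_hom \<Gamma> L L p"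
    and idem: "\<And>i x. i \<in> q_verts \<Gamma> \<Longrightarrow> x \<in> rep_space L i \<Longrightarrow> p i (p i x) = p i x"
  shows "(\<forall>i\<in>q_verts \<Gamma>. \<forall>x\<in>rep_space L i. p i x = 0) \<or> (\<forall>i\<in>q_verts \<Gamma>. \<forall>x\<in>rep_space L i. p i x = x)"
proof -
  have rep: "is_rep \<Gamma> L" using ind by (simp add: indecomposable_def)
  define X where "X = \<lparr>rep_space = (\<lambda>i. {x \<in> rep_space L i. x - p i x = 0}), rep_map = rep_map L\<rparr>"
  define Y where "Y = \<lparr>rep_space = (\<lambda>i. {x \<in> rep_space L i. p i x = 0}), rep_map = rep_map L\<rparr>"
  have sub: "cvec.subspace (rep_space L i)" if "i \<in> q_verts \<Gamma>" for i by (rule is_rep_space(2)[OF rep that])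
  have q: "is_hom \<Gamma> L L (\<lambda>i x. x - p i x)" using is_hom_lincomb[OF is_hom_id p rep, of "- 1"] by simp
  have subrep: "is_subrep \<Gamma> \<lparr>rep_space = (\<lambda>i. {x \<in> rep_space L i. f i x = 0}), rep_map = rep_map L\<rparr> L"
    (is "is_subrep _ ?Z _") if f: "is_hom \<Gamma> L L f" for f
  proof -
    have "is_rep \<Gamma> ?Z" unfolding is_rep_def
    proof (intro conjI ballI)
      fix i assume i: "i \<in> q_verts \<Gamma>"
      show "fin_dim_subspace (rep_space ?Z i)"
        by (rule fin_dim_subspace_subset[OF is_rep_space(1)[OF rep i]])
          (use linear_kernel[OF is_hom_lin[OF f i] sub[OF i]] in auto)
    next
      fix e assume e: "e \<in> q_arrows \<Gamma>"
      note tv = arrow_in_verts[OF e]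
      have "f (arrow_head \<Gamma> e) (rep_map L e x) = 0" if "x \<in> rep_space L (arrow_tail \<Gamma> e)" "f (arrow_tail \<Gamma> e) x = 0" for x
        using is_hom_arrow[OF f e that(1)] that(2) arrow_zero[OF rep e sub[OF tv(1)]] by simp
      then show "linear_between (rep_space ?Z (arrow_tail \<Gamma> e)) (rep_space ?Z (arrow_head \<Gamma> e)) (rep_map ?Z e)"
        using linear_restrict[OF is_rep_map[OF rep e], of "{x \<in> rep_space L (arrow_tail \<Gamma> e). f (arrow_tail \<Gamma> e) x = 0}"
            "{x \<in> rep_space L (arrow_head \<Gamma> e). f (arrow_head \<Gamma> e) x = 0}"]
          arrow_mem[OF rep e] by simp
    qed
    then show ?thesis by (auto simp: is_subrep_def)
  qed
  have px: "p i x \<in> rep_space L i" if "i \<in> q_verts \<Gamma>" "x \<in> rep_space L i" for i x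
    by (rule hom_mem[OF p that(1) that(2)])
  have "is_zero_rep \<Gamma> X \<or> is_zero_rep \<Gamma> Y"
  proof -
    have "rep_space X i \<inter> rep_space Y i = {0} \<and> rep_space L i = {x + y |x y. x \<in> rep_space X i \<and> y \<in> rep_space Y i}"
      if i: "i \<in> q_verts \<Gamma>" for i
    proof (intro conjI equalityI subsetI)
      fix x assume x: "x \<in> rep_space L i"
      have "x = p i x + (x - p i x)" by simp
      moreover have "p i x \<in> rep_space X i" using px[OF i x] idem[OF i x] by (simp add: X_def)
      moreover have "x - p i x \<in> rep_space Y i"
        using px[OF i x] idem[OF i x] cvec.subspace_diff[OF sub[OF i] x] hom_diff[OF p i sub[OF i] x]
        by (simp add: Y_def)
      ultimately show "x \<in> {x + y |x y. x \<in> rep_space X i \<and> y \<in> rep_space Y i}" by blast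
    qed (use cvec.subspace_0[OF sub[OF i]] cvec.subspace_add[OF sub[OF i]] hom_zero[OF p i sub[OF i]]
        in \<open>auto simp: X_def Y_def\<close>)
    moreover have "is_subrep \<Gamma> X L" "is_subrep \<Gamma> Y L" unfolding X_def Y_def using subrep[OF q] subrep[OF p] .
    ultimately show ?thesis using ind unfolding indecomposable_def by blast
  qed
  then show ?thesis
  proof
    assume Z: "is_zero_rep \<Gamma> X"
    have "p i x = 0" if i: "i \<in> q_verts \<Gamma>" and x: "x \<in> rep_space L i" for i x
    proof -
      have "p i x \<in> rep_space X i" using px[OF i x] idem[OF i x] by (simp add: X_def)
      then show ?thesis using Z i by (simp add: is_zero_rep_def)
    qed
    then show ?thesis by blast
  next
    assume Z: "is_zero_rep \<Gamma> Y"
    have "p i x = x" if i: "i \<in> q_verts \<Gamma>" and x: "x \<in> rep_space L i" for i x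
    proof -
      have "x - p i x \<in> rep_space Y i"
        using px[OF i x] idem[OF i x] cvec.subspace_diff[OF sub[OF i] x] hom_diff[OF p i sub[OF i] x]
        by (simp add: Y_def)
      then show ?thesis using Z i by (simp add: is_zero_rep_def)
    qed
    then show ?thesis by blast
  qed
qed

text \<open>
  The projection onto one string of \<open>L\<close> is a nonzero idempotent, hence the identity.
\<close>

lemma indecomposable_is_thin:
  assumes ind: "indecomposable \<Gamma> L" and n: "1 \<le> num_verts \<Gamma>"
  obtains a z l where "thin_rep \<Gamma> L a z l"
proof -
  have rep: "is_rep \<Gamma> L" using ind by (simp add: indecomposable_def)
  obtain I c d b where sb: "string_basis \<Gamma> (num_verts \<Gamma>) L I c d b"
    by (rule string_basis_exists[OF rep n])
  interpret string_rep \<Gamma> L I c d b by unfold_locales (fact rep sb)+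
  have "\<exists>i\<in>q_verts \<Gamma>. rep_space L i \<noteq> {0}" using ind by (simp add: indecomposable_def is_zero_rep_def)
  then obtain i0 x0 where i0: "i0 \<in> q_verts \<Gamma>" "x0 \<in> rep_space L i0" "x0 \<noteq> 0"
    using sub cvec.subspace_0 by blast
  have "through I c d i0 \<noteq> {}" using expand[OF i0(1,2)] i0(3) by auto
  then obtain k where k: "k \<in> I" by (auto simp: through_def)
  have itv: "1 \<le> c k" "c k \<le> d k" "d k \<le> num_verts \<Gamma>" using string_basisD(2)[OF strings k] by auto
  have vert: "i \<in> q_verts \<Gamma> \<and> k \<in> through I c d i" if "i \<in> {c k..d k}" for i
    using that itv k by (auto simp: q_verts_def through_def)
  have bnz: "b k i \<noteq> 0" if "i \<in> {c k..d k}" for i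
    using cf_b[of i k k] cf_zero[of i k] vert[OF that] by auto
  have idem: "proj k i (proj k i x) = proj k i x" if i: "i \<in> q_verts \<Gamma>" for i x
  proof (cases "i \<in> {c k..d k}")
    case True
    then show ?thesis unfolding proj_eq using cf_scale[OF i b_mem[OF k i]] cf_b[OF i, of k k] vert[OF True] by simp
  qed (simp add: proj_eq b_outside[OF k])
  have "proj k (c k) (b k (c k)) \<noteq> 0"
    unfolding proj_eq using cf_b[of "c k" k k] vert[of "c k"] bnz[of "c k"] itv by simp
  then have all: "proj k i x = x" if "i \<in> q_verts \<Gamma>" "x \<in> rep_space L i" for i x
    using indecomposable_idempotent[OF ind proj_hom[OF k] idem] that b_mem[OF k, of "c k"] vert[of "c k"] itv by auto
  have "thin_rep \<Gamma> L (c k) (d k) (b k)"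
  proof
    show "rep_space L i = (if i \<in> {c k..d k} then range (\<lambda>t. t *\<^sub>C b k i) else {0})" if i: "i \<in> q_verts \<Gamma>" for i
    proof -
      have "rep_space L i = range (\<lambda>t. t *\<^sub>C b k i)"
      proof (intro equalityI subsetI)
        fix x assume "x \<in> rep_space L i"
        then have "x = cf k i x *\<^sub>C b k i" using all[OF i] proj_eq[of k i x] by simp
        then show "x \<in> range (\<lambda>t. t *\<^sub>C b k i)" by (rule range_eqI)
      qed (use cvec.subspace_scale[OF sub[OF i] b_mem[OF k i]] in auto)
      then show ?thesis using b_outside[OF k, of i] by auto
    qed
  qed (use rep itv bnz b_outside[OF k] b_arrow[OF k] in auto)
  then show ?thesis by (rule that)
qed

section \<open>Isotropic generic embeddings\<close>

context eps_rep
begin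

text \<open>
  The homomorphism \<open>L \<rightarrow> \<nabla>L\<close> induced by \<open>\<iota>\<close>.
\<close>

lemma form_hom:
  assumes L: "is_rep \<Gamma> L" and \<iota>: "is_hom \<Gamma> L M \<iota>"
  shows "is_hom \<Gamma> L (nabla \<Gamma> L)
    (\<lambda>i x y. if y \<in> rep_space L (\<sigma> i) then B i (\<sigma> i) (\<iota> i x) (\<iota> (\<sigma> i) y) else 0)"
    (is "is_hom _ _ _ ?\<theta>")
  unfolding is_hom_def
proof (intro conjI ballI)
  fix i assume i: "i \<in> q_verts \<Gamma>"
  note j = \<sigma>_verts[OF i]
  have mem: "\<iota> i x \<in> rep_space M i" if "x \<in> rep_space L i" for x
    using hom_mem[OF \<iota> i that] .
  have memj: "\<iota> (\<sigma> i) y \<in> rep_space M (\<sigma> i)" if "y \<in> rep_space L (\<sigma> i)" for y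
    using hom_mem[OF \<iota> j that] .
  have subj: "cvec.subspace (rep_space L (\<sigma> i))" using is_rep_space(2)[OF L j] .
  have r: "linear_between (rep_space L (\<sigma> i)) UNIV (\<lambda>y. B i (\<sigma> i) (\<iota> i x) (\<iota> (\<sigma> i) y))" if "x \<in> rep_space L i" for x
    by (rule linear_comp[OF is_hom_lin[OF \<iota> j] form_right[OF i j mem[OF that]]])
  have lft: "linear_between (rep_space L i) UNIV (\<lambda>x. B i (\<sigma> i) (\<iota> i x) (\<iota> (\<sigma> i) y))" if "y \<in> rep_space L (\<sigma> i)" for y
    by (rule linear_comp[OF is_hom_lin[OF \<iota> i] form_left[OF i j memj[OF that]]])
  have "?\<theta> i x \<in> dual_space (rep_space L (\<sigma> i))" if x: "x \<in> rep_space L i" for x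
    unfolding dual_space_def
  proof (intro CollectI conjI allI impI)
    show "linear_between (rep_space L (\<sigma> i)) UNIV (?\<theta> i x)"
      using linear_add[OF r[OF x]] linear_scale[OF r[OF x]]
        cvec.subspace_add[OF subj] cvec.subspace_scale[OF subj]
      by (simp add: linear_between_def)
  qed simp
  then show "linear_between (rep_space L i) (rep_space (nabla \<Gamma> L) i) (?\<theta> i)"
    unfolding linear_between_def nabla_def
    using linear_add[OF lft] linear_scale[OF lft]
    by (auto simp: fun_eq_iff scaleC_fun_def scaleC_complex_def)
next
  fix e x assume e: "e \<in> q_arrows \<Gamma>" and x: "x \<in> rep_space L (arrow_tail \<Gamma> e)"
  let ?t = "arrow_tail \<Gamma> e" and ?h = "arrow_head \<Gamma> e"
  note tv = arrow_in_verts[OF e]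
  show "?\<theta> ?h (rep_map L e x) = rep_map (nabla \<Gamma> L) e (?\<theta> ?t x)"
  proof
    fix y
    show "?\<theta> ?h (rep_map L e x) y = rep_map (nabla \<Gamma> L) e (?\<theta> ?t x) y"
    proof (cases "y \<in> rep_space L (\<sigma> ?h)")
      case False
      then show ?thesis using e by (simp add: nabla_def)
    next
      case True
      have \<tau>y: "rep_map L (\<tau> e) y \<in> rep_space L (\<sigma> ?t)"
        using arrow_mem[OF L \<tau>_arrows[OF e], of y] True e by simp
      have \<iota>x: "\<iota> ?t x \<in> rep_space M ?t" using hom_mem[OF \<iota> tv(1) x] .
      have \<iota>y: "\<iota> (\<sigma> ?h) y \<in> rep_space M (\<sigma> ?h)" using hom_mem[OF \<iota> \<sigma>_verts[OF tv(2)] True] .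
      have "?\<theta> ?h (rep_map L e x) y = B ?h (\<sigma> ?h) (rep_map M e (\<iota> ?t x)) (\<iota> (\<sigma> ?h) y)"
        using True is_hom_arrow[OF \<iota> e x] by simp
      also have "\<dots> = - B ?t (\<sigma> ?t) (\<iota> ?t x) (rep_map M (\<tau> e) (\<iota> (\<sigma> ?h) y))"
        by (rule form_adjoint[OF e \<iota>x \<iota>y])
      also have "rep_map M (\<tau> e) (\<iota> (\<sigma> ?h) y) = \<iota> (\<sigma> ?t) (rep_map L (\<tau> e) y)"
        using is_hom_arrow[OF \<iota> \<tau>_arrows[OF e], of y] True e by simp
      also have "- B ?t (\<sigma> ?t) (\<iota> ?t x) (\<iota> (\<sigma> ?t) (rep_map L (\<tau> e) y)) = rep_map (nabla \<Gamma> L) e (?\<theta> ?t x) y"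
        using True \<tau>y e by (simp add: nabla_def)
      finally show ?thesis .
    qed
  qed
qed

text \<open>
  Under \<open>M \<cong> \<nabla>M\<close>, homomorphisms \<open>M \<rightarrow> \<nabla>L\<close> correspond to homomorphisms \<open>L \<rightarrow> M\<close>. By nondegeneracy
  each functional on a space of \<open>M\<close> is represented by a unique vector, and uniqueness makes the
  representing vectors compatible with the arrows.
\<close>

lemma dual_of_hom_to_nabla:
  assumes thin: "thin_rep \<Gamma> L a z l" and P: "is_hom \<Gamma> M (nabla \<Gamma> L) P"
  obtains w where "stringvec \<Gamma> M a z w"
    "\<And>j x. j \<in> {a..z} \<Longrightarrow> x \<in> rep_space M (\<sigma> j) \<Longrightarrow> B (\<sigma> j) j x (w j) = P (\<sigma> j) x (l j)"
proof -
  interpret thin_rep \<Gamma> L a z l by fact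
  have "\<forall>j\<in>q_verts \<Gamma>. \<exists>y. y \<in> rep_space M j \<and> (\<forall>x\<in>rep_space M (\<sigma> j). B (\<sigma> j) j x y = P (\<sigma> j) x (l j))"
  proof
    fix j assume j: "j \<in> q_verts \<Gamma>"
    note lin = is_hom_lin[OF P \<sigma>_verts[OF j]]
    have "linear_between (rep_space M (\<sigma> j)) UNIV (\<lambda>x. P (\<sigma> j) x (l j))"
      using linear_add[OF lin] linear_scale[OF lin]
      by (simp add: linear_between_def scaleC_fun_def)
    then obtain y where "y \<in> rep_space M (\<sigma> (\<sigma> j))"
      "\<And>x. x \<in> rep_space M (\<sigma> j) \<Longrightarrow> B (\<sigma> j) (\<sigma> (\<sigma> j)) x y = P (\<sigma> j) x (l j)"
      using form_represents[OF \<sigma>_verts[OF j]] by blast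
    then show "\<exists>y. y \<in> rep_space M j \<and> (\<forall>x\<in>rep_space M (\<sigma> j). B (\<sigma> j) j x y = P (\<sigma> j) x (l j))"
      using j by auto
  qed
  from bchoice[OF this] obtain w where
    w: "\<forall>j\<in>q_verts \<Gamma>. w j \<in> rep_space M j \<and> (\<forall>x\<in>rep_space M (\<sigma> j). B (\<sigma> j) j x (w j) = P (\<sigma> j) x (l j))" ..
  have wm: "w j \<in> rep_space M j" if "j \<in> q_verts \<Gamma>" for j using w that by blast
  have wB: "B (\<sigma> j) j x (w j) = P (\<sigma> j) x (l j)" if "j \<in> q_verts \<Gamma>" "x \<in> rep_space M (\<sigma> j)" for j x
    using w that by blast
  have sub: "cvec.subspace (rep_space M i)" if "i \<in> q_verts \<Gamma>" for i using is_rep_space(2)[OF M_rep that] .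
  have "rep_map M e (w (arrow_tail \<Gamma> e)) = (if arrow_head \<Gamma> e \<in> {a..z} then w (arrow_head \<Gamma> e) else 0)"
    if e: "e \<in> q_arrows \<Gamma>" and t: "arrow_tail \<Gamma> e \<in> {a..z}" for e
  proof -
    let ?t = "arrow_tail \<Gamma> e" and ?h = "arrow_head \<Gamma> e"
    note tv = arrow_in_verts[OF e] and \<tau>e = \<tau>_arrows[OF e]
    note sh = \<sigma>_verts[OF tv(2)]
    let ?w = "if ?h \<in> {a..z} then w ?h else 0"
    have mw: "rep_map M e (w ?t) \<in> rep_space M ?h" using arrow_mem[OF M_rep e wm[OF tv(1)]] .
    have hw: "?w \<in> rep_space M ?h" using wm[OF tv(2)] cvec.subspace_0[OF sub[OF tv(2)]] by simp
    have "rep_map M e (w ?t) - ?w = 0"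
    proof (rule form_nondeg_right[OF tv(2)])
      show "rep_map M e (w ?t) - ?w \<in> rep_space M ?h" using cvec.subspace_diff[OF sub[OF tv(2)] mw hw] .
      fix x assume x: "x \<in> rep_space M (\<sigma> ?h)"
      have x': "x \<in> rep_space M (arrow_tail \<Gamma> (\<tau> e))" using x e by simp
      have w': "w ?t \<in> rep_space M (\<sigma> (arrow_head \<Gamma> (\<tau> e)))" using wm[OF tv(1)] e tv by simp
      have mx: "rep_map M (\<tau> e) x \<in> rep_space M (\<sigma> ?t)"
        using arrow_mem[OF M_rep \<tau>e x'] e by simp
      have lt: "l ?t \<in> rep_space L ?t" by (rule l_mem[OF tv(1)])
      have "B (\<sigma> ?h) ?h x (rep_map M e (w ?t)) = - B (\<sigma> ?t) ?t (rep_map M (\<tau> e) x) (w ?t)"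
        using form_adjoint[OF \<tau>e x' w'] e tv by simp
      also have "\<dots> = - P (\<sigma> ?t) (rep_map M (\<tau> e) x) (l ?t)" using wB[OF tv(1) mx] by simp
      also have "P (\<sigma> ?t) (rep_map M (\<tau> e) x) = rep_map (nabla \<Gamma> L) (\<tau> e) (P (\<sigma> ?h) x)"
        using is_hom_arrow[OF P \<tau>e x'] e by simp
      also have "- rep_map (nabla \<Gamma> L) (\<tau> e) (P (\<sigma> ?h) x) (l ?t) = P (\<sigma> ?h) x (l ?h)"
        using lt e l_arrow[OF e t] by (simp add: nabla_def)
      also have "P (\<sigma> ?h) x (l ?h) = B (\<sigma> ?h) ?h x ?w"
      proof (cases "?h \<in> {a..z}")
        case True
        show ?thesis unfolding if_P[OF True] using wB[OF tv(2) x] by simp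
      next
        case False
        have "P (\<sigma> ?h) x \<in> rep_space (nabla \<Gamma> L) (\<sigma> ?h)" using hom_mem[OF P sh x] .
        then have "linear_between (rep_space L ?h) UNIV (P (\<sigma> ?h) x)"
          using tv by (simp add: nabla_def dual_space_def)
        then have "P (\<sigma> ?h) x 0 = 0" by (rule linear_zero[OF _ L_sub[OF tv(2)]])
        then show ?thesis unfolding if_not_P[OF False] l_out[OF False]
          using linear_zero[OF form_right[OF sh tv(2) x] sub[OF tv(2)]] by simp
      qed
      finally have "B (\<sigma> ?h) ?h x (rep_map M e (w ?t)) = B (\<sigma> ?h) ?h x ?w" .
      then show "B (\<sigma> ?h) ?h x (rep_map M e (w ?t) - ?w) = 0"
        using linear_diff[OF form_right[OF sh tv(2) x] sub[OF tv(2)] mw hw] by simp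
    qed
    then show ?thesis by simp
  qed
  then have "stringvec \<Gamma> M a z w" unfolding stringvec_def using wm by blast
  moreover have "B (\<sigma> j) j x (w j) = P (\<sigma> j) x (l j)" if "j \<in> {a..z}" "x \<in> rep_space M (\<sigma> j)" for j x
    using wB[OF az_vert[OF that(1)] that(2)] .
  ultimately show ?thesis using that by blast
qed

text \<open>
  Here \<open>h\<close> lifts the homomorphism \<open>L \<rightarrow> \<nabla>L\<close> induced by \<open>\<iota>\<close> along \<open>M \<rightarrow> Q \<rightarrow> \<nabla>L\<close>, and \<open>w\<close> is dual to
  this composite.
\<close>

lemma form_has_rank_two:
  fixes N :: "(nat \<Rightarrow> complex) rep" and Q :: "'q::complex_vector rep"
  assumes thin: "thin_rep \<Gamma> L a z l" and m: "mid \<in> {a..z}" "\<sigma> mid \<in> {a..z}"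
    and ex: "short_exact \<Gamma> L \<iota> M \<pi> Q" and ex2: "short_exact \<Gamma> N \<kappa> Q p (nabla \<Gamma> L)"
    and ext: "ext1_vanishes \<Gamma> L N" and q: "bt (\<iota> mid (l mid)) (\<iota> mid (l mid)) \<noteq> 0"
  obtains h w where "is_hom \<Gamma> L M h" "is_hom \<Gamma> L M w"
    "bt (\<iota> mid (l mid)) (w mid (l mid)) = 0" "bt (h mid (l mid)) (w mid (l mid)) \<noteq> 0"
proof -
  interpret thin_rep \<Gamma> L a z l by fact
  have \<iota>: "is_hom \<Gamma> L M \<iota>" and \<pi>: "is_hom \<Gamma> M Q \<pi>" and Q: "is_rep \<Gamma> Q"
    and ker: "\<And>i. i \<in> q_verts \<Gamma> \<Longrightarrow> \<iota> i ` rep_space L i = {x \<in> rep_space M i. \<pi> i x = 0}"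
    using ex by (auto simp: short_exact_def is_mono_def is_epi_def)
  have p: "is_hom \<Gamma> Q (nabla \<Gamma> L) p" using ex2 by (auto simp: short_exact_def is_epi_def)
  obtain h0 where h0: "is_hom \<Gamma> L Q h0"
    "\<And>i x. i \<in> q_verts \<Gamma> \<Longrightarrow> x \<in> rep_space L i \<Longrightarrow> p i (h0 i x) =
        (\<lambda>y. if y \<in> rep_space L (\<sigma> i) then B i (\<sigma> i) (\<iota> i x) (\<iota> (\<sigma> i) y) else 0)"
    using hom_lifts_if_ext1_vanishes[OF ex2 L_rep ext form_hom[OF L_rep \<iota>]] by blast
  obtain h where h: "is_hom \<Gamma> L M h" "\<And>i. i \<in> {a..z} \<Longrightarrow> \<pi> i (h i (l i)) = h0 i (l i)"
    by (rule thin_hom_lifts[OF thin ex h0(1)], rule that) auto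
  have P: "is_hom \<Gamma> M (nabla \<Gamma> L) (\<lambda>i x. p i (\<pi> i x))" by (rule is_hom_comp[OF \<pi> p])
  obtain w where w: "stringvec \<Gamma> M a z w"
    "\<And>j x. j \<in> {a..z} \<Longrightarrow> x \<in> rep_space M (\<sigma> j) \<Longrightarrow> B (\<sigma> j) j x (w j) = p (\<sigma> j) (\<pi> (\<sigma> j) x) (l j)"
    by (rule dual_of_hom_to_nabla[OF thin P], rule that) auto
  define W where "W = through_string a z lam w"
  have W: "is_hom \<Gamma> L M W" "W mid (l mid) = w mid"
    unfolding W_def using hom_from_stringvec[OF w(1) M_rep] m(1) by auto
  have lm: "l mid \<in> rep_space L mid" "l (\<sigma> mid) \<in> rep_space L (\<sigma> mid)"
    using l_mem mid_vert by blast+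
  have trw: "tr (w mid) = w (\<sigma> mid)" using tr_stringvec[OF w(1) m(1)] unfolding if_P[OF m(2)] .
  have bw: "bt x (W mid (l mid)) = p mid (\<pi> mid x) (l (\<sigma> mid))" if "x \<in> rep_space M mid" for x
    using w(2)[OF m(2), of x] that mid_vert(1) by (simp add: bt_def W(2) trw)
  have \<iota>m: "\<iota> mid (l mid) \<in> rep_space M mid" and hm: "h mid (l mid) \<in> rep_space M mid"
    using hom_mem[OF \<iota> mid_vert(1) lm(1)]
      hom_mem[OF h(1) mid_vert(1) lm(1)] .
  have "\<pi> mid (\<iota> mid (l mid)) = 0" using ker[OF mid_vert(1)] lm(1) by blast
  then have 1: "bt (\<iota> mid (l mid)) (W mid (l mid)) = 0"
    using bw[OF \<iota>m] hom_zero[OF p mid_vert(1) is_rep_space(2)[OF Q mid_vert(1)]] by simp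
  have "bt (h mid (l mid)) (W mid (l mid)) = B mid (\<sigma> mid) (\<iota> mid (l mid)) (\<iota> (\<sigma> mid) (l (\<sigma> mid)))"
    using bw[OF hm] h(2)[OF m(1)] h0(2)[OF mid_vert(1) lm(1)] lm(2) by simp
  also have "\<dots> = bt (\<iota> mid (l mid)) (\<iota> mid (l mid))"
    using tr_stringvec[OF hom_stringvec[OF \<iota>] m(1)] unfolding if_P[OF m(2)] bt_def by simp
  finally have 2: "bt (h mid (l mid)) (W mid (l mid)) \<noteq> 0" using q by simp
  show ?thesis by (rule that[OF h(1) W(1) 1 2])
qed

end

context eps_strings
begin

text \<open>
  The lemma \<open>isotropic_vector_in_orbit\<close> is applied to the coordinate vectors at the middle of the
  embeddings \<open>g \<circ> \<iota>\<close>, with \<open>T\<close> the set of strings that some homomorphism \<open>L \<rightarrow> M\<close> meets at the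
  middle.
\<close>

lemma automorphism_makes_isotropic:
  fixes N :: "(nat \<Rightarrow> complex) rep" and Q :: "'q::complex_vector rep"
  assumes thin: "thin_rep \<Gamma> L a z l" and m: "mid \<in> {a..z}" "\<sigma> mid \<in> {a..z}"
    and gen: "generic_embedding \<Gamma> L M \<iota>"
    and ex: "short_exact \<Gamma> L \<iota> M \<pi> Q" and ex2: "short_exact \<Gamma> N \<kappa> Q p (nabla \<Gamma> L)"
    and ext: "ext1_vanishes \<Gamma> L N"
  obtains g where "is_automorphism \<Gamma> M g" "bt (g mid (\<iota> mid (l mid))) (g mid (\<iota> mid (l mid))) = 0"
proof (cases "bt (\<iota> mid (l mid)) (\<iota> mid (l mid)) = 0")
  case True
  then show ?thesis using that[OF is_iso_id] by simp
next
  case False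
  interpret thin_rep \<Gamma> L a z l by fact
  obtain h w where h: "is_hom \<Gamma> L M h" and w: "is_hom \<Gamma> L M w"
    and b0: "bt (\<iota> mid (l mid)) (w mid (l mid)) = 0" and b1: "bt (h mid (l mid)) (w mid (l mid)) \<noteq> 0"
    by (rule form_has_rank_two[OF thin m ex ex2 ext False])
  have \<iota>: "is_hom \<Gamma> L M \<iota>" using gen by (auto simp: generic_embedding_def is_mono_def)
  note mv = mid_vert(1)
  have val: "u mid (l mid) \<in> rep_space M mid" if "is_hom \<Gamma> L M u" for u
    using hom_mem[OF that mv l_mem[OF mv]] .
  define x0 where "x0 = \<iota> mid (l mid)"
  have x0: "x0 \<in> rep_space M mid" unfolding x0_def by (rule val[OF \<iota>])
  define cv where "cv x = (\<lambda>k. cf k mid x)" for x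
  have bt_cv: "bt x y = bilin K gram (cv x) (cv y)" if "x \<in> rep_space M mid" "y \<in> rep_space M mid" for x y
    unfolding bilin_def cv_def by (rule bt_expand[OF that])
  define Orb where "Orb = {cv (g mid x0) |g. is_automorphism \<Gamma> M g}"
  define T where "T = {k \<in> K. \<exists>u. is_hom \<Gamma> L M u \<and> cf k mid (u mid (l mid)) \<noteq> 0}"
  have aut_mem: "g mid x0 \<in> rep_space M mid" if "is_automorphism \<Gamma> M g" for g
    using that is_hom_lin[of \<Gamma> M M g mid] mv x0 linear_mem by (auto simp: is_iso_def)
  have OrbI: "cv (g mid x0) \<in> Orb" if "is_automorphism \<Gamma> M g" for g using that by (auto simp: Orb_def)
  have "\<exists>x\<in>Orb. bilin K gram x x = 0"
  proof (rule isotropic_vector_in_orbit[where le = reaches and T = T and v = "cv x0"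
        and h = "cv (h mid (l mid))" and w = "cv (w mid (l mid))"])
    show "finite K" by (rule finite_through)
    show "gram k l = gram l k" if "k \<in> K" "l \<in> K" for k l by (rule gram_sym[OF that])
    show "cv x0 \<in> Orb" using OrbI[OF is_iso_id] by simp
    show "bilin K gram (cv x0) (cv (w mid (l mid))) = 0"
      using b0 bt_cv[OF x0 val[OF w]] by (simp add: x0_def)
    show "bilin K gram (cv (h mid (l mid))) (cv (w mid (l mid))) \<noteq> 0"
      using b1 bt_cv[OF val[OF h] val[OF w]] by simp
    show "k \<in> T" if "k \<in> K" "cv (h mid (l mid)) k \<noteq> 0" for k
      using that h unfolding T_def cv_def by blast
    show "k \<in> T" if "k \<in> K" "cv (w mid (l mid)) k \<noteq> 0" for k
      using that w unfolding T_def cv_def by blast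
    show "(\<exists>j\<in>K. reaches k j \<and> gram j k \<noteq> 0) \<or> (\<exists>j\<in>K. reaches l j \<and> gram j l \<noteq> 0)"
      if "k \<in> K" "l \<in> K" "gram k l \<noteq> 0" for k l by (rule gram_compare[OF that])
    show "\<exists>k\<in>K. cv x0 k \<noteq> 0 \<and> reaches k j" if j: "j \<in> T" for j
    proof -
      obtain u where jK: "j \<in> K" and u: "is_hom \<Gamma> L M u" "cf j mid (u mid (l mid)) \<noteq> 0" using j by (auto simp: T_def)
      obtain \<phi> where \<phi>: "is_hom \<Gamma> M M \<phi>" "cf j mid (\<phi> mid (\<iota> mid (l mid))) \<noteq> 0"
        by (rule generic_reaches[OF thin gen m(1) jK u])
      have lin: "linear_between (rep_space M mid) UNIV (\<lambda>x. cf j mid (\<phi> mid x))"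
        by (rule linear_comp[OF is_hom_lin[OF \<phi>(1) mv] cf_linear[OF mv]])
      have "cf j mid (\<phi> mid x0) = cf j mid (\<phi> mid (\<Sum>k\<in>K. cf k mid x0 *\<^sub>C b k mid))"
        using expand[OF mv x0] by simp
      also have "\<dots> = (\<Sum>k\<in>K. cf k mid x0 *\<^sub>C cf j mid (\<phi> mid (b k mid)))"
        by (rule linear_sum[OF lin sub[OF mv]]) (rule b_mem[OF K_I mv])
      finally have "(\<Sum>k\<in>K. cf k mid x0 *\<^sub>C cf j mid (\<phi> mid (b k mid))) \<noteq> 0" using \<phi>(2) by (simp add: x0_def)
      then obtain k where k: "k \<in> K" "cf k mid x0 *\<^sub>C cf j mid (\<phi> mid (b k mid)) \<noteq> 0"
        by (meson sum.not_neutral_contains_not_neutral)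
      then have "cv x0 k \<noteq> 0 \<and> reaches k j"
        using \<phi>(1) unfolding reaches_def cv_def by (auto simp: scaleC_complex_def)
      then show ?thesis using k(1) by blast
    qed
    show "x(j := x j + t * x k) \<in> Orb"
      if x: "x \<in> Orb" and kj: "k \<in> K" "j \<in> K" "k \<noteq> j" "reaches k j" for x k j t
    proof -
      obtain g where g: "is_automorphism \<Gamma> M g" "x = cv (g mid x0)" using x by (auto simp: Orb_def)
      obtain \<phi> where \<phi>: "is_hom \<Gamma> M M \<phi>" "cf j mid (\<phi> mid (b k mid)) \<noteq> 0" using kj(4) by (auto simp: reaches_def)
      obtain g' where g': "is_automorphism \<Gamma> M g'"
        "\<And>x i. x \<in> rep_space M mid \<Longrightarrow> cf i mid (g' mid x) = cf i mid x + (if i = j then t * cf k mid x else 0)"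
        using shear_automorphism[OF mv kj(1-3) \<phi>, of t] by blast
      have "x(j := x j + t * x k) = cv (g' mid (g mid x0))"
        using g'(2)[OF aut_mem[OF g(1)]] g(2) by (auto simp: cv_def)
      then show ?thesis using OrbI[OF is_iso_comp[OF g(1) g'(1)]] by simp
    qed
    show "(\<lambda>k. \<gamma> k * x k) \<in> Orb" if x: "x \<in> Orb" and \<gamma>: "\<forall>k\<in>K. \<gamma> k \<noteq> 0" for x \<gamma>
    proof -
      obtain g where g: "is_automorphism \<Gamma> M g" "x = cv (g mid x0)" using x by (auto simp: Orb_def)
      obtain g' where g': "is_automorphism \<Gamma> M g'"
        "\<And>i x k. i \<in> q_verts \<Gamma> \<Longrightarrow> x \<in> rep_space M i \<Longrightarrow> k \<in> I \<Longrightarrow>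
           cf k i (g' i x) = (if k \<in> K then \<gamma> k else 1) * cf k i x"
        by (rule torus_automorphism[of "\<lambda>k. if k \<in> K then \<gamma> k else 1"]) (use \<gamma> in auto)
      have "\<gamma> k * x k = cv (g' mid (g mid x0)) k" for k
      proof (cases "k \<in> K")
        case True
        then show ?thesis using g'(2)[OF mv aut_mem[OF g(1)] K_I[OF True]] g(2) by (simp add: cv_def)
      next
        case False
        then show ?thesis using g(2) by (simp add: cv_def cf_def coord_outside)
      qed
      then have "(\<lambda>k. \<gamma> k * x k) = cv (g' mid (g mid x0))" by blast
      then show ?thesis using OrbI[OF is_iso_comp[OF g(1) g'(1)]] by simp
    qed
  qed
  then obtain g where g: "is_automorphism \<Gamma> M g" "bilin K gram (cv (g mid x0)) (cv (g mid x0)) = 0"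
    by (auto simp: Orb_def)
  then have "bt (g mid x0) (g mid x0) = 0" using bt_cv[OF aut_mem[OF g(1)] aut_mem[OF g(1)]] by simp
  then show ?thesis using that[OF g(1)] by (simp add: x0_def)
qed

end

lemma generic_embedding_automorphism:
  assumes gen: "generic_embedding \<Gamma> L M \<iota>" and g: "is_automorphism \<Gamma> M g"
  shows "generic_embedding \<Gamma> L M (\<lambda>i. g i \<circ> \<iota> i)"
proof -
  obtain A \<pi> where A: "generic_quotient \<Gamma> L M A" and ex: "short_exact \<Gamma> L \<iota> M \<pi> (rep_of \<Gamma> (dim_diff M L) A)"
    using gen by (auto simp: generic_embedding_def)
  have M: "is_rep \<Gamma> M" using ex by (simp add: short_exact_def)
  note ex' = short_exact_transport[OF ex g M]
  then have "is_mono \<Gamma> L M (\<lambda>i. g i \<circ> \<iota> i)" by (simp add: short_exact_def)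
  then show ?thesis unfolding generic_embedding_def using A ex' by blast
qed

theorem proposition6p12:
  fixes \<Gamma> :: quiver and \<epsilon> :: complex
    and V :: "nat \<Rightarrow> 'v::complex_vector set"
    and B :: "nat \<Rightarrow> nat \<Rightarrow> 'v \<Rightarrow> 'v \<Rightarrow> complex"
    and M L :: "'v rep" and \<iota> :: "nat \<Rightarrow> 'v \<Rightarrow> 'v"
    and Q :: "'q::complex_vector rep" and \<pi> :: "nat \<Rightarrow> 'v \<Rightarrow> 'q"
    and K :: rep_point
  assumes "num_verts \<Gamma> \<ge> 2" and "symmetric_quiver \<Gamma>"
    and "\<epsilon> = 1 \<or> \<epsilon> = - 1" and "non_split_type \<Gamma> \<epsilon>"
    and "eps_representation \<Gamma> \<epsilon> V B M"
    and "is_subrep \<Gamma> L M" and "indecomposable \<Gamma> L"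
    and "generic_embedding \<Gamma> L M \<iota>" and "short_exact \<Gamma> L \<iota> M \<pi> Q"
    and "\<exists>p. is_epi \<Gamma> Q (nabla \<Gamma> L) p"
    and "generic_kernel \<Gamma> Q (nabla \<Gamma> L) K"
    and "ext1_vanishes \<Gamma> L (rep_of \<Gamma> (dim_diff Q (nabla \<Gamma> L)) K)"
  shows "\<exists>g. is_automorphism \<Gamma> M g \<and>
           isotropic_embedding \<Gamma> B L M (\<lambda>i. g i \<circ> \<iota> i) \<and>
           generic_embedding \<Gamma> L M (\<lambda>i. g i \<circ> \<iota> i)"
proof -
  interpret eps_rep \<Gamma> \<epsilon> V B M
    by unfold_locales (use assms in auto)
  have n1: "1 \<le> num_verts \<Gamma>" using assms(1) by simp
  obtain I c d b where sb: "string_basis \<Gamma> (num_verts \<Gamma>) M I c d b"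
    by (rule string_basis_exists[OF M_rep n1])
  interpret eps_strings \<Gamma> \<epsilon> V B M I c d b
    by unfold_locales (use M_rep sb assms(4) in auto)
  obtain a z l where thin: "thin_rep \<Gamma> L a z l"
    by (rule indecomposable_is_thin[OF assms(7) n1])
  obtain \<kappa> p where ex2: "short_exact \<Gamma> (rep_of \<Gamma> (dim_diff Q (nabla \<Gamma> L)) K) \<kappa> Q p (nabla \<Gamma> L)"
    using assms(11) by (auto simp: generic_kernel_def kernel_set_def)
  have "\<exists>g. is_automorphism \<Gamma> M g \<and> (mid \<in> {a..z} \<longrightarrow> \<sigma> mid \<in> {a..z} \<longrightarrow>
      bt (g mid (\<iota> mid (l mid))) (g mid (\<iota> mid (l mid))) = 0)"
  proof (cases "mid \<in> {a..z} \<and> \<sigma> mid \<in> {a..z}")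
    case True
    then have m: "mid \<in> {a..z}" "\<sigma> mid \<in> {a..z}" by auto
    obtain g where "is_automorphism \<Gamma> M g" "bt (g mid (\<iota> mid (l mid))) (g mid (\<iota> mid (l mid))) = 0"
      by (rule automorphism_makes_isotropic[OF thin m assms(8,9) ex2 assms(12)])
    then show ?thesis by blast
  next
    case False
    then show ?thesis using is_iso_id[of \<Gamma> M] by blast
  qed
  then obtain g where g: "is_automorphism \<Gamma> M g"
    "mid \<in> {a..z} \<Longrightarrow> \<sigma> mid \<in> {a..z} \<Longrightarrow> bt (g mid (\<iota> mid (l mid))) (g mid (\<iota> mid (l mid))) = 0"
    by blast
  have gen: "generic_embedding \<Gamma> L M (\<lambda>i. g i \<circ> \<iota> i)"
    by (rule generic_embedding_automorphism[OF assms(8) g(1)])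
  then have "is_mono \<Gamma> L M (\<lambda>i. g i \<circ> \<iota> i)" by (simp add: generic_embedding_def)
  then have "isotropic_embedding \<Gamma> B L M (\<lambda>i. g i \<circ> \<iota> i)"
    by (rule isotropic_embeddingI[OF thin]) (use g(2) in simp)
  then show ?thesis using g(1) gen by blast
qed

end
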